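(* Let $[S_1,S_2,U]$ be a full amalgam of inverse semigroups. Then \[ C^*(S_1 \ast_U S_2) \cong C^*(S_1) \ast_{C^*(U)} C^*(S_2), \] and, if $U$ has a zero (which is a common zero of $S_1$ and $S_2$), then \[ C^*_0(S_1 \ast_U S_2) \cong C^*_0(S_1) \ast_{C^*_0(U)} C^*_0(S_2). \]
   Context: An inverse semigroup is a semigroup $S$ in which every $s$ has a unique $s^{-1}$ with $ss^{-1}s=s$ and $s^{-1}ss^{-1}=s^{-1}$; $E(S)$ is its set of idempotents. An amalgam $[S_1,S_2,U]$ (or $[S_1,S_2,U,i_1,i_2]$) of inverse semigroups consists of inverse semigroups $S_1,S_2,U$ with embeddings $i_j:U\to S_j$; one regards $U$ as contained in $S_1$ and in $S_2$. It is full if $U$ is a full inverse subsemigroup of both, i.e. $E(U)=E(S_1)=E(S_2)$ (under the embeddings). In any category, the free product of $S_1$ and $S_2$ amalgamated over $U$, written $S_1\ast_U S_2$, is an object $T$ with morphisms $\psi_j:S_j\to T$ satisfying $\psi_1 i_1=\psi_2 i_2$, such that for every object $R$ and morphisms $\phi_j:S_j\to R$ with $\phi_1i_1=\phi_2i_2$ there is a unique morphism $\lambda:T\to R$ with $\lambda\psi_j=\phi_j$ for $j=1,2$. Here $S_1\ast_U S_2$ is taken in the category of inverse semigroups, and the amalgamated free products of $C^*$-algebras are taken in the category of $C^*$-algebras and $*$-homomorphisms. A representation of an inverse semigroup $S$ is a semigroup homomorphism $\rho:S\to B(\mathcal H)$, $\mathcal H$ a Hilbert space, with $\rho(s^{-1})=\rho(s)^*$.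 $C^*(S)$ is the universal $C^*$-algebra of $S$: there is a monomorphism $i:S\to C^*(S)$ such that each representation $\rho$ of $S$ on $\mathcal H$ has a unique extension to a representation $\tilde\rho:C^*(S)\to B(\mathcal H)$ with $\tilde\rho\circ i=\rho$. If $S$ has a zero, the contracted $C^*$-algebra $C^*_0(S)$ is defined by the same universal property restricted to representations sending $0$ to the zero operator; equivalently it is the quotient of $C^*(S)$ by the ideal generated by $0$ (a copy of $\mathbb C$). The maps $C^*(U)\to C^*(S_j)$ and $C^*_0(U)\to C^*_0(S_j)$ over which one amalgamates are those induced by the embeddings $i_j$. *)

theory Defs
  imports "HOL-Analysis.Analysis"
begin

section \<open>Complex Hilbert spaces and C*-algebras\<close>

class complex_normed_vector = real_normed_vector +
  fixes scaleC :: "complex \<Rightarrow> 'a \<Rightarrow> 'a"  (infixr \<open>*\<^sub>C\<close> 75)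
  assumes scaleC_add_right: "c *\<^sub>C (x + y) = c *\<^sub>C x + c *\<^sub>C y"
    and scaleC_add_left: "(c + d) *\<^sub>C x = c *\<^sub>C x + d *\<^sub>C x"
    and scaleC_scaleC: "c *\<^sub>C d *\<^sub>C x = (c * d) *\<^sub>C x"
    and scaleR_scaleC: "r *\<^sub>R x = complex_of_real r *\<^sub>C x"
    and norm_scaleC: "norm (c *\<^sub>C x) = cmod c * norm x"

class complex_hilbert_space = complex_normed_vector + banach +
  fixes cinner :: "'a \<Rightarrow> 'a \<Rightarrow> complex"
  assumes cinner_commute: "cinner x y = cnj (cinner y x)"
    and cinner_add_left: "cinner (x + y) z = cinner x z + cinner y z"
    and cinner_scaleC_left: "cinner (c *\<^sub>C x) y = c * cinner x y"
    and cinner_self: "cinner x x = complex_of_real ((norm x)\<^sup>2)"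

text \<open>C*-algebras need not have a unit, and the zero algebra is allowed.\<close>

class cstar_algebra = complex_normed_vector + real_normed_algebra + banach +
  fixes star :: "'a \<Rightarrow> 'a"
  assumes mult_scaleC_left: "(c *\<^sub>C x) * y = c *\<^sub>C (x * y)"
    and mult_scaleC_right: "x * (c *\<^sub>C y) = c *\<^sub>C (x * y)"
    and star_star: "star (star x) = x"
    and star_add: "star (x + y) = star x + star y"
    and star_scaleC: "star (c *\<^sub>C x) = cnj c *\<^sub>C star x"
    and star_mult: "star (x * y) = star y * star x"
    and cstar_identity: "norm (star x * x) = (norm x)\<^sup>2"

definition clinear :: "('a::complex_normed_vector \<Rightarrow> 'b::complex_normed_vector) \<Rightarrow> bool"
  where "clinear f \<longleftrightarrow>
    (\<forall>x y. f (x + y) = f x + f y) \<and> (\<forall>c x. f (c *\<^sub>C x) = c *\<^sub>C f x)"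

definition star_hom :: "('a::cstar_algebra \<Rightarrow> 'b::cstar_algebra) \<Rightarrow> bool"
  where "star_hom f \<longleftrightarrow> clinear f \<and>
    (\<forall>x y. f (x * y) = f x * f y) \<and> (\<forall>x. f (star x) = star (f x))"

definition bounded_operator :: "('h::complex_hilbert_space \<Rightarrow> 'h) \<Rightarrow> bool"
  where "bounded_operator A \<longleftrightarrow> clinear A \<and> (\<exists>K. \<forall>x. norm (A x) \<le> K * norm x)"

definition is_adjoint :: "('h::complex_hilbert_space \<Rightarrow> 'h) \<Rightarrow> ('h \<Rightarrow> 'h) \<Rightarrow> bool"
  where "is_adjoint A B \<longleftrightarrow> (\<forall>x y. cinner (A x) y = cinner x (B y))"

definition cstar_representation :: "('c::cstar_algebra \<Rightarrow> 'h::complex_hilbert_space \<Rightarrow> 'h) \<Rightarrow> bool"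
  where "cstar_representation \<pi> \<longleftrightarrow>
    (\<forall>a. bounded_operator (\<pi> a)) \<and>
    (\<forall>a b. \<pi> (a + b) = (\<lambda>x. \<pi> a x + \<pi> b x)) \<and>
    (\<forall>c a. \<pi> (c *\<^sub>C a) = (\<lambda>x. c *\<^sub>C \<pi> a x)) \<and>
    (\<forall>a b. \<pi> (a * b) = \<pi> a \<circ> \<pi> b) \<and>
    (\<forall>a. is_adjoint (\<pi> a) (\<pi> (star a)))"


section \<open>Inverse semigroups\<close>

record 'a semigroup_on =
  carrier :: "'a set"
  mul :: "'a \<Rightarrow> 'a \<Rightarrow> 'a"

definition is_inverse_of :: "'a semigroup_on \<Rightarrow> 'a \<Rightarrow> 'a \<Rightarrow> bool"
  where "is_inverse_of S s t \<longleftrightarrow> t \<in> carrier S \<and>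
    mul S (mul S s t) s = s \<and> mul S (mul S t s) t = t"

definition inverse_semigroup :: "'a semigroup_on \<Rightarrow> bool"
  where "inverse_semigroup S \<longleftrightarrow>
    carrier S \<noteq> {} \<and>
    (\<forall>x\<in>carrier S. \<forall>y\<in>carrier S. mul S x y \<in> carrier S) \<and>
    (\<forall>x\<in>carrier S. \<forall>y\<in>carrier S. \<forall>z\<in>carrier S.
       mul S (mul S x y) z = mul S x (mul S y z)) \<and>
    (\<forall>s\<in>carrier S. \<exists>!t. is_inverse_of S s t)"

definition inverse_in :: "'a semigroup_on \<Rightarrow> 'a \<Rightarrow> 'a"
  where "inverse_in S s = (THE t. is_inverse_of S s t)"

definition idempotents :: "'a semigroup_on \<Rightarrow> 'a set"
  where "idempotents S = {e \<in> carrier S. mul S e e = e}"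

definition is_zero_of :: "'a semigroup_on \<Rightarrow> 'a \<Rightarrow> bool"
  where "is_zero_of S z \<longleftrightarrow> z \<in> carrier S \<and> (\<forall>s\<in>carrier S. mul S z s = z \<and> mul S s z = z)"

definition semigroup_hom :: "'a semigroup_on \<Rightarrow> 'b semigroup_on \<Rightarrow> ('a \<Rightarrow> 'b) \<Rightarrow> bool"
  where "semigroup_hom S R f \<longleftrightarrow> f ` carrier S \<subseteq> carrier R \<and>
    (\<forall>x\<in>carrier S. \<forall>y\<in>carrier S. f (mul S x y) = mul R (f x) (f y))"

definition amalgam ::
  "'a semigroup_on \<Rightarrow> 'b semigroup_on \<Rightarrow> 'u semigroup_on \<Rightarrow> ('u \<Rightarrow> 'a) \<Rightarrow> ('u \<Rightarrow> 'b) \<Rightarrow> bool"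
  where "amalgam S1 S2 U i1 i2 \<longleftrightarrow>
    inverse_semigroup S1 \<and> inverse_semigroup S2 \<and> inverse_semigroup U \<and>
    semigroup_hom U S1 i1 \<and> inj_on i1 (carrier U) \<and>
    semigroup_hom U S2 i2 \<and> inj_on i2 (carrier U)"

definition full_amalgam ::
  "'a semigroup_on \<Rightarrow> 'b semigroup_on \<Rightarrow> 'u semigroup_on \<Rightarrow> ('u \<Rightarrow> 'a) \<Rightarrow> ('u \<Rightarrow> 'b) \<Rightarrow> bool"
  where "full_amalgam S1 S2 U i1 i2 \<longleftrightarrow> amalgam S1 S2 U i1 i2 \<and>
    i1 ` idempotents U = idempotents S1 \<and> i2 ` idempotents U = idempotents S2"


section \<open>Free products with amalgamation\<close>

text \<open>
  A formula of HOL cannot quantify over types, so a universal property takes as an argument the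
  type of the objects it is tested on.  A theorem that holds for a type variable in this place
  covers all objects; a theorem that assumes the property for some test types only assumes less
  than the full universal property.  The uniqueness clause is stated for functions on
  \<open>carrier T\<close>, hence the restriction to extensional functions.
\<close>

definition semigroup_free_product ::
  "'r itself \<Rightarrow> 'a semigroup_on \<Rightarrow> 'b semigroup_on \<Rightarrow> 'u semigroup_on \<Rightarrow>
   ('u \<Rightarrow> 'a) \<Rightarrow> ('u \<Rightarrow> 'b) \<Rightarrow> 't semigroup_on \<Rightarrow> ('a \<Rightarrow> 't) \<Rightarrow> ('b \<Rightarrow> 't) \<Rightarrow> bool"
  where "semigroup_free_product _ S1 S2 U i1 i2 T \<psi>1 \<psi>2 \<longleftrightarrow>
    inverse_semigroup T \<and> semigroup_hom S1 T \<psi>1 \<and> semigroup_hom S2 T \<psi>2 \<and>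
    (\<forall>u\<in>carrier U. \<psi>1 (i1 u) = \<psi>2 (i2 u)) \<and>
    (\<forall>(R :: 'r semigroup_on) \<phi>1 \<phi>2.
       inverse_semigroup R \<and> semigroup_hom S1 R \<phi>1 \<and> semigroup_hom S2 R \<phi>2 \<and>
       (\<forall>u\<in>carrier U. \<phi>1 (i1 u) = \<phi>2 (i2 u)) \<longrightarrow>
       (\<exists>!l. l \<in> extensional (carrier T) \<and> semigroup_hom T R l \<and>
          (\<forall>s\<in>carrier S1. l (\<psi>1 s) = \<phi>1 s) \<and> (\<forall>s\<in>carrier S2. l (\<psi>2 s) = \<phi>2 s)))"

text \<open>
  Here the C*-algebras are types: \<open>j1\<close> and \<open>j2\<close> map the amalgamated algebra \<open>'u\<close> into the
  factors \<open>'a\<close> and \<open>'b\<close>, and \<open>'p\<close> with \<open>\<eta>1\<close> and \<open>\<eta>2\<close> is the free product.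
\<close>

definition cstar_free_product ::
  "'r::cstar_algebra itself \<Rightarrow>
   ('u::cstar_algebra \<Rightarrow> 'a::cstar_algebra) \<Rightarrow> ('u \<Rightarrow> 'b::cstar_algebra) \<Rightarrow>
   ('a \<Rightarrow> 'p::cstar_algebra) \<Rightarrow> ('b \<Rightarrow> 'p) \<Rightarrow> bool"
  where "cstar_free_product _ j1 j2 \<eta>1 \<eta>2 \<longleftrightarrow>
    star_hom \<eta>1 \<and> star_hom \<eta>2 \<and> \<eta>1 \<circ> j1 = \<eta>2 \<circ> j2 \<and>
    (\<forall>(\<phi>1 :: 'a \<Rightarrow> 'r) (\<phi>2 :: 'b \<Rightarrow> 'r).
       star_hom \<phi>1 \<and> star_hom \<phi>2 \<and> \<phi>1 \<circ> j1 = \<phi>2 \<circ> j2 \<longrightarrow>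
       (\<exists>!l. star_hom l \<and> l \<circ> \<eta>1 = \<phi>1 \<and> l \<circ> \<eta>2 = \<phi>2))"

definition cstar_isomorphism :: "('a::cstar_algebra \<Rightarrow> 'b::cstar_algebra) \<Rightarrow> bool"
  where "cstar_isomorphism f \<longleftrightarrow> star_hom f \<and> bij f"


section \<open>C*-algebras of inverse semigroups\<close>

definition representation ::
  "'s semigroup_on \<Rightarrow> ('s \<Rightarrow> 'h::complex_hilbert_space \<Rightarrow> 'h) \<Rightarrow> bool"
  where "representation S \<rho> \<longleftrightarrow>
    (\<forall>s\<in>carrier S. bounded_operator (\<rho> s)) \<and>
    (\<forall>s\<in>carrier S. \<forall>t\<in>carrier S. \<rho> (mul S s t) = \<rho> s \<circ> \<rho> t) \<and>
    (\<forall>s\<in>carrier S. is_adjoint (\<rho> s) (\<rho> (inverse_in S s)))"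

definition star_monomorphism :: "'s semigroup_on \<Rightarrow> ('s \<Rightarrow> 'c::cstar_algebra) \<Rightarrow> bool"
  where "star_monomorphism S k \<longleftrightarrow> inj_on k (carrier S) \<and>
    (\<forall>s\<in>carrier S. \<forall>t\<in>carrier S. k (mul S s t) = k s * k t) \<and>
    (\<forall>s\<in>carrier S. k (inverse_in S s) = star (k s))"

text \<open>The type \<open>'c\<close> with \<open>k\<close> is the universal C*-algebra of \<open>S\<close>, tested on the Hilbert space \<open>'h\<close>.\<close>

definition universal_cstar_algebra ::
  "'h::complex_hilbert_space itself \<Rightarrow> 's semigroup_on \<Rightarrow> ('s \<Rightarrow> 'c::cstar_algebra) \<Rightarrow> bool"
  where "universal_cstar_algebra _ S k \<longleftrightarrow> star_monomorphism S k \<and>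
    (\<forall>\<rho> :: 's \<Rightarrow> 'h \<Rightarrow> 'h. representation S \<rho> \<longrightarrow>
       (\<exists>!\<pi> :: 'c \<Rightarrow> 'h \<Rightarrow> 'h. cstar_representation \<pi> \<and> (\<forall>s\<in>carrier S. \<pi> (k s) = \<rho> s)))"

text \<open>
  In the contracted algebra the image of the zero has to vanish as well: the (uncontracted)
  universal algebra already extends the representations that annihilate the zero, uniquely.
\<close>

definition contracted_cstar_algebra ::
  "'h::complex_hilbert_space itself \<Rightarrow> 's semigroup_on \<Rightarrow> ('s \<Rightarrow> 'c::cstar_algebra) \<Rightarrow> bool"
  where "contracted_cstar_algebra _ S k \<longleftrightarrow>
    star_monomorphism S k \<and> (\<forall>z. is_zero_of S z \<longrightarrow> k z = 0) \<and>
    (\<forall>\<rho> :: 's \<Rightarrow> 'h \<Rightarrow> 'h. representation S \<rho> \<and> (\<forall>z. is_zero_of S z \<longrightarrow> \<rho> z = (\<lambda>x. 0)) \<longrightarrow>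
       (\<exists>!\<pi> :: 'c \<Rightarrow> 'h \<Rightarrow> 'h. cstar_representation \<pi> \<and> (\<forall>s\<in>carrier S. \<pi> (k s) = \<rho> s)))"

text \<open>The homomorphism between C*-algebras of \<open>U\<close> and \<open>S\<close> induced by \<open>i\<close>.\<close>

definition induced_hom ::
  "'u semigroup_on \<Rightarrow> ('u \<Rightarrow> 's) \<Rightarrow> ('u \<Rightarrow> 'c::cstar_algebra) \<Rightarrow> ('s \<Rightarrow> 'd::cstar_algebra) \<Rightarrow>
   ('c \<Rightarrow> 'd) \<Rightarrow> bool"
  where "induced_hom U i kU kS j \<longleftrightarrow> star_hom j \<and> (\<forall>u\<in>carrier U. j (kU u) = kS (i u))"


section \<open>Square-summable families\<close>

text \<open>
  Every Hilbert space has an orthonormal basis, hence is isometric to the space of square-summable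
  families over some index type.  A representation on a Hilbert space of smaller dimension
  becomes one on a larger space by letting it act as zero on the orthogonal complement.
\<close>

typedef 'i ell2 = "{f :: 'i \<Rightarrow> complex. (\<lambda>i. (cmod (f i))\<^sup>2) summable_on UNIV}"
  by (rule exI[of _ "\<lambda>_. 0"]) simp

setup_lifting type_definition_ell2

lemma ell2_bound:
  assumes "(\<lambda>i. (cmod (f i))\<^sup>2) summable_on UNIV" "finite F"
  shows "L2_set (\<lambda>i. cmod (f i)) F \<le> sqrt (\<Sum>\<^sub>\<infinity>i. (cmod (f i))\<^sup>2)"
  unfolding L2_set_def
  by (intro real_sqrt_le_mono finite_sum_le_infsum) (use assms in auto)

lemma ell2_boundI:
  assumes "\<And>F. finite F \<Longrightarrow> L2_set (\<lambda>i. cmod (f i)) F \<le> C"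
  shows "(\<lambda>i. (cmod (f i))\<^sup>2) summable_on UNIV" "sqrt (\<Sum>\<^sub>\<infinity>i. (cmod (f i))\<^sup>2) \<le> C"
proof -
  have C: "C \<ge> 0" using assms[of "{}"] by simp
  have *: "(\<Sum>i\<in>F. (cmod (f i))\<^sup>2) \<le> C\<^sup>2" if "finite F" for F
    using assms[OF that] unfolding L2_set_def by (rule sqrt_le_D)
  show 1: "(\<lambda>i. (cmod (f i))\<^sup>2) summable_on UNIV"
    by (rule nonneg_bdd_above_summable_on) (auto intro!: bdd_aboveI2[where M = "C\<^sup>2"] *)
  have "(\<Sum>\<^sub>\<infinity>i. (cmod (f i))\<^sup>2) \<le> C\<^sup>2"
    by (rule infsum_le_finite_sums[OF 1]) (use * in auto)
  thus "sqrt (\<Sum>\<^sub>\<infinity>i. (cmod (f i))\<^sup>2) \<le> C"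
    using C by (simp add: real_le_lsqrt)
qed

lemma ell2_add:
  assumes "(\<lambda>i. (cmod (f i))\<^sup>2) summable_on UNIV" "(\<lambda>i. (cmod (g i))\<^sup>2) summable_on UNIV"
  shows "(\<lambda>i. (cmod (f i + g i))\<^sup>2) summable_on UNIV"
    "sqrt (\<Sum>\<^sub>\<infinity>i. (cmod (f i + g i))\<^sup>2) \<le>
       sqrt (\<Sum>\<^sub>\<infinity>i. (cmod (f i))\<^sup>2) + sqrt (\<Sum>\<^sub>\<infinity>i. (cmod (g i))\<^sup>2)"
proof -
  have *: "L2_set (\<lambda>i. cmod (f i + g i)) F \<le>
      sqrt (\<Sum>\<^sub>\<infinity>i. (cmod (f i))\<^sup>2) + sqrt (\<Sum>\<^sub>\<infinity>i. (cmod (g i))\<^sup>2)" if F: "finite F" for F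
  proof -
    have "L2_set (\<lambda>i. cmod (f i + g i)) F \<le> L2_set (\<lambda>i. cmod (f i) + cmod (g i)) F"
      by (intro L2_set_mono) (auto intro: norm_triangle_ineq)
    also have "\<dots> \<le> L2_set (\<lambda>i. cmod (f i)) F + L2_set (\<lambda>i. cmod (g i)) F"
      by (rule L2_set_triangle_ineq)
    also have "\<dots> \<le> sqrt (\<Sum>\<^sub>\<infinity>i. (cmod (f i))\<^sup>2) + sqrt (\<Sum>\<^sub>\<infinity>i. (cmod (g i))\<^sup>2)"
      by (intro add_mono ell2_bound assms F)
    finally show ?thesis .
  qed
  show "(\<lambda>i. (cmod (f i + g i))\<^sup>2) summable_on UNIV"
    "sqrt (\<Sum>\<^sub>\<infinity>i. (cmod (f i + g i))\<^sup>2) \<le>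
       sqrt (\<Sum>\<^sub>\<infinity>i. (cmod (f i))\<^sup>2) + sqrt (\<Sum>\<^sub>\<infinity>i. (cmod (g i))\<^sup>2)"
    using ell2_boundI[of "\<lambda>i. f i + g i", OF *] by auto
qed

lemma ell2_scale:
  assumes "(\<lambda>i. (cmod (f i))\<^sup>2) summable_on UNIV"
  shows "(\<lambda>i. (cmod (c * f i))\<^sup>2) summable_on UNIV"
  using summable_on_cmult_right[OF assms, of "(cmod c)\<^sup>2"]
  by (simp add: norm_mult power_mult_distrib)

lemma ell2_inner_summable:
  assumes "(\<lambda>i. (cmod (f i))\<^sup>2) summable_on UNIV" "(\<lambda>i. (cmod (g i))\<^sup>2) summable_on UNIV"
  shows "(\<lambda>i. f i * cnj (g i)) summable_on UNIV"
proof -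
  have "(\<lambda>i. norm (f i * cnj (g i))) summable_on UNIV"
  proof (rule summable_on_comparison_test)
    show "(\<lambda>i. (cmod (f i))\<^sup>2 + (cmod (g i))\<^sup>2) summable_on UNIV"
      by (intro summable_on_add assms)
    show "norm (f i * cnj (g i)) \<le> (cmod (f i))\<^sup>2 + (cmod (g i))\<^sup>2" for i
    proof -
      have "2 * (cmod (f i) * cmod (g i)) \<le> (cmod (f i))\<^sup>2 + (cmod (g i))\<^sup>2"
        using sum_squares_bound[of "cmod (f i)" "cmod (g i)"] by simp
      moreover have "0 \<le> cmod (f i) * cmod (g i)" by simp
      ultimately show ?thesis unfolding norm_mult complex_mod_cnj by linarith
    qed
  qed auto
  thus ?thesis by (rule abs_summable_summable)
qed

instantiation ell2 :: (type) complex_normed_vector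
begin

lift_definition zero_ell2 :: "'a ell2" is "\<lambda>_. 0" by simp
lift_definition plus_ell2 :: "'a ell2 \<Rightarrow> 'a ell2 \<Rightarrow> 'a ell2" is "\<lambda>f g i. f i + g i"
  by (simp add: ell2_add)
lift_definition uminus_ell2 :: "'a ell2 \<Rightarrow> 'a ell2" is "\<lambda>f i. - f i" by simp
lift_definition minus_ell2 :: "'a ell2 \<Rightarrow> 'a ell2 \<Rightarrow> 'a ell2" is "\<lambda>f g i. f i - g i"
  using ell2_add[of _ "\<lambda>i. - _ i"] by simp
lift_definition scaleC_ell2 :: "complex \<Rightarrow> 'a ell2 \<Rightarrow> 'a ell2" is "\<lambda>c f i. c * f i"
  by (simp add: ell2_scale)
lift_definition scaleR_ell2 :: "real \<Rightarrow> 'a ell2 \<Rightarrow> 'a ell2" is "\<lambda>r f i. complex_of_real r * f i"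
  by (simp add: ell2_scale)
lift_definition norm_ell2 :: "'a ell2 \<Rightarrow> real" is "\<lambda>f. sqrt (\<Sum>\<^sub>\<infinity>i. (cmod (f i))\<^sup>2)" .

definition "dist (x :: 'a ell2) y = norm (x - y)"
definition "sgn (x :: 'a ell2) = inverse (norm x) *\<^sub>R x"
definition [code del]:
  "(uniformity :: ('a ell2 \<times> 'a ell2) filter) = (INF e\<in>{0<..}. principal {(x, y). dist x y < e})"
definition [code del]:
  "open (S :: 'a ell2 set) =
    (\<forall>x\<in>S. \<forall>\<^sub>F (x', y) in uniformity. x' = x \<longrightarrow> y \<in> S)"

instance
proof
  fix x y z :: "'a ell2" and a b :: real and c d :: complex
  show "x + y + z = x + (y + z)" "x + y = y + x" "0 + x = x" "- x + x = 0" "x - y = x + - y"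
    by (transfer; simp add: algebra_simps)+
  show "a *\<^sub>R (x + y) = a *\<^sub>R x + a *\<^sub>R y" "(a + b) *\<^sub>R x = a *\<^sub>R x + b *\<^sub>R x"
    "a *\<^sub>R b *\<^sub>R x = (a * b) *\<^sub>R x" "1 *\<^sub>R x = x"
    by (transfer; simp add: algebra_simps)+
  show "c *\<^sub>C (x + y) = c *\<^sub>C x + c *\<^sub>C y" "(c + d) *\<^sub>C x = c *\<^sub>C x + d *\<^sub>C x"
    "c *\<^sub>C d *\<^sub>C x = (c * d) *\<^sub>C x" "a *\<^sub>R x = complex_of_real a *\<^sub>C x"
    by (transfer; simp add: algebra_simps)+
  show "dist x y = norm (x - y)" "sgn x = inverse (norm x) *\<^sub>R x"
    by (simp_all add: dist_ell2_def sgn_ell2_def)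
  show "uniformity = (INF e\<in>{0<..}. principal {(x, y :: 'a ell2). dist x y < e})"
    by (fact uniformity_ell2_def)
  show "open S = (\<forall>x\<in>S. \<forall>\<^sub>F (x', y) in uniformity. x' = x \<longrightarrow> y \<in> S)" for S :: "'a ell2 set"
    by (fact open_ell2_def)
  show "norm (x + y) \<le> norm x + norm y"
    by transfer (simp add: ell2_add)
  show scale: "norm (c *\<^sub>C x) = cmod c * norm x" for c
    by transfer (simp add: norm_mult power_mult_distrib infsum_cmult_right' real_sqrt_mult)
  show "norm (a *\<^sub>R x) = \<bar>a\<bar> * norm x"
    by transfer (simp add: norm_mult power_mult_distrib infsum_cmult_right' real_sqrt_mult)
  show "norm x = 0 \<longleftrightarrow> x = 0"
  proof
    show "norm x = 0 \<Longrightarrow> x = 0"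
    proof transfer
      fix f :: "'a \<Rightarrow> complex"
      assume f: "(\<lambda>i. (cmod (f i))\<^sup>2) summable_on UNIV" "sqrt (\<Sum>\<^sub>\<infinity>i. (cmod (f i))\<^sup>2) = 0"
      have "f i = 0" for i
        using ell2_bound[OF f(1), of "{i}"] f(2) by (simp add: L2_set_def)
      thus "f = (\<lambda>_. 0)" by auto
    qed
  qed (transfer, simp)
qed

end

lemma ell2_component_le: "cmod (Rep_ell2 x i) \<le> norm x"
proof transfer
  fix f :: "'a \<Rightarrow> complex" and i
  assume "(\<lambda>i. (cmod (f i))\<^sup>2) summable_on UNIV"
  from ell2_bound[OF this, of "{i}"] show "cmod (f i) \<le> sqrt (\<Sum>\<^sub>\<infinity>i. (cmod (f i))\<^sup>2)"
    by (simp add: L2_set_def)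
qed

instance ell2 :: (type) banach
proof
  fix X :: "nat \<Rightarrow> 'a ell2"
  assume "Cauchy X"
  have ptw: "Cauchy (\<lambda>n. Rep_ell2 (X n) i)" for i
  proof (rule metric_CauchyI)
    fix e :: real assume "e > 0"
    then obtain N where N: "\<And>m n. m \<ge> N \<Longrightarrow> n \<ge> N \<Longrightarrow> dist (X m) (X n) < e"
      using metric_CauchyD[OF \<open>Cauchy X\<close>] by blast
    have "dist (Rep_ell2 (X m) i) (Rep_ell2 (X n) i) \<le> dist (X m) (X n)" for m n
      using ell2_component_le[of "X m - X n" i] by (simp add: dist_norm minus_ell2.rep_eq)
    thus "\<exists>N. \<forall>m\<ge>N. \<forall>n\<ge>N. dist (Rep_ell2 (X m) i) (Rep_ell2 (X n) i) < e"
      using N by (meson le_less_trans)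
  qed
  define f where "f i = lim (\<lambda>n. Rep_ell2 (X n) i)" for i
  have f: "(\<lambda>n. Rep_ell2 (X n) i) \<longlonglongrightarrow> f i" for i
    using ptw[of i] by (simp add: f_def Cauchy_convergent_iff convergent_LIMSEQ_iff)
  have bound: "L2_set (\<lambda>i. cmod (Rep_ell2 (X m) i - f i)) F \<le> e"
    if N: "\<And>m n. m \<ge> N \<Longrightarrow> n \<ge> N \<Longrightarrow> dist (X m) (X n) < e" and "m \<ge> N" "finite F"
    for e N m F
  proof (rule LIMSEQ_le_const2)
    show "(\<lambda>n. L2_set (\<lambda>i. cmod (Rep_ell2 (X m) i - Rep_ell2 (X n) i)) F)
        \<longlonglongrightarrow> L2_set (\<lambda>i. cmod (Rep_ell2 (X m) i - f i)) F"
      unfolding L2_set_def by (intro tendsto_intros f)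
    show "\<exists>N. \<forall>n\<ge>N. L2_set (\<lambda>i. cmod (Rep_ell2 (X m) i - Rep_ell2 (X n) i)) F \<le> e"
    proof (intro exI allI impI)
      fix n assume "n \<ge> N"
      have "L2_set (\<lambda>i. cmod (Rep_ell2 (X m - X n) i)) F \<le> norm (X m - X n)"
        unfolding norm_ell2.rep_eq using Rep_ell2[of "X m - X n"] \<open>finite F\<close>
        by (intro ell2_bound) auto
      also have "\<dots> \<le> e" using N[OF \<open>m \<ge> N\<close> \<open>n \<ge> N\<close>] by (simp add: dist_norm)
      finally show "L2_set (\<lambda>i. cmod (Rep_ell2 (X m) i - Rep_ell2 (X n) i)) F \<le> e"
        by (simp add: minus_ell2.rep_eq)
    qed
  qed
  obtain N1 where N1: "\<And>m n. m \<ge> N1 \<Longrightarrow> n \<ge> N1 \<Longrightarrow> dist (X m) (X n) < 1"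
    using metric_CauchyD[OF \<open>Cauchy X\<close>, of 1] by auto
  have "(\<lambda>i. (cmod (Rep_ell2 (X N1) i - f i))\<^sup>2) summable_on UNIV"
    by (rule ell2_boundI(1), rule bound[OF N1 order_refl])
  with Rep_ell2[of "X N1"]
  have "(\<lambda>i. (cmod (Rep_ell2 (X N1) i + - (Rep_ell2 (X N1) i - f i)))\<^sup>2) summable_on UNIV"
    by (intro ell2_add(1)) (auto simp: norm_minus_commute)
  hence sum: "(\<lambda>i. (cmod (f i))\<^sup>2) summable_on UNIV" by simp
  define L where "L = Abs_ell2 f"
  have L: "Rep_ell2 L = f" using sum by (simp add: L_def Abs_ell2_inverse)
  have "X \<longlonglongrightarrow> L"
  proof (rule metric_LIMSEQ_I)
    fix e :: real assume "e > 0"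
    then obtain N where N: "\<And>m n. m \<ge> N \<Longrightarrow> n \<ge> N \<Longrightarrow> dist (X m) (X n) < e / 2"
      using metric_CauchyD[OF \<open>Cauchy X\<close>, of "e / 2"] by auto
    have "dist (X m) L \<le> e / 2" if "m \<ge> N" for m
      using ell2_boundI(2)[of "\<lambda>i. Rep_ell2 (X m) i - f i", OF bound[OF N that]]
      by (simp add: dist_norm norm_ell2.rep_eq minus_ell2.rep_eq L)
    thus "\<exists>N. \<forall>n\<ge>N. dist (X n) L < e"
      using \<open>e > 0\<close> by (intro exI[of _ N]) fastforce
  qed
  thus "convergent X" by (rule convergentI)
qed

instantiation ell2 :: (type) complex_hilbert_space
begin

lift_definition cinner_ell2 :: "'a ell2 \<Rightarrow> 'a ell2 \<Rightarrow> complex"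
  is "\<lambda>f g. \<Sum>\<^sub>\<infinity>i. f i * cnj (g i)" .

instance
proof
  fix x y z :: "'a ell2" and c :: complex
  show "cinner x y = cnj (cinner y x)"
    by transfer (simp add: mult.commute flip: infsum_cnj)
  show "cinner (x + y) z = cinner x z + cinner y z"
    by transfer (simp add: distrib_right infsum_add ell2_inner_summable)
  show "cinner (c *\<^sub>C x) y = c * cinner x y"
    by transfer (simp add: mult.assoc infsum_cmult_right')
  show "cinner x x = complex_of_real ((norm x)\<^sup>2)"
  proof transfer
    fix f :: "'a \<Rightarrow> complex"
    assume f: "(\<lambda>i. (cmod (f i))\<^sup>2) summable_on UNIV"
    have "(\<Sum>\<^sub>\<infinity>i. f i * cnj (f i)) = (\<Sum>\<^sub>\<infinity>i. complex_of_real ((cmod (f i))\<^sup>2))"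
      by (simp only: complex_norm_square)
    also have "\<dots> = complex_of_real (\<Sum>\<^sub>\<infinity>i. (cmod (f i))\<^sup>2)"
      by (rule infsumI) (use f in \<open>simp only: has_sum_of_real_iff has_sum_infsum\<close>)
    finally show "(\<Sum>\<^sub>\<infinity>i. f i * cnj (f i)) = complex_of_real ((sqrt (\<Sum>\<^sub>\<infinity>i. (cmod (f i))\<^sup>2))\<^sup>2)"
      by (simp add: infsum_nonneg)
  qed
qed

end

end

theory Submission
  imports Defs
begin

text \<open>
  A star-preserving multiplicative map \<open>\<theta>\<close> from an inverse semigroup \<open>S\<close> to a C*-algebra extends
  uniquely to \<open>C\<^sup>*(S)\<close>: by the Gelfand--Naimark construction the norms of the target are attained by
  representations on the test Hilbert space, composing them with \<open>\<theta>\<close> gives representations of \<open>S\<close>,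
  so \<open>\<theta>\<close> is contractive on the span of \<open>S\<close>.  The span is dense because extensions of
  representations are unique (epimorphisms of C*-algebras are surjective).

  The maps \<open>S\<^sub>j \<rightarrow> T \<rightarrow> C\<^sup>*(T)\<close> extend to \<open>C\<^sup>*(S\<^sub>j)\<close> and induce a homomorphism \<open>g\<close> from the
  free product \<open>P\<close> to \<open>C\<^sup>*(T)\<close>.  In the other direction, the images of \<open>S\<^sub>1\<close> and \<open>S\<^sub>2\<close> in \<open>P\<close>
  consist of partial isometries.  Since the amalgam is full, they share the same commuting projections,
  and these are preserved under conjugation, so the images generate an inverse semigroup in \<open>P\<close>.  The
  universal property of \<open>T\<close> maps \<open>T\<close> into it, and the extension to \<open>C\<^sup>*(T)\<close> is inverse to \<open>g\<close>.

  Spectral theory is replaced by the power series of \<open>sqrt (1 - x)\<close>, which converges for \<open>\<parallel>x\<parallel> \<le> 1\<close>.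
\<close>

section \<open>Positive elements of unital C*-algebras\<close>

text \<open>A universal property can only be tested on one type at a time, and this shapes the
  analysis. Quotient and completion of an algebra by a positive functional would create a new type
  for every functional. Instead the GNS space is realised inside the fixed space
  \<open>'i ell2\<close>: a linear map reproduces the form, and the operators vanish on the
  orthogonal complement of its range. For this \<open>'i\<close> must be large enough to index the
  unitization; a cardinality argument shows that an injection of the algebra itself into
  \<open>'i\<close> suffices, unless the algebra is zero. The definition of the universal algebra
  speaks of representations on Hilbert spaces only. Maps into C*-algebras, and the fact that the
  image of \<open>S\<close> generates, have to be reached from there, and the second requires two
  positive functionals that agree on a subalgebra without being equal. The universal and the
  contracted statement are proved at once, as the cases of an algebra that is universal for maps
  vanishing on a prescribed set \<open>Z\<close>.\<close>

class unital_cstar_algebra = cstar_algebra + real_normed_algebra_1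

section \<open>Scalars and involution\<close>

lemma scaleC_eqs [simp]:
  fixes x :: "'a::complex_normed_vector"
  shows "1 *\<^sub>C x = x" "0 *\<^sub>C x = 0" "c *\<^sub>C (0::'a) = 0" "(-c) *\<^sub>C x = - (c *\<^sub>C x)"
    "c *\<^sub>C (-x) = - (c *\<^sub>C x)" "c *\<^sub>C d *\<^sub>C x = (c * d) *\<^sub>C x"
proof -
  show 1: "1 *\<^sub>C x = x" using scaleR_scaleC[of 1 x] by simp
  show 2: "0 *\<^sub>C x = 0" using scaleC_add_left[of 0 0 x] by simp
  show 3: "c *\<^sub>C (0::'a) = 0" using scaleC_add_right[of c "0::'a" 0] by simp
  show "(-c) *\<^sub>C x = - (c *\<^sub>C x)" using scaleC_add_left[of "-c" c x] 2 by (simp add: eq_neg_iff_add_eq_0)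
  show "c *\<^sub>C (-x) = - (c *\<^sub>C x)" using scaleC_add_right[of c "-x" x] 3 by (simp add: eq_neg_iff_add_eq_0)
  show "c *\<^sub>C d *\<^sub>C x = (c * d) *\<^sub>C x" by (rule scaleC_scaleC)
qed

lemma scaleC_diff_right: "c *\<^sub>C (x - y) = c *\<^sub>C x - c *\<^sub>C (y::'a::complex_normed_vector)"
  using scaleC_add_right[of c x "-y"] by simp

lemma scaleC_diff_left: "(c - d) *\<^sub>C x = c *\<^sub>C x - d *\<^sub>C (x::'a::complex_normed_vector)"
  using scaleC_add_left[of c "-d" x] by simp

lemma bounded_linear_scaleC: "bounded_linear (\<lambda>x::'a::complex_normed_vector. c *\<^sub>C x)"
  by (rule bounded_linear_intro[where K = "cmod c"])
    (auto simp: scaleC_add_right scaleR_scaleC norm_scaleC mult.commute)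

lemma star_simps [simp]:
  fixes x y :: "'a::cstar_algebra"
  shows "star (0::'a) = 0" "star (- x) = - star x" "star (x - y) = star x - star y"
    "star (r *\<^sub>R x) = r *\<^sub>R star x" "star (star x) = x" "star (x + y) = star x + star y"
    "star (c *\<^sub>C x) = cnj c *\<^sub>C star x" "star (x * y) = star y * star x"
proof -
  show 0: "star (0::'a) = 0" using star_add[of "0::'a" 0] by simp
  show 1: "star (- x) = - star x" for x :: 'a
    using star_add[of "-x" x] 0 by (simp add: eq_neg_iff_add_eq_0)
  show "star (x - y) = star x - star y" using star_add[of x "-y"] 1 by simp
  show "star (r *\<^sub>R x) = r *\<^sub>R star x" by (simp add: scaleR_scaleC star_scaleC)
qed (simp_all add: star_star star_add star_scaleC star_mult)

lemma norm_star [simp]: "norm (star x) = norm (x::'a::cstar_algebra)"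
proof -
  have "norm x \<le> norm (star x)" for x :: 'a
  proof (cases "x = 0")
    case False
    have "(norm x)\<^sup>2 \<le> norm (star x) * norm x"
      unfolding cstar_identity[symmetric] by (rule norm_mult_ineq)
    thus ?thesis using False by (simp add: power2_eq_square)
  qed simp
  from this[of x] this[of "star x"] show ?thesis by simp
qed

lemma bounded_linear_star: "bounded_linear (star :: 'a \<Rightarrow> 'a::cstar_algebra)"
  by (rule bounded_linear_intro[where K = 1]) auto

lemma star_one [simp]: "star 1 = (1::'a::unital_cstar_algebra)"
  by (metis mult_1 star_mult star_star mult_1_right)

lemma star_of_real [simp]: "star (of_real t) = (of_real t::'a::unital_cstar_algebra)"
  by (simp add: of_real_def)

lemma norm_selfadjoint_square:
  "star x = x \<Longrightarrow> norm (x * x) = (norm (x::'a::cstar_algebra))\<^sup>2"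
  using cstar_identity[of x] by simp

section \<open>Coefficients of the binomial series of sqrt (1 - x)\<close>

definition sqrt_coeff :: "nat \<Rightarrow> real"
  where "sqrt_coeff k = (1/2 gchoose k) * (- 1) ^ k"

text \<open>The ratio of consecutive coefficients of (1 - x)^a. Its sign is read off twice: for a =
  1/2 it makes every coefficient after the first nonpositive, for a = -1/2 it keeps all of them
  nonnegative.\<close>

lemma gbinomial_alternating_Suc:
  fixes a :: real
  shows "(a gchoose Suc k) * (-1) ^ Suc k = (a gchoose k) * (-1) ^ k * ((real k - a) / real (Suc k))"
proof -
  have "real (Suc k) * (a gchoose Suc k) = (a - real k) * (a gchoose k)"
    using gbinomial_mult_1[of a k] by (simp add: algebra_simps)
  hence e: "(a gchoose Suc k) = (a - real k) * (a gchoose k) / real (Suc k)"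
    by (metis nonzero_mult_div_cancel_left of_nat_neq_0)
  have "(a - b) * g / c * (-1 * p) = g * p * ((b - a) / c)" for b c g p :: real
    by (simp add: algebra_simps diff_divide_distrib)
  thus ?thesis unfolding e power_Suc .
qed

lemma sqrt_coeff_0 [simp]: "sqrt_coeff 0 = 1"
  by (simp add: sqrt_coeff_def)

lemma sqrt_coeff_Suc_nonpos: "sqrt_coeff (Suc k) \<le> 0"
proof (induction k)
  case 0 thus ?case by (simp add: sqrt_coeff_def)
next
  case (Suc k)
  have "sqrt_coeff (Suc (Suc k)) = sqrt_coeff (Suc k) * ((real (Suc k) - 1/2) / real (Suc (Suc k)))"
    unfolding sqrt_coeff_def by (rule gbinomial_alternating_Suc)
  thus ?case using Suc by (simp add: mult_nonpos_nonneg divide_nonpos_pos)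
qed

text \<open>Dividing (1 - x)^(1/2) by 1 - x gives (1 - x)^(-1/2), so the partial sums of the
  coefficients of the first series are the coefficients of the second.\<close>

lemma sum_sqrt_coeff_nonneg: "(\<Sum>k\<le>n. sqrt_coeff k) \<ge> 0"
proof -
  have "0 \<le> (-1/2 gchoose n) * (- 1 :: real) ^ n"
  proof (induction n)
    case (Suc n)
    show ?case unfolding gbinomial_alternating_Suc by (rule mult_nonneg_nonneg[OF Suc]) simp
  qed simp
  moreover have "(\<Sum>k\<le>n. sqrt_coeff k) = (- 1) ^ n * (1/2 - 1 gchoose n)"
    unfolding sqrt_coeff_def by (rule gbinomial_sum_lower_neg)
  ultimately show ?thesis by (simp only: mult.commute) simp
qed

text \<open>The constant coefficient is 1 and all others are nonpositive, so the sum is 1 minus a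
  nonnegative partial sum. This gives absolute convergence up to norm 1 and the estimate
  \<open>norm (1 - r) \<le> 1\<close> for the root.\<close>

lemma sum_abs_sqrt_coeff: "(\<Sum>k<n. \<bar>sqrt_coeff (Suc k)\<bar>) \<le> 1"
proof -
  have "(\<Sum>k<n. \<bar>sqrt_coeff (Suc k)\<bar>) = - (\<Sum>k<n. sqrt_coeff (Suc k))"
    by (simp add: sum_negf[symmetric] abs_of_nonpos sqrt_coeff_Suc_nonpos)
  also have "\<dots> = 1 - (\<Sum>k\<le>n. sqrt_coeff k)"
    by (simp add: sum.atMost_shift)
  finally show ?thesis using sum_sqrt_coeff_nonneg[of n] by simp
qed

lemma summable_sqrt_coeff: "summable (\<lambda>k. \<bar>sqrt_coeff k\<bar>)"
proof -
  have "summable (\<lambda>k. \<bar>sqrt_coeff (Suc k)\<bar>)"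
    by (rule bounded_imp_summable[where B = 1])
      (simp_all only: lessThan_Suc_atMost[symmetric] sum_abs_sqrt_coeff abs_ge_zero)
  thus ?thesis by (rule summable_Suc_iff[THEN iffD1])
qed

text \<open>Vandermonde's identity for 1/2 + 1/2 = 1: the Cauchy square of the series is 1 -
  x.\<close>

lemma sum_sqrt_coeff_convolution:
  "(\<Sum>i\<le>n. sqrt_coeff i * sqrt_coeff (n - i)) = (if n = 0 then 1 else if n = 1 then -1 else 0)"
proof -
  have "(\<Sum>i\<le>n. sqrt_coeff i * sqrt_coeff (n - i)) =
      (\<Sum>i\<le>n. (-1) ^ n * ((1/2 gchoose i) * (1/2 gchoose (n - i))))"
    by (intro sum.cong refl) (auto simp: sqrt_coeff_def power_add[symmetric] ac_simps)
  also have "\<dots> = (-1) ^ n * (\<Sum>i=0..n. (1/2 gchoose i) * (1/2 gchoose (n - i)))"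
    by (simp add: sum_distrib_left atLeast0AtMost)
  also have "\<dots> = (-1) ^ n * ((1/2 + 1/2 :: real) gchoose n)"
    by (subst gbinomial_Vandermonde) simp
  also have "\<dots> = (-1) ^ n * real (1 choose n)"
    using binomial_gbinomial[of 1 n, where 'a = real] by simp
  also have "\<dots> = (if n = 0 then 1 else if n = 1 then -1 else 0)"
    by (cases n; cases "n - 1") auto
  finally show ?thesis .
qed

text \<open>The last three clauses stand in for functional calculus. Distance at most 1 from the
  unit will show that a selfadjoint root is itself positive, and commutation with the commutant of
  \<open>x\<close> allows roots to be moved past other elements.\<close>

lemma sqrt_one_minus:
  fixes x :: "'a::unital_cstar_algebra"
  assumes "norm x \<le> 1"
  obtains r where "r * r = 1 - x" "norm (1 - r) \<le> 1" "\<And>y. x * y = y * x \<Longrightarrow> r * y = y * r"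
    "star x = x \<Longrightarrow> star r = r"
proof
  let ?f = "\<lambda>k. sqrt_coeff k *\<^sub>R x ^ k"
  define r where "r = (\<Sum>k. ?f k)"
  have le: "norm (?f k) \<le> \<bar>sqrt_coeff k\<bar>" for k
  proof -
    have "norm (x ^ k) \<le> 1"
      using norm_power_ineq[of x k] power_le_one[OF norm_ge_zero assms, of k] by linarith
    thus ?thesis by (simp add: mult_left_le)
  qed
  have sn: "summable (\<lambda>k. norm (?f k))"
    by (rule summable_comparison_test'[OF summable_sqrt_coeff, of 0]) (use le in auto)
  hence s: "summable ?f" by (rule summable_norm_cancel)
  have "(\<lambda>n. \<Sum>i\<le>n. ?f i * ?f (n - i)) sums (r * r)"
    unfolding r_def by (rule Cauchy_product_sums[OF sn sn])
  moreover have "(\<Sum>i\<le>n. ?f i * ?f (n - i)) = (if n = 0 then 1 else if n = 1 then -x else 0)" for n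
  proof -
    have "(\<Sum>i\<le>n. ?f i * ?f (n - i)) = (\<Sum>i\<le>n. (sqrt_coeff i * sqrt_coeff (n - i)) *\<^sub>R x ^ n)"
      by (intro sum.cong refl) (auto simp: power_add[symmetric])
    also have "\<dots> = (if n = 0 then 1 else if n = 1 then -x else 0)"
      unfolding scaleR_sum_left[symmetric] sum_sqrt_coeff_convolution by simp
    finally show ?thesis .
  qed
  ultimately have "(\<lambda>n. if n = 0 then 1 else if n = 1 then -x else 0) sums (r * r)" by simp
  moreover have "(\<lambda>n. if n = 0 then 1 else if n = 1 then -x else 0) sums
      (\<Sum>n\<in>{0,1::nat}. if n = 0 then 1 else if n = 1 then -x else (0::'a))"
    by (intro sums_finite) auto
  ultimately show "r * r = 1 - x" using sums_unique2 by fastforce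
  have s': "summable (\<lambda>k. ?f (Suc k))" using s by (rule summable_Suc_iff[THEN iffD2])
  have "1 - r = - (\<Sum>k. ?f (Suc k))"
    using suminf_split_head[OF s] by (simp add: r_def)
  moreover have "norm (\<Sum>k. ?f (Suc k)) \<le> 1"
  proof (rule LIMSEQ_le_const2)
    show "(\<lambda>n. norm (\<Sum>k<n. ?f (Suc k))) \<longlonglongrightarrow> norm (\<Sum>k. ?f (Suc k))"
      by (intro tendsto_norm summable_LIMSEQ s')
    have "norm (\<Sum>k<n. ?f (Suc k)) \<le> 1" for n
    proof -
      have "norm (\<Sum>k<n. ?f (Suc k)) \<le> (\<Sum>k<n. \<bar>sqrt_coeff (Suc k)\<bar>)"
        by (rule order_trans[OF norm_sum sum_mono]) (rule le)
      thus ?thesis using sum_abs_sqrt_coeff[of n] by linarith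
    qed
    thus "\<exists>N. \<forall>n\<ge>N. norm (\<Sum>k<n. ?f (Suc k)) \<le> 1" by blast
  qed
  ultimately show "norm (1 - r) \<le> 1" by simp
  show "r * y = y * r" if "x * y = y * x" for y
  proof -
    have p: "x ^ k * y = y * x ^ k" for k
      by (rule power_commuting_commutes[OF that])
    have "r * y = (\<Sum>k. ?f k * y)" unfolding r_def by (rule suminf_mult2[OF s])
    also have "\<dots> = (\<Sum>k. y * ?f k)" by (simp add: p)
    also have "\<dots> = y * r" unfolding r_def by (rule suminf_mult[OF s])
    finally show ?thesis .
  qed
  show "star r = r" if "star x = x"
  proof -
    have p: "star (x ^ k) = x ^ k" for k
      by (induction k) (simp_all add: that power_commutes)
    have "star r = (\<Sum>k. star (?f k))"
      unfolding r_def by (rule bounded_linear.suminf[OF bounded_linear_star s])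
    thus ?thesis by (simp add: p r_def)
  qed
qed

section \<open>Positivity through norm estimates\<close>

lemma mult_cartesian:
  fixes x y :: "'a::cstar_algebra"
  shows "(x + \<i> *\<^sub>C y) * (x + \<i> *\<^sub>C y) = x * x - y * y + \<i> *\<^sub>C (x * y + y * x)"
    "(x - \<i> *\<^sub>C y) * (x - \<i> *\<^sub>C y) = x * x - y * y - \<i> *\<^sub>C (x * y + y * x)"
    "(x - \<i> *\<^sub>C y) * (x + \<i> *\<^sub>C y) = x * x + y * y + \<i> *\<^sub>C (x * y - y * x)"
    "(x + \<i> *\<^sub>C y) * (x - \<i> *\<^sub>C y) = x * x + y * y - \<i> *\<^sub>C (x * y - y * x)"
  by (simp_all add: distrib_left distrib_right left_diff_distrib right_diff_distrib
      mult_scaleC_left mult_scaleC_right scaleC_add_right scaleC_diff_right)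

text \<open>Squares of selfadjoint elements, so that no spectrum is involved. That elements of the
  form \<open>star c * c\<close> are positive as well is the hard fact
  \<open>positive_star_mult_self\<close>.\<close>

definition positive :: "'a::unital_cstar_algebra \<Rightarrow> bool"
  where "positive x \<longleftrightarrow> (\<exists>y. star y = y \<and> x = y * y)"

lemma positive_selfadjoint: "positive x \<Longrightarrow> star x = x"
  by (auto simp: positive_def)

text \<open>With \<open>r = sqrt (1 - k\<^sup>2)\<close> the element \<open>u = k + \<i> r\<close> is unitary, and
  \<open>2 k\<^sup>2 - 1 = (u\<^sup>2 + (u\<^sup>*)\<^sup>2) / 2\<close>.\<close>

lemma norm_one_minus_double_square:
  fixes k :: "'a::unital_cstar_algebra"
  assumes "star k = k" "norm k \<le> 1"
  shows "norm (1 - 2 *\<^sub>R (k * k)) \<le> 1"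
proof -
  have "norm (k * k) \<le> 1"
    unfolding norm_selfadjoint_square[OF assms(1)] using assms(2) by (simp add: power_le_one)
  moreover have "star (k * k) = k * k" by (simp add: assms(1))
  ultimately obtain r where r: "r * r = 1 - k * k" "\<And>y. k * k * y = y * (k * k) \<Longrightarrow> r * y = y * r"
      "star r = r"
    using sqrt_one_minus[of "k * k"] by metis
  have rk: "r * k = k * r" by (rule r(2)) (simp add: mult.assoc)
  define u where "u = k + \<i> *\<^sub>C r"
  have su: "star u = k - \<i> *\<^sub>C r" by (simp add: u_def assms(1) r(3))
  have "star u * u = 1"
    unfolding su unfolding u_def mult_cartesian by (simp add: rk r(1))
  hence "(norm u)\<^sup>2 = 1\<^sup>2" by (metis cstar_identity norm_one one_power2)
  hence nu: "norm u = 1" by (rule power2_eq_imp_eq) auto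
  have "2 *\<^sub>R (1 - 2 *\<^sub>R (k * k)) = - (u * u + star u * star u)"
    unfolding su unfolding u_def mult_cartesian by (simp add: r(1) scaleR_2)
  hence "2 * norm (1 - 2 *\<^sub>R (k * k)) = norm (u * u + star u * star u)"
    by (metis norm_minus_cancel norm_scaleR abs_numeral)
  also have "\<dots> \<le> norm u * norm u + norm (star u) * norm (star u)"
    by (intro order_trans[OF norm_triangle_ineq] add_mono norm_mult_ineq)
  finally show ?thesis by (simp add: nu)
qed

text \<open>Scaling by \<open>1/t\<close> reduces to the power series at \<open>z = 1 - x/t\<close>.
  The root satisfies the same estimate with \<open>sqrt t\<close> in place of \<open>t\<close>, so
  it is positive by the same criterion.\<close>

lemma positive_if_norm_le:
  fixes x :: "'a::unital_cstar_algebra"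
  assumes "star x = x" "norm (of_real t - x) \<le> t"
  obtains r where "star r = r" "norm (of_real (sqrt t) - r) \<le> sqrt t" "r * r = x"
    "\<And>y. x * y = y * x \<Longrightarrow> r * y = y * r"
proof (cases "t = 0")
  case True
  with assms have "x = 0" by simp
  thus ?thesis using that[of 0] True by simp
next
  case False
  hence t: "t > 0" using assms(2) norm_ge_zero[of "of_real t - x"] by linarith
  define z where "z = 1 - (1/t) *\<^sub>R x"
  have z: "z = (1/t) *\<^sub>R (of_real t - x)"
    using t by (simp add: z_def algebra_simps of_real_def)
  have "norm z \<le> 1" unfolding z using t assms(2) by simp
  moreover have "star z = z" by (simp add: z_def assms(1))
  ultimately obtain r where r: "r * r = 1 - z" "norm (1 - r) \<le> 1"
      "\<And>y. z * y = y * z \<Longrightarrow> r * y = y * r" "star r = r"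
    using sqrt_one_minus[of z] by metis
  show ?thesis
  proof (rule that[of "sqrt t *\<^sub>R r"])
    show "star (sqrt t *\<^sub>R r) = sqrt t *\<^sub>R r" by (simp add: r(4))
    have "of_real (sqrt t) - sqrt t *\<^sub>R r = sqrt t *\<^sub>R (1 - r)"
      by (simp add: of_real_def algebra_simps)
    thus "norm (of_real (sqrt t) - sqrt t *\<^sub>R r) \<le> sqrt t"
      using r(2) t by (simp add: mult_left_le)
    show "sqrt t *\<^sub>R r * sqrt t *\<^sub>R r = x"
      using t by (simp add: r(1) z_def)
    show "sqrt t *\<^sub>R r * y = y * sqrt t *\<^sub>R r" if "x * y = y * x" for y
    proof -
      have "z * y = y * z" by (simp add: z_def left_diff_distrib right_diff_distrib that)
      thus ?thesis by (simp add: r(3))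
    qed
  qed
qed

lemma positiveI_norm:
  "star x = x \<Longrightarrow> norm (of_real t - x) \<le> t \<Longrightarrow> positive x"
  unfolding positive_def by (metis positive_if_norm_le)

text \<open>If x = y^2 and k = y / sqrt (2 t), then t - x = t (1 - 2 k^2). Together with
  \<open>positiveI_norm\<close> this characterises positivity of a selfadjoint element by a norm
  estimate, with any \<open>t\<close> that is at least half the norm.\<close>

lemma positive_norm_le:
  fixes x :: "'a::unital_cstar_algebra"
  assumes "positive x" "norm x \<le> 2 * t"
  shows "norm (of_real t - x) \<le> t"
proof (cases "t = 0")
  case True
  thus ?thesis using assms by simp
next
  case False
  hence t: "t > 0" using assms(2) norm_ge_zero[of x] by linarith
  obtain y where y: "star y = y" "x = y * y" using assms(1) by (auto simp: positive_def)
  define k where "k = (1 / sqrt (2 * t)) *\<^sub>R y"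
  have "(norm y)\<^sup>2 \<le> 2 * t" using assms(2) by (simp add: y norm_selfadjoint_square)
  hence "norm y \<le> sqrt (2 * t)" by (rule real_le_rsqrt)
  hence "norm k \<le> 1" using t by (simp add: k_def)
  hence "norm (1 - 2 *\<^sub>R (k * k)) \<le> 1"
    by (intro norm_one_minus_double_square) (simp_all add: k_def y)
  hence "t * norm (1 - 2 *\<^sub>R (k * k)) \<le> t" using t by simp
  moreover have "of_real t - x = t *\<^sub>R (1 - 2 *\<^sub>R (k * k))"
    using t by (simp add: k_def y algebra_simps of_real_def)
  ultimately show ?thesis using t by simp
qed

lemma positive_sqrt:
  fixes x :: "'a::unital_cstar_algebra"
  assumes "positive x"
  obtains r where "positive r" "r * r = x" "\<And>y. x * y = y * x \<Longrightarrow> r * y = y * r"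
proof -
  have "norm (of_real (norm x) - x) \<le> norm x"
    by (rule positive_norm_le[OF assms]) simp
  with positive_selfadjoint[OF assms] show thesis
    by (rule positive_if_norm_le) (use that positiveI_norm in blast)
qed

lemma positive_zero [simp]: "positive 0"
  unfolding positive_def by (rule exI[of _ 0]) simp

text \<open>A sum of two squares has no visible root, but the norm estimates for the constants
  \<open>norm x\<close> and \<open>norm y\<close> simply add up.\<close>

lemma positive_add:
  assumes "positive x" "positive y"
  shows "positive (x + y)"
proof (rule positiveI_norm)
  show "star (x + y) = x + y" using assms by (simp add: positive_selfadjoint)
  have "norm (of_real (norm x) - x) \<le> norm x" "norm (of_real (norm y) - y) \<le> norm y"
    using assms by (simp_all add: positive_norm_le)
  moreover have "of_real (norm x + norm y) - (x + y) = (of_real (norm x) - x) + (of_real (norm y) - y)"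
    by simp
  ultimately show "norm (of_real (norm x + norm y) - (x + y)) \<le> norm x + norm y"
    using norm_triangle_ineq by (metis add_mono order_trans)
qed

lemma positive_scaleR:
  assumes "positive x" "t \<ge> 0"
  shows "positive (t *\<^sub>R x)"
proof -
  obtain y where "star y = y" "x = y * y" using assms(1) by (auto simp: positive_def)
  thus ?thesis unfolding positive_def using assms(2)
    by (intro exI[of _ "sqrt t *\<^sub>R y"]) simp
qed

lemma positive_of_real [simp]:
  "positive (of_real t :: 'a::unital_cstar_algebra) \<longleftrightarrow> t \<ge> 0"
proof
  assume p: "positive (of_real t :: 'a)"
  show "t \<ge> 0"
  proof (rule ccontr)
    assume "\<not> t \<ge> 0"
    moreover have "norm (of_real \<bar>t\<bar> - of_real t :: 'a) \<le> \<bar>t\<bar>"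
      by (rule positive_norm_le[OF p]) simp
    moreover have "norm (of_real \<bar>t\<bar> - of_real t :: 'a) = \<bar>\<bar>t\<bar> - t\<bar>"
      unfolding of_real_diff[symmetric] by (rule norm_of_real)
    ultimately show False by simp
  qed
next
  assume "t \<ge> 0"
  thus "positive (of_real t :: 'a)"
    by (intro positiveI_norm[of _ t]) auto
qed

lemma positive_norm_minus:
  assumes "star x = x" "norm x \<le> t"
  shows "positive (of_real t - x)"
  by (rule positiveI_norm[of _ t]) (use assms in auto)

lemma positive_norm_minus_self: "positive x \<Longrightarrow> positive (of_real (norm x) - x)"
  by (simp add: positive_norm_minus positive_selfadjoint)

text \<open>If \<open>x = y\<^sup>2\<close> and \<open>s - x = r\<^sup>2\<close> with \<open>r\<close> commuting with \<open>y\<close>, then \<open>u = y + \<i> r\<close> satisfies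
  \<open>u\<^sup>* u = s\<close>, and \<open>y\<close> is the real part of \<open>u\<close>.\<close>

lemma norm_le_if_positive_diff:
  fixes x :: "'a::unital_cstar_algebra"
  assumes "positive x" "positive (of_real s - x)"
  shows "norm x \<le> s"
proof -
  obtain y where y: "star y = y" "x = y * y" using assms(1) by (auto simp: positive_def)
  obtain r where r: "positive r" "r * r = of_real s - x"
      "\<And>y. (of_real s - x) * y = y * (of_real s - x) \<Longrightarrow> r * y = y * r"
    using positive_sqrt[OF assms(2)] by metis
  have ry: "r * y = y * r"
    by (rule r(3)) (simp add: y(2) algebra_simps of_real_def)
  have sr: "star r = r" by (rule positive_selfadjoint[OF r(1)])
  define u where "u = y + \<i> *\<^sub>C r"
  have su: "star u = y - \<i> *\<^sub>C r" by (simp add: u_def y sr)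
  have "star u * u = of_real s"
    unfolding su unfolding u_def mult_cartesian by (simp add: ry r(2) y(2))
  hence nu: "(norm u)\<^sup>2 = \<bar>s\<bar>" by (metis cstar_identity norm_of_real)
  have s: "s \<ge> 0" using positive_add[OF assms] by simp
  have "2 * norm y = norm (u + star u)"
    unfolding su unfolding u_def by (simp add: scaleR_2[symmetric])
  also have "\<dots> \<le> 2 * norm u"
    using norm_triangle_ineq[of u "star u"] by simp
  finally have "norm y \<le> norm u" by simp
  hence "(norm y)\<^sup>2 \<le> (norm u)\<^sup>2" by (simp add: power_mono)
  thus ?thesis using s by (simp add: y norm_selfadjoint_square nu)
qed

text \<open>As 2 t - (t - h) = t + h is positive, \<open>t - h\<close> has norm at most 2 t; since
  \<open>t - h\<close> is positive, the estimate of \<open>positive_norm_le\<close> then applies to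
  t - (t - h) = h.\<close>

lemma norm_le_if_order_bounded:
  fixes h :: "'a::unital_cstar_algebra"
  assumes "positive (of_real t - h)" "positive (of_real t + h)"
  shows "norm h \<le> t"
proof -
  have "positive (of_real (t + t) :: 'a)" using positive_add[OF assms] by (simp only: of_real_add add_diff_eq diff_add_eq) simp
  hence t: "t \<ge> 0" by (simp only: positive_of_real zero_le_double_add_iff_zero_le_single_add)
  have "a + a - (a - h) = a + h" for a :: "'a" by (simp add: diff_diff_eq2 add.assoc)
  hence "of_real (t + t) - (of_real t - h) = of_real t + h" by (simp only: of_real_add)
  hence "norm (of_real t - h) \<le> t + t"
    using norm_le_if_positive_diff[OF assms(1)] assms(2) by metis
  hence "norm (of_real t - h) \<le> 2 * t" by simp
  from positive_norm_le[OF assms(1) this] show ?thesis by simp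
qed

text \<open>With s = \<open>norm (x + of_real t)\<close>, the element s - t - x is positive and
  bounds the norm of \<open>x\<close> by s - t. The exact value is what the lower estimate in
  \<open>star_mult_self_negative\<close> rests on.\<close>

lemma norm_positive_add_of_real:
  assumes "positive x" "t \<ge> 0"
  shows "norm (x + of_real t) = norm x + t"
proof (rule antisym)
  let ?s = "norm (x + of_real t)"
  have "positive (x + of_real t)" using assms by (simp add: positive_add)
  hence "positive (of_real ?s - (x + of_real t))"
    by (rule positive_norm_minus_self)
  hence "positive (of_real (?s - t) - x)" by (simp add: algebra_simps)
  from norm_le_if_positive_diff[OF assms(1) this] show "norm x + t \<le> ?s" by simp
  show "?s \<le> norm x + t" using norm_triangle_ineq[of x "of_real t"] assms(2) by simp
qed

text \<open>Put \<open>M = d d\<^sup>*\<close>, which is positive because \<open>d\<^sup>* d + d d\<^sup>*\<close> is, and \<open>c = \<parallel>d\<parallel>\<^sup>2\<close>.  The element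
  \<open>e = (M + c) d = d (c - k\<^sup>2)\<close> has norm at most \<open>c \<parallel>d\<parallel>\<close> by its second form, while its first form
  makes the norm of \<open>e d\<^sup>* = M\<^sup>2 + c M\<close> at least \<open>2 c\<^sup>2\<close>.\<close>

lemma star_mult_self_negative:
  fixes d :: "'a::unital_cstar_algebra"
  assumes dd: "star d * d = - (k * k)" and k: "star k = k"
  shows "d = 0"
proof -
  define x where "x = (1/2) *\<^sub>R (d + star d)"
  define y where "y = (- \<i> / 2) *\<^sub>C (d - star d)"
  define M where "M = d * star d"
  define c where "c = (norm d)\<^sup>2"
  have sx: "star x = x" and sy: "star y = y"
    by (simp_all add: x_def y_def add.commute) (simp add: scaleC_diff_right)
  have iy: "\<i> *\<^sub>C y = (1/2) *\<^sub>R (d - star d)" by (simp add: y_def scaleR_scaleC)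
  have d: "d = x + \<i> *\<^sub>C y"
    unfolding iy x_def by (simp add: algebra_simps flip: scaleR_left_distrib)
  have sd: "star d = x - \<i> *\<^sub>C y" using arg_cong[OF d, of star] by (simp add: sx sy)
  have "star d * d + d * star d = 2 *\<^sub>R (x * x + y * y)"
    unfolding sd unfolding d mult_cartesian by (simp add: scaleR_2)
  hence M: "M = 2 *\<^sub>R (x * x) + 2 *\<^sub>R (y * y) + k * k"
    by (simp add: dd M_def algebra_simps)
  have "positive (x * x)" "positive (y * y)" and pk: "positive (k * k)"
    using sx sy k by (auto simp: positive_def)
  hence pM: "positive M" unfolding M by (intro positive_add positive_scaleR) auto
  have nM: "norm M = c" using cstar_identity[of "star d"] by (simp add: M_def c_def)
  have nk: "norm (k * k) = c"
    using cstar_identity[of d] dd by (simp add: c_def)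
  have c: "c \<ge> 0" by (simp add: c_def)
  define e where "e = (M + of_real c) * d"
  have "e = d * (of_real c - k * k)"
  proof -
    have "M * d = d * (star d * d)" by (simp add: M_def mult.assoc)
    thus ?thesis by (simp add: e_def dd algebra_simps of_real_def)
  qed
  moreover have "norm (of_real c - k * k) \<le> c"
    by (rule positive_norm_le[OF pk]) (simp add: nk c)
  ultimately have ne: "norm e \<le> norm d * c"
    by (metis norm_mult_ineq mult_left_mono norm_ge_zero order_trans)
  \<comment> \<open>Completing the square: M^2 + c M = w^2 - (c/2)^2, and w has norm 3c/2. The
    resulting lower bound 2 c^2 meets the upper bound c^2 only for c = 0.\<close>
  let ?w = "M + of_real (c/2)"
  have "norm ?w = c + c/2" using norm_positive_add_of_real[OF pM, of "c/2"] nM c by simp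
  moreover have "star ?w = ?w" using pM by (simp add: positive_selfadjoint)
  ultimately have "norm (?w * ?w) = (c + c/2)\<^sup>2" using norm_selfadjoint_square by metis
  moreover have "?w * ?w = e * star d + of_real ((c/2)\<^sup>2)"
  proof -
    have "e * star d = M * M + c *\<^sub>R M"
      by (simp add: e_def mult.assoc M_def[symmetric]) (simp add: distrib_right of_real_def)
    moreover have "?w * ?w = M * M + ((c/2) *\<^sub>R M + (c/2) *\<^sub>R M) + of_real ((c/2)\<^sup>2)"
      by (simp add: algebra_simps of_real_def power2_eq_square)
    moreover have "(c/2) *\<^sub>R M + (c/2) *\<^sub>R M = c *\<^sub>R M"
      by (simp flip: scaleR_left_distrib)
    ultimately show ?thesis by simp
  qed
  moreover have "norm (e * star d + of_real ((c/2)\<^sup>2)) \<le> norm (e * star d) + (c/2)\<^sup>2"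
    using norm_triangle_ineq[of "e * star d" "of_real ((c/2)\<^sup>2)"] by (simp only: norm_of_real) simp
  moreover have "norm (e * star d) \<le> c * c"
  proof -
    have "norm (e * star d) \<le> norm e * norm d" using norm_mult_ineq[of e "star d"] by simp
    also have "\<dots> \<le> norm d * c * norm d" by (intro mult_right_mono ne) simp
    finally show ?thesis by (simp add: c_def power2_eq_square mult_ac)
  qed
  ultimately have "(c + c/2)\<^sup>2 \<le> c * c + (c/2)\<^sup>2" by simp
  hence "c * c \<le> 0" by (simp add: power2_eq_square field_simps)
  hence "c = 0" using mult_nonneg_nonneg[OF c c] by simp
  thus ?thesis by (simp add: c_def)
qed

text \<open>With \<open>h = c\<^sup>* c\<close> and \<open>n = \<bar>h\<bar> - h\<close>, the element \<open>d = c n\<close> satisfies \<open>d\<^sup>* d = - \<bar>h\<bar> n\<^sup>2\<close>.\<close>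

theorem positive_star_mult_self:
  fixes c :: "'a::unital_cstar_algebra"
  shows "positive (star c * c)"
proof -
  define h where "h = star c * c"
  have sh: "star h = h" by (simp add: h_def)
  have "positive (h * h)" using sh by (auto simp: positive_def)
  then obtain m where m: "positive m" "m * m = h * h" "\<And>y. h * h * y = y * (h * h) \<Longrightarrow> m * y = y * m"
    using positive_sqrt by metis
  obtain r where r: "positive r" "r * r = m" "\<And>y. m * y = y * m \<Longrightarrow> r * y = y * r"
    using positive_sqrt[OF m(1)] by metis
  have sr: "star r = r" and sm: "star m = m" using r(1) m(1) by (simp_all add: positive_selfadjoint)
  have mh: "m * h = h * m" by (rule m(3)) (simp add: mult.assoc)
  have rh: "r * h = h * r" by (rule r(3)[OF mh])
  have rm: "r * m = m * r" by (rule r(3)) simp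
  \<comment> \<open>Twice the negative part of \<open>h\<close>; once it is shown to vanish,
    \<open>h\<close> equals its absolute value \<open>m\<close>.\<close>
  define n where "n = m - h"
  have sn: "star n = n" by (simp add: n_def sm sh)
  have rn: "r * n = n * r" by (simp add: n_def rh rm algebra_simps)
  have mn: "m * n = n * m" by (simp add: n_def mh algebra_simps)
  have nh: "n * h = - (m * n)" by (simp add: n_def algebra_simps m(2))
  have "star (c * n) * (c * n) = n * h * n" by (simp add: sn h_def mult.assoc)
  also have "\<dots> = - (r * n * (r * n))"
  proof -
    have "r * n * (r * n) = (r * r) * n * n" by (metis rn mult.assoc)
    thus ?thesis by (simp add: nh r(2))
  qed
  finally have c: "star (c * n) * (c * n) = - (r * n * (r * n))" .
  moreover have "star (r * n) = r * n" by (simp add: sn sr rn)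
  ultimately have "c * n = 0" by (rule star_mult_self_negative)
  hence "h * n = 0" by (simp add: h_def mult.assoc)
  hence "n * h = 0" using arg_cong[of "h * n" 0 star] unfolding star_simps sn sh by simp
  hence "n * n = 0" using nh mn by (simp add: n_def right_diff_distrib)
  hence "n = 0" using norm_selfadjoint_square[OF sn] by simp
  thus ?thesis using m(1) by (simp add: n_def h_def)
qed

section \<open>Adjoining a unit\<close>

datatype 'a unitization = Unitization (alg_part: 'a) (scalar_part: complex)

lemma unitization_eqI: "alg_part x = alg_part y \<Longrightarrow> scalar_part x = scalar_part y \<Longrightarrow> x = y"
  by (rule unitization.expand) simp

abbreviation left_action :: "'a::cstar_algebra unitization \<Rightarrow> 'a \<Rightarrow> 'a"
  where "left_action z x \<equiv> alg_part z * x + scalar_part z *\<^sub>C x"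

lemma bounded_linear_left_action: "bounded_linear (left_action z)"
  by (intro bounded_linear_add bounded_linear_mult_right bounded_linear_scaleC)

instantiation unitization :: (cstar_algebra)
  "{complex_normed_vector, real_normed_algebra_1}"
begin

definition "0 = Unitization (0::'a) 0"
definition "1 = Unitization (0::'a) 1"
definition "x + y = Unitization (alg_part x + alg_part y :: 'a) (scalar_part x + scalar_part y)"
definition "- x = Unitization (- alg_part x :: 'a) (- scalar_part x)"
definition "x - y = Unitization (alg_part x - alg_part y :: 'a) (scalar_part x - scalar_part y)"
definition "x * y = Unitization
  (alg_part x * alg_part y + scalar_part y *\<^sub>C alg_part x + scalar_part x *\<^sub>C alg_part y :: 'a)
  (scalar_part x * scalar_part y)"
definition "c *\<^sub>C x = Unitization (c *\<^sub>C alg_part x :: 'a) (c * scalar_part x)"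
definition "r *\<^sub>R x = Unitization (r *\<^sub>R alg_part x :: 'a) (r *\<^sub>R scalar_part x)"

text \<open>If the algebra already has a unit, the operator norm alone does not separate points.\<close>

definition norm_unitization :: "'a unitization \<Rightarrow> real"
  where "norm x = max (cmod (scalar_part x)) (onorm (left_action x))"
definition "dist (x :: 'a unitization) y = norm (x - y)"
definition "sgn (x :: 'a unitization) = inverse (norm x) *\<^sub>R x"
definition [code del]:
  "(uniformity :: ('a unitization \<times> 'a unitization) filter) =
    (INF e\<in>{0<..}. principal {(x, y). dist x y < e})"
definition [code del]:
  "open (S :: 'a unitization set) =
    (\<forall>x\<in>S. \<forall>\<^sub>F (x', y) in uniformity. x' = x \<longrightarrow> y \<in> S)"

lemma unitization_parts [simp]:
  fixes x y :: "'a unitization"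
  shows "alg_part (0 :: 'a unitization) = 0" "scalar_part (0 :: 'a unitization) = 0"
    "alg_part (1 :: 'a unitization) = 0" "scalar_part (1 :: 'a unitization) = 1"
    "alg_part (x + y) = alg_part x + alg_part y"
    "scalar_part (x + y) = scalar_part x + scalar_part y"
    "alg_part (- x) = - alg_part x" "scalar_part (- x) = - scalar_part x"
    "alg_part (x - y) = alg_part x - alg_part y"
    "scalar_part (x - y) = scalar_part x - scalar_part y"
    "alg_part (x * y) =
      alg_part x * alg_part y + scalar_part y *\<^sub>C alg_part x + scalar_part x *\<^sub>C alg_part y"
    "scalar_part (x * y) = scalar_part x * scalar_part y"
    "alg_part (c *\<^sub>C x) = c *\<^sub>C alg_part x" "scalar_part (c *\<^sub>C x) = c * scalar_part x"
    "alg_part (r *\<^sub>R x) = r *\<^sub>R alg_part x" "scalar_part (r *\<^sub>R x) = r *\<^sub>R scalar_part x"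
  by (simp_all add: zero_unitization_def one_unitization_def plus_unitization_def
      uminus_unitization_def minus_unitization_def times_unitization_def scaleC_unitization_def
      scaleR_unitization_def)

text \<open>Let the element act on \<open>star a\<close>, where \<open>a\<close> is its algebra
  part: the C*-identity turns the norm of \<open>a * star a\<close> into the square of the norm of
  \<open>a\<close>. The bound yields both definiteness and completeness of the norm.\<close>

lemma norm_alg_part_le: "norm (alg_part x) \<le> cmod (scalar_part x) + onorm (left_action x)"
  for x :: "'a unitization"
proof (cases "alg_part x = 0")
  case True
  thus ?thesis using onorm_pos_le[OF bounded_linear_left_action[of x]] by simp
next
  case False
  let ?a = "alg_part x"
  have "(norm ?a)\<^sup>2 = norm (?a * star ?a)" using cstar_identity[of "star ?a"] by simp
  also have "\<dots> = norm (left_action x (star ?a) - scalar_part x *\<^sub>C star ?a)" by simp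
  also have "\<dots> \<le> onorm (left_action x) * norm (star ?a) + cmod (scalar_part x) * norm (star ?a)"
    by (rule order_trans[OF norm_triangle_ineq4 add_mono])
      (rule onorm[OF bounded_linear_left_action], simp add: norm_scaleC)
  finally have "norm ?a * norm ?a \<le> (cmod (scalar_part x) + onorm (left_action x)) * norm ?a"
    by (simp add: power2_eq_square algebra_simps)
  thus ?thesis using False by simp
qed

instance
proof
  fix x y z :: "'a unitization" and a b :: real and c d :: complex
  show "x + y + z = x + (y + z)" "x + y = y + x" "0 + x = x" "- x + x = 0" "x - y = x + - y"
    by (rule unitization_eqI; simp add: algebra_simps)+
  show "a *\<^sub>R (x + y) = a *\<^sub>R x + a *\<^sub>R y" "(a + b) *\<^sub>R x = a *\<^sub>R x + b *\<^sub>R x"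
    "a *\<^sub>R b *\<^sub>R x = (a * b) *\<^sub>R x" "1 *\<^sub>R x = x"
    by (rule unitization_eqI; simp add: algebra_simps)+
  show "c *\<^sub>C (x + y) = c *\<^sub>C x + c *\<^sub>C y" "(c + d) *\<^sub>C x = c *\<^sub>C x + d *\<^sub>C x"
    "c *\<^sub>C d *\<^sub>C x = (c * d) *\<^sub>C x" "a *\<^sub>R x = complex_of_real a *\<^sub>C x"
    by (rule unitization_eqI; simp add: scaleC_add_right scaleC_add_left algebra_simps scaleR_scaleC
        scaleR_conv_of_real)+
  show "dist x y = norm (x - y)" "sgn x = inverse (norm x) *\<^sub>R x"
    by (simp_all add: dist_unitization_def sgn_unitization_def)
  show "uniformity = (INF e\<in>{0<..}. principal {(x, y :: 'a unitization). dist x y < e})"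
    by (fact uniformity_unitization_def)
  show "open S = (\<forall>x\<in>S. \<forall>\<^sub>F (x', y) in uniformity. x' = x \<longrightarrow> y \<in> S)"
    for S :: "'a unitization set" by (fact open_unitization_def)
  show "x * y * z = x * (y * z)" "(x + y) * z = x * z + y * z" "x * (y + z) = x * y + x * z"
    "a *\<^sub>R x * y = a *\<^sub>R (x * y)" "x * a *\<^sub>R y = a *\<^sub>R (x * y)" "1 * x = x" "x * 1 = x"
    by (rule unitization_eqI; simp add: scaleC_add_right scaleC_add_left algebra_simps
        mult_scaleC_left mult_scaleC_right scaleR_scaleC scaleR_conv_of_real mult.commute)+
  show "(0::'a unitization) \<noteq> 1"
    by (metis unitization_parts(2,4) zero_neq_one)
  have "onorm (\<lambda>x::'a. x) \<le> 1" by (rule onorm_id_le)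
  thus "norm (1 :: 'a unitization) = 1" by (simp add: norm_unitization_def)
  show "norm x = 0 \<longleftrightarrow> x = 0"
  proof
    assume "norm x = 0"
    moreover have "onorm (left_action x) \<ge> 0" by (rule onorm_pos_le[OF bounded_linear_left_action])
    ultimately have "scalar_part x = 0" "onorm (left_action x) = 0"
      by (auto simp: norm_unitization_def max_def split: if_splits)
    thus "x = 0" using norm_alg_part_le[of x] by (intro unitization_eqI) auto
  qed (simp add: norm_unitization_def onorm_zero)
  have "onorm (left_action (x + y)) \<le> onorm (left_action x) + onorm (left_action y)"
  proof -
    have "left_action (x + y) = (\<lambda>v. left_action x v + left_action y v)"
      by (simp add: fun_eq_iff scaleC_add_left distrib_right)
    thus ?thesis by (simp only: onorm_triangle bounded_linear_left_action)
  qed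
  moreover have "cmod (scalar_part (x + y)) \<le> cmod (scalar_part x) + cmod (scalar_part y)"
    by (simp add: norm_triangle_ineq)
  ultimately show "norm (x + y) \<le> norm x + norm y" unfolding norm_unitization_def by linarith
  show normC: "norm (c *\<^sub>C x) = cmod c * norm x" for c and x :: "'a unitization"
  proof -
    have "onorm (left_action (c *\<^sub>C x)) = cmod c * onorm (left_action x)"
    proof (rule antisym)
      have le: "onorm (left_action (c *\<^sub>C x)) \<le> cmod c * onorm (left_action x)" for c and x :: "'a unitization"
      proof (rule onorm_bound)
        show "0 \<le> cmod c * onorm (left_action x)"
          by (simp add: onorm_pos_le[OF bounded_linear_left_action])
        fix v
        have "left_action (c *\<^sub>C x) v = c *\<^sub>C left_action x v"
          by (simp add: mult_scaleC_left scaleC_add_right)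
        thus "norm (left_action (c *\<^sub>C x) v) \<le> cmod c * onorm (left_action x) * norm v"
          using onorm[OF bounded_linear_left_action[of x], of v]
          by (simp add: norm_scaleC mult.assoc mult_left_mono)
      qed
      show "onorm (left_action (c *\<^sub>C x)) \<le> cmod c * onorm (left_action x)" by (rule le)
      show "cmod c * onorm (left_action x) \<le> onorm (left_action (c *\<^sub>C x))"
      proof (cases "c = 0")
        case True
        thus ?thesis by (simp add: onorm_zero)
      next
        case False
        have "x = inverse c *\<^sub>C (c *\<^sub>C x)" by (rule unitization_eqI) (use False in auto)
        hence "onorm (left_action x) \<le> cmod (inverse c) * onorm (left_action (c *\<^sub>C x))"
          using le[of "inverse c" "c *\<^sub>C x"] by (simp only:)
        hence "cmod c * onorm (left_action x) \<le>
            cmod c * (cmod (inverse c) * onorm (left_action (c *\<^sub>C x)))"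
          by (rule mult_left_mono) simp
        thus ?thesis using False by (simp only: mult.assoc[symmetric] norm_mult[symmetric]) simp
      qed
    qed
    thus ?thesis by (simp add: norm_unitization_def norm_mult max_mult_distrib_left)
  qed
  have "a *\<^sub>R x = complex_of_real a *\<^sub>C x"
    by (rule unitization_eqI) (simp_all add: scaleR_scaleC scaleR_conv_of_real)
  thus "norm (a *\<^sub>R x) = \<bar>a\<bar> * norm x" using normC[of "complex_of_real a" x] by simp
  have "onorm (left_action (x * y)) \<le> onorm (left_action x) * onorm (left_action y)"
  proof -
    have "left_action (x * y) = left_action x \<circ> left_action y"
      by (simp add: fun_eq_iff scaleC_add_right algebra_simps mult_scaleC_left mult_scaleC_right)
    thus ?thesis by (simp only: onorm_compose bounded_linear_left_action)
  qed
  also have "\<dots> \<le> norm x * norm y"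
    unfolding norm_unitization_def
    by (intro mult_mono) (auto simp: onorm_pos_le[OF bounded_linear_left_action] le_max_iff_disj)
  finally show "norm (x * y) \<le> norm x * norm y"
    by (subst norm_unitization_def)
      (simp add: norm_mult, simp add: norm_unitization_def mult_mono le_max_iff_disj)
qed

end

lemma scalar_part_le_norm: "cmod (scalar_part x) \<le> norm (x::'a::cstar_algebra unitization)"
  by (simp add: norm_unitization_def)

lemma alg_part_le_norm: "norm (alg_part x) \<le> 2 * norm (x::'a::cstar_algebra unitization)"
  using norm_alg_part_le[of x] by (simp add: norm_unitization_def)

lemma norm_Unitization_le: "norm (Unitization a c) \<le> norm (a::'a::cstar_algebra) + cmod c"
proof -
  have "onorm (left_action (Unitization a c)) \<le> norm a + cmod c"
  proof (rule onorm_bound)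
    show "0 \<le> norm a + cmod c" by simp
    fix x
    have "norm (a * x + c *\<^sub>C x) \<le> norm (a * x) + norm (c *\<^sub>C x)" by (rule norm_triangle_ineq)
    also have "\<dots> \<le> norm a * norm x + cmod c * norm x"
      by (simp add: norm_mult_ineq norm_scaleC)
    finally show "norm (left_action (Unitization a c) x) \<le> (norm a + cmod c) * norm x"
      by (simp add: algebra_simps)
  qed
  thus ?thesis by (simp add: norm_unitization_def)
qed

instantiation unitization :: (cstar_algebra) cstar_algebra
begin

definition "star x = Unitization (star (alg_part x :: 'a)) (cnj (scalar_part x))"

lemma star_parts [simp]:
  "alg_part (star x) = star (alg_part (x :: 'a unitization))" "scalar_part (star x) = cnj (scalar_part x)"
  by (simp_all add: star_unitization_def)

instance
proof
  fix X :: "nat \<Rightarrow> 'a unitization"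
  assume X: "Cauchy X"
  \<comment> \<open>The norm is equivalent to the sum of the norms of the two parts, so a Cauchy
    sequence converges as soon as its parts do.\<close>
  have bl: "bounded_linear (alg_part :: 'a unitization \<Rightarrow> 'a)"
    by (rule bounded_linear_intro[where K = 2]) (use alg_part_le_norm in \<open>auto simp: mult.commute\<close>)
  have bl': "bounded_linear (scalar_part :: 'a unitization \<Rightarrow> complex)"
    by (rule bounded_linear_intro[where K = 1]) (use scalar_part_le_norm in auto)
  obtain a where a: "(\<lambda>n. alg_part (X n)) \<longlonglongrightarrow> a"
    using Cauchy_convergent[OF bounded_linear.Cauchy[OF bl X]] by (auto simp: convergent_def)
  obtain c where c: "(\<lambda>n. scalar_part (X n)) \<longlonglongrightarrow> c"
    using Cauchy_convergent[OF bounded_linear.Cauchy[OF bl' X]] by (auto simp: convergent_def)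
  have lim: "(\<lambda>n. norm (alg_part (X n) - a) + cmod (scalar_part (X n) - c)) \<longlonglongrightarrow> 0"
    using tendsto_add[OF LIM_zero[OF a, THEN tendsto_norm_zero] LIM_zero[OF c, THEN tendsto_norm_zero]]
    by simp
  have "(\<lambda>n. X n - Unitization a c) \<longlonglongrightarrow> 0"
  proof (rule Lim_null_comparison[OF _ lim], rule always_eventually, rule allI)
    fix n
    have "X n - Unitization a c = Unitization (alg_part (X n) - a) (scalar_part (X n) - c)"
      by (rule unitization_eqI) auto
    thus "norm (X n - Unitization a c) \<le> norm (alg_part (X n) - a) + cmod (scalar_part (X n) - c)"
      by (simp add: norm_Unitization_le)
  qed
  thus "convergent X" unfolding convergent_def by (blast intro: LIM_zero_cancel)
next
  fix x y :: "'a unitization" and c :: complex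
  show "c *\<^sub>C x * y = c *\<^sub>C (x * y)" "x * c *\<^sub>C y = c *\<^sub>C (x * y)"
    by (rule unitization_eqI; simp add: scaleC_add_right mult_scaleC_left mult_scaleC_right mult_ac)+
  show "star (star x) = x" "star (x + y) = star x + star y" "star (c *\<^sub>C x) = cnj c *\<^sub>C star x"
    by (rule unitization_eqI; simp)+
  show sm: "star (x * y) = star y * star x" for x y :: "'a unitization"
    by (rule unitization_eqI; simp add: mult.commute add_ac)
  \<comment> \<open>For w = \<open>left_action x v\<close> the C*-identity of the original algebra
    bounds the square of the norm of w through \<open>star x * x\<close>. This one inequality
    implies first that \<open>star\<close> is isometric and then the full identity.\<close>
  have ge: "(norm x)\<^sup>2 \<le> norm (star x * x)" for x :: "'a unitization"
  proof -
    let ?N = "norm (star x * x)"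
    have s: "(cmod (scalar_part x))\<^sup>2 \<le> ?N"
      using scalar_part_le_norm[of "star x * x"] by (simp add: norm_mult power2_eq_square)
    have "onorm (left_action x) \<le> sqrt ?N"
    proof (rule onorm_bound)
      show "0 \<le> sqrt ?N" by simp
      fix v
      let ?w = "left_action x v"
      have "(norm ?w)\<^sup>2 = norm (star ?w * ?w)" by (rule cstar_identity[symmetric])
      also have "star ?w * ?w = star v * left_action (star x * x) v"
        by (simp add: algebra_simps mult_scaleC_left mult_scaleC_right scaleC_add_right)
      also have "norm \<dots> \<le> norm v * (onorm (left_action (star x * x)) * norm v)"
        by (rule order_trans[OF norm_mult_ineq])
          (simp only: norm_star mult_left_mono norm_ge_zero onorm[OF bounded_linear_left_action])
      also have "\<dots> \<le> norm v * (?N * norm v)"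
        by (intro mult_left_mono mult_right_mono) (auto simp: norm_unitization_def)
      finally have "(norm ?w)\<^sup>2 \<le> ?N * (norm v)\<^sup>2" by (simp add: power2_eq_square mult_ac)
      thus "norm ?w \<le> sqrt ?N * norm v"
        using real_le_rsqrt by (fastforce simp: real_sqrt_mult)
    qed
    hence "norm x \<le> sqrt ?N"
      using real_le_rsqrt[OF s] by (subst norm_unitization_def) simp
    hence "(norm x)\<^sup>2 \<le> (sqrt ?N)\<^sup>2" by (intro power_mono) auto
    thus ?thesis by simp
  qed
  have le: "norm x \<le> norm (star x)" for x :: "'a unitization"
  proof (cases "x = 0")
    case False
    have "(norm x)\<^sup>2 \<le> norm (star x) * norm x"
      using ge[of x] norm_mult_ineq[of "star x" x] by linarith
    thus ?thesis using False by (simp add: power2_eq_square)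
  qed simp
  have ss: "star (star x) = x" by (rule unitization_eqI) auto
  have "norm (star x) = norm x" using le[of x] le[of "star x"] ss by simp
  hence "norm (star x * x) \<le> (norm x)\<^sup>2" using norm_mult_ineq[of "star x" x] by (simp add: power2_eq_square)
  thus "norm (star x * x) = (norm x)\<^sup>2" using ge[of x] by simp
qed

end

instance unitization :: (cstar_algebra) unital_cstar_algebra ..

abbreviation embed :: "'a::cstar_algebra \<Rightarrow> 'a unitization"
  where "embed a \<equiv> Unitization a 0"

lemma embed_simps:
  fixes a b :: "'a::cstar_algebra"
  shows "embed (a + b) = embed a + embed b" "embed (a - b) = embed a - embed b"
    "embed (a * b) = embed a * embed b" "embed (c *\<^sub>C a) = c *\<^sub>C embed a"
    "embed (star a) = star (embed a)"
  by (rule unitization_eqI; simp)+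

lemma norm_embed [simp]: "norm (embed a) = norm (a::'a::cstar_algebra)"
proof -
  have "norm a \<le> norm (embed a)" using norm_alg_part_le[of "embed a"] by (simp add: norm_unitization_def)
  thus ?thesis using norm_Unitization_le[of a 0] by simp
qed

section \<open>Separation by positive functionals\<close>

definition sublinear :: "('v::real_vector \<Rightarrow> real) \<Rightarrow> bool"
  where "sublinear p \<longleftrightarrow> (\<forall>x y. p (x + y) \<le> p x + p y) \<and> (\<forall>c x. c > 0 \<longrightarrow> p (c *\<^sub>R x) \<le> c * p x)"

lemma sublinear_add: "sublinear p \<Longrightarrow> p (x + y) \<le> p x + p y"
  by (simp add: sublinear_def)

lemma sublinear_zero: "sublinear p \<Longrightarrow> p 0 = 0"
proof -
  assume p: "sublinear p"
  have "p (2 *\<^sub>R 0) \<le> 2 * p 0" "p ((1/2) *\<^sub>R 0) \<le> (1/2) * p 0"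
    using p unfolding sublinear_def by (metis zero_less_numeral, metis half_gt_zero_iff zero_less_one)
  thus ?thesis by simp
qed

text \<open>The definition asks for one direction only, which is what an infimum inherits; the other
  one results from scaling back by \<open>inverse c\<close>.\<close>

lemma sublinear_scaleR:
  assumes "sublinear p" "c \<ge> 0"
  shows "p (c *\<^sub>R x) = c * p x"
proof (cases "c = 0")
  case True
  thus ?thesis using sublinear_zero[OF assms(1)] by simp
next
  case False
  hence c: "c > 0" using assms by simp
  have "p (inverse c *\<^sub>R c *\<^sub>R x) \<le> inverse c * p (c *\<^sub>R x)"
    using assms(1) c unfolding sublinear_def by (metis positive_imp_inverse_positive)
  hence "c * p x \<le> p (c *\<^sub>R x)" using c by (simp add: field_simps)
  moreover have "p (c *\<^sub>R x) \<le> c * p x" using assms(1) c by (simp add: sublinear_def)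
  ultimately show ?thesis by simp
qed

lemma sublinear_minus: "sublinear p \<Longrightarrow> - p (- x) \<le> p x"
  using sublinear_add[of p x "-x"] sublinear_zero[of p] by simp

text \<open>The common pattern of three constructions: descending in one direction, lower bounds of
  chains, and the distance functional on pairs.\<close>

lemma sublinear_Inf:
  fixes S :: "'v::real_vector \<Rightarrow> real set"
  assumes ne: "\<And>x. S x \<noteq> {}" and bdd: "\<And>x. bdd_below (S x)"
    and add: "\<And>x y t s. t \<in> S x \<Longrightarrow> s \<in> S y \<Longrightarrow> \<exists>r\<in>S (x + y). r \<le> t + s"
    and scale: "\<And>c x t. c > 0 \<Longrightarrow> t \<in> S x \<Longrightarrow> \<exists>r\<in>S (c *\<^sub>R x). r \<le> c * t"
  shows "sublinear (\<lambda>x. Inf (S x))"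
  unfolding sublinear_def
proof safe
  fix x y
  have "Inf (S (x + y)) \<le> t + s" if "t \<in> S x" "s \<in> S y" for t s
    using add[OF that] cInf_lower[OF _ bdd] by (meson order_trans)
  hence "Inf (S (x + y)) - s \<le> Inf (S x)" if "s \<in> S y" for s
    using that by (intro cInf_greatest ne) (fastforce simp: algebra_simps)
  hence "Inf (S (x + y)) - Inf (S x) \<le> Inf (S y)"
    by (intro cInf_greatest ne) (fastforce simp: algebra_simps)
  thus "Inf (S (x + y)) \<le> Inf (S x) + Inf (S y)" by simp
next
  fix c :: real and x assume c: "c > 0"
  have "Inf (S (c *\<^sub>R x)) / c \<le> t" if "t \<in> S x" for t
  proof -
    have "Inf (S (c *\<^sub>R x)) \<le> c * t"
      using scale[OF c that] cInf_lower[OF _ bdd] by (meson order_trans)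
    thus ?thesis using c by (simp add: divide_le_eq mult.commute)
  qed
  hence "Inf (S (c *\<^sub>R x)) / c \<le> Inf (S x)" by (intro cInf_greatest ne)
  thus "Inf (S (c *\<^sub>R x)) \<le> c * Inf (S x)" using c by (simp add: divide_le_eq mult.commute)
qed

text \<open>The infimum of p (x + t y) - t p y over t \<ge> 0 is the descent along y; t = 0 gives q
  \<le> p, and t = 1 gives the bound at - y. A functional that admits no proper descent is therefore
  odd.\<close>

lemma sublinear_descend:
  assumes p: "sublinear p"
  obtains q where "sublinear q" "\<And>x. q x \<le> p x" "q (- y) \<le> - p y"
proof
  let ?S = "\<lambda>x. (\<lambda>t. p (x + t *\<^sub>R y) - t * p y) ` {0..}"
  have lower: "- p (- x) \<le> p (x + t *\<^sub>R y) - t * p y" if "t \<ge> 0" for x t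
    using sublinear_add[OF p, of "x + t *\<^sub>R y" "-x"] sublinear_scaleR[OF p that, of y] by simp
  have bdd: "bdd_below (?S x)" for x
    by (rule bdd_belowI2[of _ "- p (- x)"]) (use lower in auto)
  show "sublinear (\<lambda>x. Inf (?S x))"
  proof (rule sublinear_Inf[OF _ bdd])
    fix x x' t s assume "t \<in> ?S x" "s \<in> ?S x'"
    then obtain a b where ab: "a \<ge> 0" "b \<ge> 0" "t = p (x + a *\<^sub>R y) - a * p y" "s = p (x' + b *\<^sub>R y) - b * p y"
      by auto
    have "p (x + x' + (a + b) *\<^sub>R y) - (a + b) * p y \<le> t + s"
      using sublinear_add[OF p, of "x + a *\<^sub>R y" "x' + b *\<^sub>R y"] by (simp add: ab algebra_simps)
    thus "\<exists>r\<in>?S (x + x'). r \<le> t + s" using ab by (intro bexI[rotated] imageI) auto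
  next
    fix c :: real and x t assume c: "c > 0" "t \<in> ?S x"
    then obtain a where a: "a \<ge> 0" "t = p (x + a *\<^sub>R y) - a * p y" by auto
    have "p (c *\<^sub>R x + (c * a) *\<^sub>R y) - (c * a) * p y \<le> c * t"
      using sublinear_scaleR[OF p, of c "x + a *\<^sub>R y"] c by (simp add: a algebra_simps)
    thus "\<exists>r\<in>?S (c *\<^sub>R x). r \<le> c * t" using a c by (intro bexI[rotated] imageI) auto
  qed auto
  show "Inf (?S x) \<le> p x" for x
    by (rule cInf_lower2[OF _ _ bdd, of "p x"]) (auto intro!: image_eqI[of _ _ 0])
  show "Inf (?S (- y)) \<le> - p y"
    by (rule cInf_lower2[OF _ _ bdd, of "- p y"])
      (auto intro!: image_eqI[of _ _ 1] simp: sublinear_zero[OF p])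
qed

text \<open>A minimal sublinear functional is linear.\<close>

theorem hahn_banach:
  fixes p :: "'v::real_vector \<Rightarrow> real"
  assumes p: "sublinear p"
  obtains f where "linear f" "\<And>x. f x \<le> p x" "f a = p a"
proof -
  \<comment> \<open>Descending at \<open>a\<close> before minimising forces every linear functional
    below \<open>p'\<close> to take the value \<open>p a\<close> at \<open>a\<close>.\<close>
  obtain p' where p': "sublinear p'" "\<And>x. p' x \<le> p x" "p' (- a) \<le> - p a"
    using sublinear_descend[OF p, of a] by blast
  define A where "A = {q. sublinear q \<and> (\<forall>x. q x \<le> p' x)}"
  \<comment> \<open>The order is reversed, so that a maximal element for Zorn's lemma is a minimal
    functional.\<close>
  define R where "R = (\<lambda>q r :: 'v \<Rightarrow> real. \<forall>x. r x \<le> q x)"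
  have "\<exists>m\<in>A. \<forall>q\<in>A. R m q \<longrightarrow> q = m"
  proof (rule predicate_Zorn)
    show "partial_order_on A (relation_of R A)"
      unfolding partial_order_on_def preorder_on_def refl_on_def trans_on_def antisym_on_def
        relation_of_def R_def
      by (auto simp: fun_eq_iff intro: order_trans antisym)
    fix C assume "C \<in> Chains (relation_of R A)"
    hence C: "C \<subseteq> A" "\<And>q r. q \<in> C \<Longrightarrow> r \<in> C \<Longrightarrow> (\<forall>x. q x \<le> r x) \<or> (\<forall>x. r x \<le> q x)"
      unfolding Chains_def relation_of_def R_def by auto
    show "\<exists>u\<in>A. \<forall>q\<in>C. R q u"
    proof (cases "C = {}")
      case True
      thus ?thesis using p' by (auto simp: A_def)
    next
      case False
      let ?S = "\<lambda>x. (\<lambda>q. q x) ` C"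
      have bdd: "bdd_below (?S x)" for x
      proof (rule bdd_belowI2[of _ "- p' (- x)"])
        fix q assume "q \<in> C"
        hence q: "sublinear q" "q (- x) \<le> p' (- x)" using C by (auto simp: A_def)
        thus "- p' (- x) \<le> q x" using sublinear_minus[OF q(1), of x] by linarith
      qed
      have "sublinear (\<lambda>x. Inf (?S x))"
      proof (rule sublinear_Inf[OF _ bdd])
        fix x y t s assume "t \<in> ?S x" "s \<in> ?S y"
        then obtain q r where qr: "q \<in> C" "r \<in> C" "t = q x" "s = r y" by auto
        then obtain m where m: "m \<in> C" "m x \<le> q x" "m y \<le> r y" using C(2)[of q r] by auto
        hence "m (x + y) \<le> t + s"
          using C(1) sublinear_add[of m x y] qr by (fastforce simp: A_def)
        thus "\<exists>r\<in>?S (x + y). r \<le> t + s" using m by blast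
      next
        fix c :: real and x t assume "c > 0" "t \<in> ?S x"
        thus "\<exists>r\<in>?S (c *\<^sub>R x). r \<le> c * t" using C(1) by (auto simp: A_def sublinear_def)
      qed (use False in auto)
      moreover have le: "Inf (?S x) \<le> q x" if "q \<in> C" for q x
        by (rule cInf_lower[OF _ bdd]) (use that in auto)
      moreover obtain q where "q \<in> C" using False by auto
      moreover have "q x \<le> p' x" for x using \<open>q \<in> C\<close> C(1) by (auto simp: A_def)
      ultimately have "(\<lambda>x. Inf (?S x)) \<in> A"
        unfolding A_def by (blast intro: order_trans)
      thus ?thesis using le by (intro bexI[of _ "\<lambda>x. Inf (?S x)"]) (auto simp: R_def)
    qed
  qed
  then obtain f where f: "f \<in> A" "\<And>q. q \<in> A \<Longrightarrow> (\<And>x. q x \<le> f x) \<Longrightarrow> q = f"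
    by (auto simp: R_def)
  have sf: "sublinear f" and fp': "\<And>x. f x \<le> p' x" using f(1) by (auto simp: A_def)
  have neg: "f (- y) = - f y" for y
  proof -
    obtain q where q: "sublinear q" "\<And>x. q x \<le> f x" "q (- y) \<le> - f y"
      using sublinear_descend[OF sf, of y] by blast
    hence "q = f" using fp' by (intro f(2)) (auto simp: A_def intro: order_trans)
    thus ?thesis using q(3) sublinear_minus[OF sf, of y] by simp
  qed
  have lin: "linear f"
  proof (rule linearI)
    fix x y
    have "f (- x + - y) \<le> f (- x) + f (- y)" by (rule sublinear_add[OF sf])
    hence "f x + f y \<le> f (x + y)" using neg[of "x + y"] by (simp add: neg)
    thus "f (x + y) = f x + f y" using sublinear_add[OF sf, of x y] by simp
  next
    fix c :: real and x
    show "f (c *\<^sub>R x) = c *\<^sub>R f x"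
    proof (cases "c \<ge> 0")
      case True
      thus ?thesis by (simp add: sublinear_scaleR[OF sf])
    next
      case False
      thus ?thesis using sublinear_scaleR[OF sf, of "-c" "x"] neg[of "c *\<^sub>R x"] by simp
    qed
  qed
  have le: "f x \<le> p x" for x using fp' p'(2) order_trans by blast
  have "f (- a) \<le> - p a" using fp'[of "-a"] p'(3) by linarith
  hence "f a = p a" using neg[of a] le[of a] by simp
  with lin le show thesis by (rule that)
qed

text \<open>A positive functional is represented by its real part, from which it is recovered as
  \<open>\<phi> x = f x - \<i> f (\<i> x)\<close>.\<close>

definition positive_functional :: "('a::cstar_algebra \<Rightarrow> real) \<Rightarrow> bool"
  where "positive_functional f \<longleftrightarrow>
    linear f \<and> (\<forall>x. f (star x) = f x) \<and> (\<forall>x. f (star x * x) \<ge> 0)"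

text \<open>The functional \<open>p (x, y) = inf {t. \<exists>b\<in>B. Re (x + b) \<le> t \<and> Re (y - b) \<le> t}\<close> on pairs is
  sublinear, and \<open>p (h, - h)\<close> is the distance of \<open>h\<close> from \<open>B\<close>.  The components of a linear
  functional below \<open>p\<close> are positive and agree on \<open>B\<close>.\<close>

theorem separating_positive_functionals:
  fixes h :: "'a::unital_cstar_algebra"
  assumes h: "star h = h"
    and B: "0 \<in> B" "\<And>x y. x \<in> B \<Longrightarrow> y \<in> B \<Longrightarrow> x + y \<in> B" "\<And>c x. x \<in> B \<Longrightarrow> c *\<^sub>R x \<in> B"
      "\<And>x. x \<in> B \<Longrightarrow> star x \<in> B"
    and dist: "\<And>b. b \<in> B \<Longrightarrow> \<delta> \<le> norm (h - b)"
  obtains f g where "positive_functional f" "positive_functional g" "\<And>b. b \<in> B \<Longrightarrow> f b = g b"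
    "f h - g h \<ge> \<delta>" "f 1 + g 1 \<le> 1"
proof -
  \<comment> \<open>Only selfadjoint elements can be compared with scalars; taking real parts makes
    the functional meaningful on all pairs.\<close>
  define re where "re x = (1/2) *\<^sub>R (x + star x)" for x :: 'a
  have re_add: "re (x + y) = re x + re y" and re_scale: "re (c *\<^sub>R x) = c *\<^sub>R re x"
    and re_neg: "re (- x) = - re x" and re_diff: "re (x - y) = re x - re y"
    and star_re: "star (re x) = re x" for x y c
    by (simp_all add: re_def algebra_simps)
  have re_sa: "re x = x" if "star x = x" for x
    using that by (simp add: re_def scaleR_2[symmetric])
  have re_norm: "norm (re x) \<le> norm x" for x
    using norm_triangle_ineq[of x "star x"] by (simp add: re_def)
  define S where "S v = {t. \<exists>b\<in>B. positive (of_real t - re (fst v + b)) \<and>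
    positive (of_real t - re (snd v - b))}" for v :: "'a \<times> 'a"
  have SI: "t \<in> S (x, y)" if "b \<in> B" "positive (of_real t - re (x + b))" "positive (of_real t - re (y - b))"
    for t b x y using that unfolding S_def by auto
  have ne: "max (norm (fst v)) (norm (snd v)) \<in> S v" for v
    unfolding S_def using re_norm[of "fst v"] re_norm[of "snd v"]
    by (auto intro!: bexI[of _ 0] positive_norm_minus star_re simp: B)
  \<comment> \<open>The element \<open>b\<close> cancels in the sum of the two conditions, which
    leaves a lower bound for 2 t by the norm of the sum of the components.\<close>
  have bdd: "bdd_below (S v)" for v
  proof (rule bdd_belowI)
    fix t assume "t \<in> S v"
    then obtain b where b: "b \<in> B" "positive (of_real t - re (fst v + b))" "positive (of_real t - re (snd v - b))"
      by (auto simp: S_def)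
    let ?N = "norm (fst v + snd v)"
    have "positive (of_real ?N - (- re (fst v + snd v)))"
      using re_norm[of "fst v + snd v"] by (intro positive_norm_minus) (auto simp: star_re)
    hence "positive (of_real t - re (fst v + b) + (of_real t - re (snd v - b)) +
        (of_real ?N - (- re (fst v + snd v))))"
      by (intro positive_add b)
    also have "of_real t - re (fst v + b) + (of_real t - re (snd v - b)) +
        (of_real ?N - (- re (fst v + snd v))) = of_real (t + t + ?N)"
      unfolding re_add re_diff of_real_add by (simp del: mult_2 add: algebra_simps)
    finally show "- ?N / 2 \<le> t" unfolding positive_of_real by simp
  qed
  have "sublinear (\<lambda>v. Inf (S v))"
  proof (rule sublinear_Inf[OF _ bdd])
    fix v w t s assume "t \<in> S v" "s \<in> S w"
    then obtain b c where b: "b \<in> B" "positive (of_real t - re (fst v + b))" "positive (of_real t - re (snd v - b))"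
      and c: "c \<in> B" "positive (of_real s - re (fst w + c))" "positive (of_real s - re (snd w - c))"
      by (auto simp: S_def)
    have "t + s \<in> S (fst v + fst w, snd v + snd w)"
    proof (rule SI)
      show "b + c \<in> B" using b c B by auto
      show "positive (of_real (t + s) - re (fst v + fst w + (b + c)))"
        using positive_add[OF b(2) c(2)] by (simp add: re_add algebra_simps)
      show "positive (of_real (t + s) - re (snd v + snd w - (b + c)))"
        using positive_add[OF b(3) c(3)] by (simp add: re_add re_diff algebra_simps)
    qed
    thus "\<exists>r\<in>S (v + w). r \<le> t + s" by (intro bexI[of _ "t + s"]) (auto simp: plus_prod_def)
  next
    fix c :: real and v t assume c: "c > 0" "t \<in> S v"
    then obtain b where b: "b \<in> B" "positive (of_real t - re (fst v + b))" "positive (of_real t - re (snd v - b))"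
      by (auto simp: S_def)
    have "c * t \<in> S (c *\<^sub>R fst v, c *\<^sub>R snd v)"
    proof (rule SI)
      show "c *\<^sub>R b \<in> B" using b B by auto
      show "positive (of_real (c * t) - re (c *\<^sub>R fst v + c *\<^sub>R b))"
        using positive_scaleR[OF b(2), of c] c by (simp add: re_scale re_add algebra_simps of_real_def)
      show "positive (of_real (c * t) - re (c *\<^sub>R snd v - c *\<^sub>R b))"
        using positive_scaleR[OF b(3), of c] c by (simp add: re_scale re_diff algebra_simps of_real_def)
    qed
    thus "\<exists>r\<in>S (c *\<^sub>R v). r \<le> c * t" by (intro bexI[of _ "c * t"]) (auto simp: scaleR_prod_def)
  qed (use ne in blast)
  then obtain F where F: "linear F" "\<And>v. F v \<le> Inf (S v)" "F (h, - h) = Inf (S (h, - h))"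
    using hahn_banach[where a = "(h, - h)"] by blast
  have F_le: "F v \<le> t" if "t \<in> S v" for v t
    using F(2)[of v] cInf_lower[OF that bdd] by linarith
  have F_zero: "F (x, y) = 0" if "0 \<in> S (x, y)" "0 \<in> S (- x, - y)" for x y
    using F_le[OF that(1)] F_le[OF that(2)] linear_neg[OF F(1), of "(x, y)"] by simp
  have pf: "positive_functional (\<lambda>x. F (x, 0))" "positive_functional (\<lambda>x. F (0, x))"
  proof -
    have lin: "linear (\<lambda>x. F (x, 0))" "linear (\<lambda>x. F (0, x))"
      by (intro linear_compose[OF _ F(1), unfolded o_def] linearI; simp)+
    have sq: "star x * x = re (star x * x)" for x by (rule re_sa[symmetric]) simp
    have "re (x - star x) = 0" for x by (simp add: re_def)
    hence "F (x - star x, 0) = 0" "F (0, x - star x) = 0" for x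
      by (auto intro!: F_zero SI[OF B(1)] simp: re_neg simp del: minus_diff_eq)
        (simp_all add: re_def)
    hence eq: "F (star x, 0) = F (x, 0)" "F (0, star x) = F (0, x)" for x
      using linear_diff[OF lin(1), of x "star x"] linear_diff[OF lin(2), of x "star x"] by simp_all
    \<comment> \<open>With b = 0 and t = 0 the conditions say that \<open>star x * x\<close> is
      positive; this turns the upper bound on \<open>F\<close> into positivity of its
      components.\<close>
    have "re (- (star x * x)) = - (star x * x)" for x by (rule re_sa) simp
    hence "0 \<in> S (- (star x * x), 0)" "0 \<in> S (0, - (star x * x))" for x
      by (auto intro!: SI[OF B(1)] simp: positive_star_mult_self) (simp_all add: re_def)
    hence "F (- (star x * x), 0) \<le> 0" "F (0, - (star x * x)) \<le> 0" for x
      by (blast intro: F_le)+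
    hence "F (star x * x, 0) \<ge> 0" "F (0, star x * x) \<ge> 0" for x
      by (metis linear_neg[OF lin(1)] neg_le_0_iff_le, metis linear_neg[OF lin(2)] neg_le_0_iff_le)
    with lin eq show "positive_functional (\<lambda>x. F (x, 0))" "positive_functional (\<lambda>x. F (0, x))"
      by (simp_all add: positive_functional_def)
  qed
  have F_pair: "F (x, y) = F (x, 0) + F (0, y)" for x y
    using linear_add[OF F(1), of "(x, 0)" "(0, y)"] by simp
  have F_snd_neg: "F (0, - y) = - F (0, y)" for y
    using linear_neg[OF F(1), of "(0, y)"] by simp
  show thesis
  proof (rule that[OF pf])
    fix b assume b: "b \<in> B"
    have nb: "- b \<in> B" using B(3)[OF b, of "-1"] by simp
    have "re 0 = 0" by (simp add: re_def)
    \<comment> \<open>The witness - b annihilates the pair (b, - b), and b annihilates its negative,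
      so 0 is an upper bound of \<open>F\<close> at both.\<close>
    hence "F (b, - b) = 0"
      by (intro F_zero SI[OF nb] SI[OF b, of 0 "- b" "- (- b)"]) simp_all
    thus "F (b, 0) = F (0, b)" using F_pair[of b "-b"] F_snd_neg[of b] by simp
  next
    have "\<delta> \<le> t" if t: "t \<in> S (h, - h)" for t
    proof -
      obtain b where b: "b \<in> B" "positive (of_real t - re (h + b))" "positive (of_real t - re (- h - b))"
        using t unfolding S_def mem_Collect_eq fst_conv snd_conv by blast
      \<comment> \<open>Hence \<open>re (h + b)\<close> lies between - t and t. Since
        \<open>B\<close> is stable under \<open>star\<close>, this compares \<open>h\<close> with an
        element of \<open>B\<close>.\<close>
      have r: "re (- h - b) = - re (h + b)" by (simp add: re_add re_diff re_neg)
      have n: "norm (re (h + b)) \<le> t"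
        by (rule norm_le_if_order_bounded) (use b r in simp_all)
      have e: "re (h + b) = h - (- 1) *\<^sub>R re b" by (simp add: re_add re_sa h)
      have "(- 1) *\<^sub>R re b \<in> B" unfolding re_def by (intro B b(1))
      from dist[OF this] n show ?thesis unfolding e by linarith
    qed
    hence "\<delta> \<le> Inf (S (h, - h))" using ne by (intro cInf_greatest) auto
    thus "\<delta> \<le> F (h, 0) - F (0, h)" using F(3) F_pair[of h "-h"] F_snd_neg[of h] by simp
    have "re 1 = 1" by (rule re_sa) simp
    hence "1 \<in> S (1, 1)" by (intro SI[OF B(1)]) simp_all
    thus "F (1, 0) + F (0, 1) \<le> 1" using F_le F_pair[of 1 1] by fastforce
  qed
qed

text \<open>Writing \<parallel>x\<parallel>^2 - star x * x as the square of a selfadjoint r, the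
  difference of the two sides is the value of \<open>f\<close> at
  \<open>star (r * a) * (r * a)\<close>. This makes left multiplication by \<open>x\<close> bounded
  on the GNS space.\<close>

lemma positive_functional_bound:
  fixes f :: "'a::unital_cstar_algebra \<Rightarrow> real"
  assumes f: "positive_functional f"
  shows "f (star (x * a) * (x * a)) \<le> (norm x)\<^sup>2 * f (star a * a)"
proof -
  have "norm (star x * x) = (norm x)\<^sup>2" by (rule cstar_identity)
  hence "positive (of_real ((norm x)\<^sup>2) - star x * x)"
    by (intro positive_norm_minus) auto
  then obtain r where r: "star r = r" "of_real ((norm x)\<^sup>2) - star x * x = r * r"
    by (auto simp: positive_def)
  have "star (r * a) * (r * a) = star a * (r * r) * a" by (simp add: r mult.assoc)
  also have "\<dots> = (norm x)\<^sup>2 *\<^sub>R (star a * a) - star (x * a) * (x * a)"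
    by (simp only: r(2)[symmetric] right_diff_distrib left_diff_distrib)
      (simp add: of_real_def mult.assoc)
  finally have "0 \<le> f ((norm x)\<^sup>2 *\<^sub>R (star a * a) - star (x * a) * (x * a))"
    using f by (metis positive_functional_def)
  thus ?thesis using f by (simp add: positive_functional_def linear_diff linear_scale)
qed

section \<open>Hilbert space constructions\<close>

text \<open>Covers both \<open>cinner\<close> and the possibly degenerate GNS form, so that the
  Cauchy-Schwarz inequality and approximate projections are available for each.\<close>

locale semi_inner_product =
  fixes G :: "'v::complex_normed_vector \<Rightarrow> 'v \<Rightarrow> complex"
  assumes commute: "G x y = cnj (G y x)"
    and add_left: "G (x + y) z = G x z + G y z"
    and scaleC_left: "G (c *\<^sub>C x) z = c * G x z"
    and nonneg: "Re (G x x) \<ge> 0"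
begin

definition Q :: "'v \<Rightarrow> real"
  where "Q x = Re (G x x)"

lemma add_right: "G x (y + z) = G x y + G x z"
  by (metis add_left commute complex_cnj_add)

lemma scaleC_right: "G x (c *\<^sub>C y) = cnj c * G x y"
  by (metis scaleC_left commute complex_cnj_mult)

lemma minus_left: "G (- x) y = - G x y"
  using scaleC_left[of "-1" x y] by simp

lemma minus_right: "G x (- y) = - G x y"
  using scaleC_right[of x "-1" y] by simp

lemma diff_left: "G (x - y) z = G x z - G y z"
  using add_left[of x "-y" z] by (simp add: minus_left)

lemma diff_right: "G x (y - z) = G x y - G x z"
  using add_right[of x y "-z"] by (simp add: minus_right)

lemma self: "G x x = complex_of_real (Q x)"
  using commute[of x x] by (simp add: Q_def complex_eq_iff)

lemma Q_nonneg: "Q x \<ge> 0"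
  using nonneg by (simp add: Q_def)

text \<open>Expand Q at z - t g x for real t with g = \<open>G z x\<close>; the best choice is t = 1
  / Q x. For d = 0 this is the Cauchy-Schwarz inequality. When d is the squared distance from a
  subspace, it says that near-minimizers are nearly orthogonal to it.\<close>

lemma variational:
  assumes "\<And>c. d \<le> Q (z - c *\<^sub>C x)"
  shows "(cmod (G z x))\<^sup>2 \<le> (Q z - d) * Q x"
proof -
  define g where "g = G z x"
  have key: "2 * t * (cmod g)\<^sup>2 - t\<^sup>2 * (cmod g)\<^sup>2 * Q x \<le> Q z - d" for t
  proof -
    let ?c = "complex_of_real t * g"
    have "G (z - ?c *\<^sub>C x) (z - ?c *\<^sub>C x) =
        complex_of_real (Q z) - cnj ?c * g - ?c * cnj g + ?c * cnj ?c * complex_of_real (Q x)"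
      unfolding diff_left diff_right scaleC_left scaleC_right
      unfolding self g_def commute[of x z] by (simp add: algebra_simps)
    also have "\<dots> = complex_of_real (Q z - 2 * t * (cmod g)\<^sup>2 + t\<^sup>2 * (cmod g)\<^sup>2 * Q x)"
      using complex_norm_square[of g] by (simp add: algebra_simps power2_eq_square)
    finally have "Q (z - ?c *\<^sub>C x) = Q z - 2 * t * (cmod g)\<^sup>2 + t\<^sup>2 * (cmod g)\<^sup>2 * Q x"
      by (simp add: Q_def)
    thus ?thesis using assms[of ?c] by simp
  qed
  show ?thesis
  proof (cases "Q x = 0")
    case True
    have "g = 0"
    proof (rule ccontr)
      assume "g \<noteq> 0"
      hence p: "(cmod g)\<^sup>2 > 0" by simp
      \<comment> \<open>For Q x = 0 the bound is linear in t, and this value violates it by exactly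
        1.\<close>
      let ?t = "(Q z - d + 1) / (2 * (cmod g)\<^sup>2)"
      have "2 * ?t * (cmod g)\<^sup>2 = Q z - d + 1" using p by simp
      thus False using key[of ?t] True by simp
    qed
    thus ?thesis using True by (simp add: g_def)
  next
    case False
    hence q: "Q x > 0" using Q_nonneg[of x] by simp
    have "2 * (1 / Q x) * (cmod g)\<^sup>2 - (1 / Q x)\<^sup>2 * (cmod g)\<^sup>2 * Q x = (cmod g)\<^sup>2 / Q x"
      using q by (simp add: field_simps power2_eq_square)
    hence "(cmod g)\<^sup>2 / Q x \<le> Q z - d" using key[of "1 / Q x"] by simp
    thus ?thesis using q by (simp add: g_def divide_le_eq)
  qed
qed

lemma Cauchy_Schwarz: "(cmod (G z x))\<^sup>2 \<le> Q z * Q x"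
  using variational[of 0 z x] Q_nonneg by simp

text \<open>A substitute for the projection in a space that need not be complete. The Cauchy
  property also comes from \<open>variational\<close>: Q (m i - m j) is the difference of two inner
  products of nearly orthogonal residuals with the vector m i - m j itself.\<close>

lemma minimizing_sequence:
  assumes M: "0 \<in> M" "\<And>x y. x \<in> M \<Longrightarrow> y \<in> M \<Longrightarrow> x + y \<in> M" "\<And>c x. x \<in> M \<Longrightarrow> c *\<^sub>C x \<in> M"
  obtains m where "\<And>n::nat. m n \<in> M" "\<And>x. x \<in> M \<Longrightarrow> (\<lambda>n. G (a - m n) x) \<longlonglongrightarrow> 0"
    "\<And>e. e > 0 \<Longrightarrow> \<exists>N. \<forall>i\<ge>N. \<forall>j\<ge>N. Q (m i - m j) < e"
proof -
  define d where "d = (INF x\<in>M. Q (a - x))"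
  have d: "d \<le> Q (a - x)" if "x \<in> M" for x
    unfolding d_def by (rule cINF_lower[OF _ that]) (auto intro!: bdd_belowI2[of _ 0] Q_nonneg)
  define \<epsilon> where "\<epsilon> n = inverse (real (Suc n))" for n
  have "\<exists>x\<in>M. Q (a - x) < d + \<epsilon> n" for n
    using cInf_lessD[of "(\<lambda>x. Q (a - x)) ` M" "d + \<epsilon> n"] M(1) by (auto simp: d_def \<epsilon>_def)
  then obtain m where m: "\<And>n. m n \<in> M" "\<And>n. Q (a - m n) < d + \<epsilon> n" by metis
  have G_le: "(cmod (G (a - m n) x))\<^sup>2 \<le> \<epsilon> n * Q x" if x: "x \<in> M" for n x
  proof -
    have "(cmod (G (a - m n) x))\<^sup>2 \<le> (Q (a - m n) - d) * Q x"
    proof (rule variational)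
      fix c
      have "m n + c *\<^sub>C x \<in> M" using M m(1) x by blast
      thus "d \<le> Q (a - m n - c *\<^sub>C x)" using d by (metis diff_diff_eq)
    qed
    also have "\<dots> \<le> \<epsilon> n * Q x"
      using m(2)[of n] by (intro mult_right_mono Q_nonneg) simp
    finally show ?thesis .
  qed
  have Q_le: "Q (m i - m j) \<le> 2 * (\<epsilon> i + \<epsilon> j)" for i j
  proof -
    let ?x = "m i - m j"
    have "m i + (-1) *\<^sub>C m j \<in> M" using M m(1) by blast
    hence x: "?x \<in> M" by simp
    define \<alpha> where "\<alpha> = cmod (G (a - m j) ?x)"
    define \<beta> where "\<beta> = cmod (G (a - m i) ?x)"
    have "complex_of_real (Q ?x) = G (a - m j) ?x - G (a - m i) ?x"
      unfolding self[symmetric] diff_left[symmetric] by simp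
    hence "cmod (complex_of_real (Q ?x)) \<le> \<alpha> + \<beta>"
      unfolding \<alpha>_def \<beta>_def by (simp only: norm_triangle_ineq4)
    hence "Q ?x \<le> \<alpha> + \<beta>" by simp
    hence "(Q ?x)\<^sup>2 \<le> (\<alpha> + \<beta>)\<^sup>2" by (intro power_mono Q_nonneg)
    also have "\<dots> \<le> 2 * (\<alpha>\<^sup>2 + \<beta>\<^sup>2)"
      using sum_squares_bound[of \<alpha> \<beta>] by (simp add: power2_sum)
    also have "\<dots> \<le> 2 * (\<epsilon> j * Q ?x + \<epsilon> i * Q ?x)"
      using G_le[OF x] unfolding \<alpha>_def \<beta>_def by (intro mult_left_mono add_mono) auto
    finally have *: "Q ?x * Q ?x \<le> 2 * (\<epsilon> i + \<epsilon> j) * Q ?x" by (simp add: power2_eq_square algebra_simps)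
    show ?thesis
    proof (cases "Q ?x = 0")
      case True
      thus ?thesis by (simp add: \<epsilon>_def)
    next
      case False
      hence "Q ?x > 0" using Q_nonneg[of ?x] by simp
      thus ?thesis using * by simp
    qed
  qed
  show thesis
  proof (rule that[OF m(1)])
    fix x assume x: "x \<in> M"
    have "(\<lambda>n. sqrt (\<epsilon> n * Q x)) \<longlonglongrightarrow> sqrt (0 * Q x)"
      unfolding \<epsilon>_def by (intro tendsto_intros LIMSEQ_inverse_real_of_nat)
    hence lim: "(\<lambda>n. sqrt (\<epsilon> n * Q x)) \<longlonglongrightarrow> 0" by simp
    show "(\<lambda>n. G (a - m n) x) \<longlonglongrightarrow> 0"
      by (rule Lim_null_comparison[OF _ lim], rule always_eventually, rule allI,
        rule real_le_rsqrt, rule G_le[OF x])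
  next
    fix e :: real assume "e > 0"
    hence "e / 4 > 0" by simp
    then obtain N where N: "\<epsilon> N < e / 4" unfolding \<epsilon>_def using reals_Archimedean by blast
    have less: "\<epsilon> i < e / 4" if "i \<ge> N" for i
    proof -
      have "\<epsilon> i \<le> \<epsilon> N" unfolding \<epsilon>_def using that by (simp add: field_simps)
      thus ?thesis using N by simp
    qed
    have "Q (m i - m j) < e" if "i \<ge> N" "j \<ge> N" for i j
      using Q_le[of i j] less[OF that(1)] less[OF that(2)] by simp
    thus "\<exists>N. \<forall>i\<ge>N. \<forall>j\<ge>N. Q (m i - m j) < e" by blast
  qed
qed

end

interpretation cinner: semi_inner_product "cinner :: 'h::complex_hilbert_space \<Rightarrow> 'h \<Rightarrow> complex"
  rewrites "semi_inner_product.Q (cinner :: 'h \<Rightarrow> 'h \<Rightarrow> complex) = (\<lambda>x. (norm x)\<^sup>2)"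
proof -
  show "semi_inner_product (cinner :: 'h \<Rightarrow> 'h \<Rightarrow> complex)"
    by unfold_locales (simp_all add: cinner_add_left cinner_scaleC_left cinner_self flip: cinner_commute)
  then interpret semi_inner_product "cinner :: 'h \<Rightarrow> 'h \<Rightarrow> complex" .
  show "Q = (\<lambda>x::'h. (norm x)\<^sup>2)" by (simp add: fun_eq_iff Q_def cinner_self)
qed

lemma norm_cinner_le: "cmod (cinner x y) \<le> norm x * norm (y::'h::complex_hilbert_space)"
  using cinner.Cauchy_Schwarz[of x y] by (simp add: power_mult_distrib[symmetric] power2_le_iff_abs_le abs_mult)

lemma bounded_bilinear_cinner: "bounded_bilinear (cinner :: 'h::complex_hilbert_space \<Rightarrow> 'h \<Rightarrow> complex)"
proof
  show "\<exists>K. \<forall>a b :: 'h. norm (cinner a b) \<le> norm a * norm b * K"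
    by (rule exI[of _ 1]) (simp add: norm_cinner_le)
qed (simp_all add: cinner.add_left cinner.add_right scaleR_scaleC cinner.scaleC_left
    cinner.scaleC_right scaleR_conv_of_real)

lemmas tendsto_cinner = bounded_bilinear.tendsto[OF bounded_bilinear_cinner]

section \<open>Limits, closures of graphs and projections\<close>

lemma cinner_closure_zero:
  assumes "\<And>k. k \<in> K \<Longrightarrow> cinner x k = 0" "k \<in> closure K"
  shows "cinner x (k::'h::complex_hilbert_space) = 0"
proof -
  obtain f where f: "\<And>n. f n \<in> K" "f \<longlonglongrightarrow> k" using assms(2) closure_sequential[of k K] by blast
  have "(\<lambda>n. cinner x (f n)) \<longlonglongrightarrow> cinner x k" by (intro tendsto_cinner tendsto_const f)
  thus ?thesis using f(1) assms(1) by (simp add: LIMSEQ_const_iff)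
qed

lemma closureI_sequence: "(\<And>n. f n \<in> S) \<Longrightarrow> f \<longlonglongrightarrow> x \<Longrightarrow> x \<in> closure (S :: 'x::metric_space set)"
  unfolding closure_sequential by (intro exI[of _ f]) auto

lemma closure_closed_under:
  assumes "u \<in> closure S" "v \<in> closure S" "\<And>u v. u \<in> S \<Longrightarrow> v \<in> S \<Longrightarrow> F u v \<in> S"
    "\<And>f g. f \<longlonglongrightarrow> u \<Longrightarrow> g \<longlonglongrightarrow> v \<Longrightarrow> (\<lambda>n. F (f n) (g n)) \<longlonglongrightarrow> F u v"
  shows "F u v \<in> closure (S :: 'x::metric_space set)"
proof -
  obtain f g where "\<And>n. f n \<in> S" "f \<longlonglongrightarrow> u" "\<And>n. g n \<in> S" "g \<longlonglongrightarrow> v"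
    using assms(1,2) unfolding closure_sequential by blast
  thus ?thesis using assms(3,4) unfolding closure_sequential
    by (intro exI[of _ "\<lambda>n. F (f n) (g n)"]) auto
qed

lemma closure_subspace:
  fixes B :: "'v::complex_normed_vector set"
  shows "(\<And>x y. x \<in> B \<Longrightarrow> y \<in> B \<Longrightarrow> x + y \<in> B) \<Longrightarrow> x \<in> closure B \<Longrightarrow> y \<in> closure B \<Longrightarrow> x + y \<in> closure B"
    "(\<And>x. x \<in> B \<Longrightarrow> c *\<^sub>C x \<in> B) \<Longrightarrow> x \<in> closure B \<Longrightarrow> c *\<^sub>C x \<in> closure B"
  by (erule (1) closure_closed_under) (auto intro: tendsto_add
      closure_closed_under[where F = "\<lambda>x y. c *\<^sub>C x"] bounded_linear.tendsto[OF bounded_linear_scaleC])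

lemma closure_graph_bound:
  fixes S :: "('x::real_normed_vector \<times> 'y::real_normed_vector) set"
  assumes "\<And>x y. (x, y) \<in> S \<Longrightarrow> norm y \<le> C * norm x" "(x, y) \<in> closure S"
  shows "norm y \<le> C * norm x"
proof -
  obtain f where f: "\<And>n. f n \<in> S" "f \<longlonglongrightarrow> (x, y)" using assms(2) closure_sequential by blast
  have "(\<lambda>n. norm (snd (f n))) \<longlonglongrightarrow> norm y" "(\<lambda>n. C * norm (fst (f n))) \<longlonglongrightarrow> C * norm x"
    using tendsto_snd[OF f(2)] tendsto_fst[OF f(2)] by (auto intro!: tendsto_intros)
  moreover have "norm (snd (f n)) \<le> C * norm (fst (f n))" for n
    using assms(1)[of "fst (f n)" "snd (f n)"] f(1) by simp
  ultimately show ?thesis by (intro LIMSEQ_le) auto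
qed

text \<open>Extension by continuity in terms of graphs: a bounded graph that is stable under
  differences maps Cauchy sequences to Cauchy sequences, so its closure is defined on the closure of
  the domain.\<close>

lemma closure_graph_total:
  fixes S :: "('x::real_normed_vector \<times> 'y::banach) set"
  assumes bound: "\<And>x y. (x, y) \<in> S \<Longrightarrow> norm y \<le> C * norm x"
    and diff: "\<And>p q. p \<in> S \<Longrightarrow> q \<in> S \<Longrightarrow> p - q \<in> S"
    and x: "x \<in> closure (fst ` S)" and C: "C \<ge> 0"
  obtains y where "(x, y) \<in> closure S"
proof -
  obtain f where f: "\<And>n. f n \<in> fst ` S" "f \<longlonglongrightarrow> x" using x closure_sequential by blast
  have "\<exists>y. (f n, y) \<in> S" for n using f(1)[of n] by auto
  then obtain g where g: "\<And>n. (f n, g n) \<in> S" by metis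
  have "Cauchy g"
  proof (rule metric_CauchyI)
    fix e :: real assume "e > 0"
    hence "e / (C + 1) > 0" using C by simp
    then obtain N where N: "\<And>m n. m \<ge> N \<Longrightarrow> n \<ge> N \<Longrightarrow> dist (f m) (f n) < e / (C + 1)"
      using metric_CauchyD[OF LIMSEQ_imp_Cauchy[OF f(2)]] by blast
    have "dist (g m) (g n) < e" if "m \<ge> N" "n \<ge> N" for m n
    proof -
      have "(f m - f n, g m - g n) \<in> S" using diff[OF g[of m] g[of n]] by simp
      hence "dist (g m) (g n) \<le> C * dist (f m) (f n)" using bound by (simp add: dist_norm)
      also have "\<dots> \<le> (C + 1) * dist (f m) (f n)" by (intro mult_right_mono) auto
      also have "\<dots> < e" using N[OF that] C by (simp add: field_simps)
      finally show ?thesis .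
    qed
    thus "\<exists>N. \<forall>m\<ge>N. \<forall>n\<ge>N. dist (g m) (g n) < e" by blast
  qed
  then obtain y where "g \<longlonglongrightarrow> y" using Cauchy_convergent convergent_def by blast
  hence "(\<lambda>n. (f n, g n)) \<longlonglongrightarrow> (x, y)" by (intro tendsto_Pair f)
  with g have "(x, y) \<in> closure S" by (rule closureI_sequence)
  thus thesis by (rule that)
qed

lemma hilbert_projection:
  fixes K :: "'h::complex_hilbert_space set"
  assumes K: "0 \<in> K" "\<And>x y. x \<in> K \<Longrightarrow> y \<in> K \<Longrightarrow> x + y \<in> K" "\<And>c x. x \<in> K \<Longrightarrow> c *\<^sub>C x \<in> K"
  obtains p where "p \<in> closure K" "\<And>k. k \<in> K \<Longrightarrow> cinner (\<xi> - p) k = 0"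
proof -
  obtain m where m: "\<And>n. m n \<in> K" "\<And>x. x \<in> K \<Longrightarrow> (\<lambda>n. cinner (\<xi> - m n) x) \<longlonglongrightarrow> 0"
    "\<And>e. e > 0 \<Longrightarrow> \<exists>N. \<forall>i\<ge>N. \<forall>j\<ge>N. (norm (m i - m j))\<^sup>2 < e"
    using cinner.minimizing_sequence[of K \<xi>] K by blast
  have "Cauchy m"
  proof (rule metric_CauchyI)
    fix e :: real assume "e > 0"
    then obtain N where "\<forall>i\<ge>N. \<forall>j\<ge>N. (norm (m i - m j))\<^sup>2 < e\<^sup>2" using m(3)[of "e\<^sup>2"] by auto
    thus "\<exists>N. \<forall>i\<ge>N. \<forall>j\<ge>N. dist (m i) (m j) < e"
      unfolding dist_norm using power_less_imp_less_base[OF _ less_imp_le[OF \<open>e > 0\<close>]] by blast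
  qed
  then obtain p where p: "m \<longlonglongrightarrow> p" using Cauchy_convergent convergent_def by blast
  show thesis
  proof (rule that)
    show "p \<in> closure K" using m(1) p closure_sequential by blast
    fix k assume "k \<in> K"
    moreover have "(\<lambda>n. cinner (\<xi> - m n) k) \<longlonglongrightarrow> cinner (\<xi> - p) k"
      by (intro tendsto_cinner tendsto_intros p)
    ultimately show "cinner (\<xi> - p) k = 0" using m(2) LIMSEQ_unique by blast
  qed
qed

text \<open>\<open>T\<close> is the continuous extension of \<open>g a \<mapsto> g' a\<close> composed with the projection onto the
  closure of the range of \<open>g\<close>.\<close>

lemma bounded_operator_extension:
  fixes g g' :: "'v::complex_normed_vector \<Rightarrow> 'h::complex_hilbert_space"
  assumes g: "clinear g" "clinear g'" and bound: "\<And>a. norm (g' a) \<le> C * norm (g a)" and C: "C \<ge> 0"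
  obtains T where "bounded_operator T" "\<And>a. T (g a) = g' a"
    "\<And>\<xi>. (\<And>a. cinner \<xi> (g a) = 0) \<Longrightarrow> T \<xi> = 0" "\<And>\<xi>. T \<xi> \<in> closure (range g')"
proof -
  define S where "S = range (\<lambda>a. (g a, g' a))"
  have gadd: "g (a + b) = g a + g b" "g' (a + b) = g' a + g' b"
    and gscale: "g (c *\<^sub>C a) = c *\<^sub>C g a" "g' (c *\<^sub>C a) = c *\<^sub>C g' a" for a b c
    using g by (simp_all add: clinear_def)
  have gdiff: "g (a - b) = g a - g b" "g' (a - b) = g' a - g' b" for a b
    using gadd[of a "(-1) *\<^sub>C b"] by (simp_all add: gscale del: scaleC_eqs(4)) simp_all
  have S_add: "p + q \<in> closure S" if "p \<in> closure S" "q \<in> closure S" for p q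
    by (rule closure_closed_under[OF that]) (auto simp: S_def gadd[symmetric] intro: tendsto_add)
  have S_scale: "(c *\<^sub>C x, c *\<^sub>C y) \<in> closure S" if "(x, y) \<in> closure S" for c x y
  proof -
    have "(\<lambda>p q. (c *\<^sub>C fst p, c *\<^sub>C snd p)) (x, y) (x, y) \<in> closure S"
    proof (rule closure_closed_under[OF that that])
      fix u v assume "u \<in> S" "v \<in> S"
      thus "(c *\<^sub>C fst u, c *\<^sub>C snd u) \<in> S" by (auto simp: S_def gscale[symmetric])
    next
      fix f h :: "nat \<Rightarrow> 'h \<times> 'h" assume f: "f \<longlonglongrightarrow> (x, y)"
      show "(\<lambda>n. (c *\<^sub>C fst (f n), c *\<^sub>C snd (f n))) \<longlonglongrightarrow> (c *\<^sub>C fst (x, y), c *\<^sub>C snd (x, y))"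
        by (intro tendsto_Pair bounded_linear.tendsto[OF bounded_linear_scaleC] tendsto_fst tendsto_snd f)
    qed
    thus ?thesis by simp
  qed
  have S_diff: "p - q \<in> S" if "p \<in> S" "q \<in> S" for p q
    using that by (auto simp: S_def gdiff[symmetric])
  have S_bound: "norm y \<le> C * norm x" if "(x, y) \<in> S" for x y
    using that bound by (auto simp: S_def)
  have fst_S: "fst ` S = range g" by (auto simp: S_def image_image)
  have fst_closure: "x \<in> closure (range g)" and snd_closure: "y \<in> closure (range g')"
    if xy: "(x, y) \<in> closure S" for x y
  proof -
    obtain f where f: "\<And>n. f n \<in> S" "f \<longlonglongrightarrow> (x, y)" using xy closure_sequential by blast
    have r: "fst (f n) \<in> range g" "snd (f n) \<in> range g'" for n using f(1)[of n] by (auto simp: S_def)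
    show "x \<in> closure (range g)" "y \<in> closure (range g')"
      using closureI_sequence[OF r(1) tendsto_fst[OF f(2)]] closureI_sequence[OF r(2) tendsto_snd[OF f(2)]]
      by simp_all
  qed
  \<comment> \<open>The operator as a relation: p stands for the projection of \<xi> and \<eta> for
    its image under the closed graph. The bound on \<eta> makes the relation single-valued.\<close>
  define R where "R \<xi> \<eta> \<longleftrightarrow> (\<exists>p. (p, \<eta>) \<in> closure S \<and> (\<forall>a. cinner (\<xi> - p) (g a) = 0))" for \<xi> \<eta>
  have R_add: "R (\<xi> + \<xi>') (\<eta> + \<eta>')" if "R \<xi> \<eta>" "R \<xi>' \<eta>'" for \<xi> \<xi>' \<eta> \<eta>'
  proof -
    obtain p q where "(p, \<eta>) \<in> closure S" "\<forall>a. cinner (\<xi> - p) (g a) = 0"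
      "(q, \<eta>') \<in> closure S" "\<forall>a. cinner (\<xi>' - q) (g a) = 0" using \<open>R \<xi> \<eta>\<close> \<open>R \<xi>' \<eta>'\<close> by (auto simp: R_def)
    thus ?thesis unfolding R_def using S_add[of "(p, \<eta>)" "(q, \<eta>')"]
      by (intro exI[of _ "p + q"]) (auto simp: cinner.diff_left cinner.add_left)
  qed
  have R_scale: "R (c *\<^sub>C \<xi>) (c *\<^sub>C \<eta>)" if r: "R \<xi> \<eta>" for c \<xi> \<eta>
  proof -
    obtain p where "(p, \<eta>) \<in> closure S" "\<forall>a. cinner (\<xi> - p) (g a) = 0" using r by (auto simp: R_def)
    thus ?thesis unfolding R_def using S_scale[of p \<eta> c]
      by (intro exI[of _ "c *\<^sub>C p"]) (auto simp: cinner.diff_left cinner.scaleC_left)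
  qed
  have R_bound: "norm \<eta> \<le> C * norm \<xi>" if r: "R \<xi> \<eta>" for \<xi> \<eta>
  proof -
    obtain p where p: "(p, \<eta>) \<in> closure S" "\<forall>a. cinner (\<xi> - p) (g a) = 0" using r by (auto simp: R_def)
    have "cinner (\<xi> - p) p = 0"
      by (rule cinner_closure_zero[OF _ fst_closure[OF p(1)]]) (use p(2) in auto)
    hence "cinner \<xi> p = complex_of_real ((norm p)\<^sup>2)" by (simp add: cinner.diff_left cinner_self)
    hence "(norm p)\<^sup>2 \<le> norm \<xi> * norm p" using norm_cinner_le[of \<xi> p] by (simp add: norm_power)
    hence "norm p \<le> norm \<xi>" by (cases "norm p = 0") (simp_all add: power2_eq_square)
    moreover have "norm \<eta> \<le> C * norm p" by (rule closure_graph_bound[OF S_bound p(1)])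
    ultimately show ?thesis using C by (meson mult_left_mono order_trans)
  qed
  have R_ex: "\<exists>\<eta>. R \<xi> \<eta>" for \<xi>
  proof -
    have g0: "g 0 = 0" using gscale(1)[of 0 0] by simp
    obtain p where p: "p \<in> closure (range g)" "\<And>k. k \<in> range g \<Longrightarrow> cinner (\<xi> - p) k = 0"
    proof (rule hilbert_projection[of "range g" \<xi>])
      show "0 \<in> range g" using g0 by (metis rangeI)
    qed (auto simp: gadd[symmetric] gscale[symmetric])
    obtain \<eta> where "(p, \<eta>) \<in> closure S"
      by (rule closure_graph_total[OF S_bound S_diff _ C]) (use p fst_S in auto)
    thus ?thesis using p unfolding R_def by blast
  qed
  define T where "T \<xi> = (SOME \<eta>. R \<xi> \<eta>)" for \<xi>
  have RT: "R \<xi> (T \<xi>)" for \<xi> unfolding T_def using R_ex by (rule someI_ex)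
  have T_eq: "T \<xi> = \<eta>" if "R \<xi> \<eta>" for \<xi> \<eta>
  proof -
    have "R (\<xi> + (-1) *\<^sub>C \<xi>) (T \<xi> + (-1) *\<^sub>C \<eta>)" by (intro R_add R_scale RT that)
    thus ?thesis using R_bound by fastforce
  qed
  show thesis
  proof (rule that)
    show "bounded_operator T"
      unfolding bounded_operator_def clinear_def using R_bound RT
      by (auto intro!: T_eq R_add R_scale exI[of _ C])
    fix a
    have "(g a, g' a) \<in> closure S" using closure_subset[of S] by (auto simp: S_def)
    thus "T (g a) = g' a" by (intro T_eq) (auto simp: R_def intro!: exI[of _ "g a"] simp: cinner.diff_left)
  next
    fix \<xi> assume "\<And>a. cinner \<xi> (g a) = 0"
    moreover have "(g 0, g' 0) \<in> S" by (simp add: S_def)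
    from S_diff[OF this this] have "(0, 0) \<in> closure S"
      using closure_subset by (auto simp: zero_prod_def)
    ultimately show "T \<xi> = 0" by (intro T_eq) (auto simp: R_def intro!: exI[of _ 0])
  next
    fix \<xi> show "T \<xi> \<in> closure (range g')" using RT[of \<xi>] snd_closure by (auto simp: R_def)
  qed
qed

section \<open>Realising a semidefinite form in a space of square-summable families\<close>

lift_definition ket :: "'i \<Rightarrow> 'i ell2" is "\<lambda>i j. if j = i then 1 else 0"
  by (rule finite_nonzero_values_imp_summable_on) (auto simp: if_distrib)

lemma cinner_ket [simp]: "cinner v (ket i) = Rep_ell2 v i"
proof transfer
  fix f :: "'a \<Rightarrow> complex" and i
  have "(\<Sum>\<^sub>\<infinity>j. f j * cnj (if j = i then 1 else 0)) = (\<Sum>\<^sub>\<infinity>j\<in>{i}. f j)"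
    by (rule infsum_cong_neutral) auto
  thus "(\<Sum>\<^sub>\<infinity>j. f j * cnj (if j = i then 1 else 0)) = f i" by simp
qed

lemma Rep_ell2_ket: "Rep_ell2 (ket i) j = (if j = i then 1 else 0)"
  by (simp add: ket.rep_eq)

lemma Rep_ell2_linear:
  "Rep_ell2 (v + w) i = Rep_ell2 v i + Rep_ell2 w i" "Rep_ell2 (c *\<^sub>C v) i = c * Rep_ell2 v i"
  by (simp_all add: plus_ell2.rep_eq scaleC_ell2.rep_eq)

text \<open>A maximal isometric graph, each of whose vectors is supported on the domain of the
  graph, is total: if \<open>a\<close> lies outside the domain, then the coordinate of \<open>a\<close> is free and
  is used for the component of \<open>a\<close> orthogonal to the domain.\<close>

theorem (in semi_inner_product) isometry_into_ell2:
  fixes \<iota> :: "'v \<Rightarrow> 'i"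
  assumes \<iota>: "inj \<iota>"
  obtains V :: "'v \<Rightarrow> 'i ell2" where "clinear V" "\<And>x y. cinner (V x) (V y) = G x y"
proof -
  define admissible where "admissible W \<longleftrightarrow> (0, 0) \<in> W \<and>
    (\<forall>x v y w. (x, v) \<in> W \<longrightarrow> (y, w) \<in> W \<longrightarrow> (x + y, v + w) \<in> W \<and> cinner v w = G x y) \<and>
    (\<forall>x v c. (x, v) \<in> W \<longrightarrow> (c *\<^sub>C x, c *\<^sub>C v) \<in> W) \<and>
    (\<forall>x v i. (x, v) \<in> W \<longrightarrow> Rep_ell2 v i \<noteq> 0 \<longrightarrow> i \<in> \<iota> ` Domain W)" for W :: "('v \<times> 'i ell2) set"
  have "\<exists>W\<in>Collect admissible. \<forall>X\<in>Collect admissible. W \<subseteq> X \<longrightarrow> X = W"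
  proof (rule subset_Zorn_nonempty)
    have "admissible {(0, 0)}"
      using scaleC_left[of 0 0 0] cinner.scaleC_left[of 0 0 "0 :: 'i ell2"]
      by (auto simp: admissible_def zero_ell2.rep_eq)
    thus "Collect admissible \<noteq> {}" by blast
    fix C assume ne: "C \<noteq> {}" and chain: "subset.chain (Collect admissible) C"
    have adm: "\<And>W. W \<in> C \<Longrightarrow> admissible W" using chain by (auto simp: subset_chain_def)
    have pair: "\<exists>W\<in>C. p \<in> W \<and> q \<in> W" if "p \<in> \<Union>C" "q \<in> \<Union>C" for p q
    proof -
      obtain W W' where "W \<in> C" "W' \<in> C" "p \<in> W" "q \<in> W'" using \<open>p \<in> \<Union>C\<close> \<open>q \<in> \<Union>C\<close> by blast
      moreover have "W \<subseteq> W' \<or> W' \<subseteq> W" using chain calculation(1,2) by (auto simp: subset_chain_def)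
      ultimately show ?thesis by blast
    qed
    have "admissible (\<Union>C)"
      unfolding admissible_def
    proof (intro conjI allI impI)
      show "(0, 0) \<in> \<Union>C" using ne adm by (auto simp: admissible_def)
    next
      fix x v y w assume "(x, v) \<in> \<Union>C" "(y, w) \<in> \<Union>C"
      then obtain W where "W \<in> C" "(x, v) \<in> W" "(y, w) \<in> W" using pair by blast
      with adm[of W] show "(x + y, v + w) \<in> \<Union>C" "cinner v w = G x y"
        unfolding admissible_def by blast+
    next
      fix x v c assume "(x, v) \<in> \<Union>C"
      thus "(c *\<^sub>C x, c *\<^sub>C v) \<in> \<Union>C" using adm unfolding admissible_def by blast
    next
      fix x v i assume "(x, v) \<in> \<Union>C" "Rep_ell2 v i \<noteq> 0"
      thus "i \<in> \<iota> ` Domain (\<Union>C)" using adm unfolding admissible_def by blast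
    qed
    thus "\<Union>C \<in> Collect admissible" by simp
  qed
  then obtain W where "admissible W" and maximal: "\<And>X. admissible X \<Longrightarrow> W \<subseteq> X \<Longrightarrow> X = W" by auto
  hence zero: "(0, 0) \<in> W"
    and add: "\<And>x v y w. (x, v) \<in> W \<Longrightarrow> (y, w) \<in> W \<Longrightarrow> (x + y, v + w) \<in> W"
    and inner: "\<And>x v y w. (x, v) \<in> W \<Longrightarrow> (y, w) \<in> W \<Longrightarrow> cinner v w = G x y"
    and scale: "\<And>x v c. (x, v) \<in> W \<Longrightarrow> (c *\<^sub>C x, c *\<^sub>C v) \<in> W"
    and supp: "\<And>x v i. (x, v) \<in> W \<Longrightarrow> Rep_ell2 v i \<noteq> 0 \<Longrightarrow> i \<in> \<iota> ` Domain W"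
    unfolding admissible_def by blast+
  have "a \<in> Domain W" for a
  proof (rule ccontr)
    assume a: "a \<notin> Domain W"
    obtain m where m: "\<And>n::nat. m n \<in> Domain W"
      "\<And>x. x \<in> Domain W \<Longrightarrow> (\<lambda>n. G (a - m n) x) \<longlonglongrightarrow> 0"
      "\<And>e. e > 0 \<Longrightarrow> \<exists>N. \<forall>i\<ge>N. \<forall>j\<ge>N. Q (m i - m j) < e"
    proof (rule minimizing_sequence[of "Domain W" a])
      show "0 \<in> Domain W" using zero by blast
    qed (use add scale in blast)+
    have "\<exists>v. (m n, v) \<in> W" for n using m(1)[of n] by blast
    then obtain v where v: "\<And>n. (m n, v n) \<in> W" by metis
    have dist_v: "(dist (v i) (v j))\<^sup>2 = Q (m i - m j)" for i j
    proof -
      have "(m i - m j, v i - v j) \<in> W" using add[OF v[of i] scale[OF v[of j], of "-1"]] by simp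
      from inner[OF this this] have "complex_of_real ((norm (v i - v j))\<^sup>2) = complex_of_real (Q (m i - m j))"
        by (simp only: self cinner_self)
      thus ?thesis by (simp only: of_real_eq_iff dist_norm)
    qed
    have "Cauchy v"
    proof (rule metric_CauchyI)
      fix e :: real assume "e > 0"
      then obtain N where N: "\<forall>i\<ge>N. \<forall>j\<ge>N. (dist (v i) (v j))\<^sup>2 < e\<^sup>2"
        using m(3)[of "e\<^sup>2"] by (auto simp: dist_v)
      thus "\<exists>N. \<forall>i\<ge>N. \<forall>j\<ge>N. dist (v i) (v j) < e"
        using power_less_imp_less_base[OF _ less_imp_le[OF \<open>e > 0\<close>]] by blast
    qed
    \<comment> \<open>The image of the projection of \<open>a\<close> to the domain. The projection
      itself may fail to exist in \<open>'v\<close>, but the images of the minimizing sequence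
      converge in \<open>ell2\<close>.\<close>
    then obtain y where y: "v \<longlonglongrightarrow> y" using Cauchy_convergent convergent_def by blast
    have yw: "cinner y w = G a x" if xw: "(x, w) \<in> W" for x w
    proof (rule LIMSEQ_unique)
      show "(\<lambda>n. cinner (v n) w) \<longlonglongrightarrow> cinner y w" by (intro tendsto_cinner y tendsto_const)
      have "(\<lambda>n. G a x - G (a - m n) x) \<longlonglongrightarrow> G a x - 0"
        using xw by (intro tendsto_diff tendsto_const m(2)) blast
      moreover have "G a x - G (a - m n) x = cinner (v n) w" for n
        using inner[OF v[of n] xw] by (simp add: diff_left)
      ultimately show "(\<lambda>n. cinner (v n) w) \<longlonglongrightarrow> G a x" by simp
    qed
    have y_le: "(norm y)\<^sup>2 \<le> Q a"
    proof (cases "y = 0")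
      case False
      have "(\<lambda>n. cmod (cinner y (v n))) \<longlonglongrightarrow> cmod (cinner y y)"
        by (intro tendsto_intros tendsto_cinner y)
      moreover have "(\<lambda>n. sqrt (Q a) * norm (v n)) \<longlonglongrightarrow> sqrt (Q a) * norm y"
        by (intro tendsto_intros y)
      moreover have "cmod (cinner y (v n)) \<le> sqrt (Q a) * norm (v n)" for n
      proof -
        have "complex_of_real (Q (m n)) = complex_of_real ((norm (v n))\<^sup>2)"
          using inner[OF v[of n] v[of n]] by (simp only: self cinner_self)
        hence "Q (m n) = (norm (v n))\<^sup>2" by (simp only: of_real_eq_iff)
        moreover have "(cmod (G a (m n)))\<^sup>2 \<le> Q a * Q (m n)" by (rule Cauchy_Schwarz)
        ultimately have "cmod (G a (m n)) \<le> sqrt (Q a * (norm (v n))\<^sup>2)" by (intro real_le_rsqrt) simp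
        thus ?thesis by (simp add: yw[OF v] real_sqrt_mult)
      qed
      ultimately have "cmod (cinner y y) \<le> sqrt (Q a) * norm y" by (intro LIMSEQ_le) auto
      hence "norm y * norm y \<le> sqrt (Q a) * norm y"
        by (simp only: cinner_self norm_of_real) (simp add: power2_eq_square)
      hence "norm y \<le> sqrt (Q a)" using False by simp
      hence "(norm y)\<^sup>2 \<le> (sqrt (Q a))\<^sup>2" by (intro power_mono) auto
      thus ?thesis using Q_nonneg by simp
    qed (simp add: Q_nonneg)
    have y_supp: "i \<in> \<iota> ` Domain W" if i: "Rep_ell2 y i \<noteq> 0" for i
    proof (rule ccontr)
      assume ni: "i \<notin> \<iota> ` Domain W"
      have "(\<lambda>n. cinner (v n) (ket i)) \<longlonglongrightarrow> cinner y (ket i)" by (intro tendsto_cinner y tendsto_const)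
      moreover have "Rep_ell2 (v n) i = 0" for n using supp[OF v] ni by blast
      ultimately show False using i by (simp add: LIMSEQ_const_iff)
    qed
    have \<iota>a: "\<iota> a \<notin> \<iota> ` Domain W" using a \<iota> by (auto simp: inj_def)
    \<comment> \<open>The length of the component of \<open>a\<close> orthogonal to the domain. The
      Bessel inequality \<open>y_le\<close> makes its square equal to the difference under the
      root.\<close>
    define \<delta> where "\<delta> = sqrt (Q a - (norm y)\<^sup>2)"
    define u where "u = y + complex_of_real \<delta> *\<^sub>C ket (\<iota> a)"
    have ket_w: "cinner (ket (\<iota> a)) w = 0" if "Rep_ell2 w (\<iota> a) = 0" for w
      using cinner.commute[of "ket (\<iota> a)" w] that by simp
    have y_a: "Rep_ell2 y (\<iota> a) = 0" using y_supp \<iota>a by blast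
    have w_a: "Rep_ell2 w (\<iota> a) = 0" if "(x, w) \<in> W" for x w using supp[OF that] \<iota>a by blast
    have uw: "cinner u w = G a x" if "(x, w) \<in> W" for x w
      using yw[OF that] ket_w[OF w_a[OF that]] by (simp add: u_def cinner_add_left cinner_scaleC_left)
    have wu: "cinner w u = G x a" if "(x, w) \<in> W" for x w
      using uw[OF that] cinner.commute[of w u] commute[of x a] by simp
    have uu: "cinner u u = G a a"
    proof -
      have "cinner u u = complex_of_real ((norm y)\<^sup>2) + complex_of_real (\<delta> * \<delta>)"
        unfolding u_def using ket_w[OF y_a] y_a
        by (simp add: cinner_add_left cinner_scaleC_left cinner.add_right cinner.scaleC_right
            cinner_self[of y] Rep_ell2_ket Rep_ell2_linear)
      also have "\<dots> = complex_of_real (Q a)" using y_le by (simp add: \<delta>_def flip: of_real_add)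
      finally show ?thesis by (simp add: self)
    qed
    define W' where "W' = {(x + c *\<^sub>C a, w + c *\<^sub>C u) |x w c. (x, w) \<in> W}"
    have sub: "W \<subseteq> W'" by (force simp: W'_def intro: exI[of _ 0])
    have a_in: "(a, u) \<in> W'"
      unfolding W'_def using zero by (auto intro!: exI[of _ 0] exI[of _ 1])
    have dom: "\<iota> ` Domain W \<subseteq> \<iota> ` Domain W'" "\<iota> a \<in> \<iota> ` Domain W'" using sub a_in by blast+
    have "admissible W'"
      unfolding admissible_def
    proof (intro conjI allI impI)
      show "(0, 0) \<in> W'" using sub zero by blast
    next
      fix x1 v1 x2 v2 assume "(x1, v1) \<in> W'" "(x2, v2) \<in> W'"
      then obtain x w c x' w' c' where e: "x1 = x + c *\<^sub>C a" "v1 = w + c *\<^sub>C u" "(x, w) \<in> W"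
        "x2 = x' + c' *\<^sub>C a" "v2 = w' + c' *\<^sub>C u" "(x', w') \<in> W" by (auto simp: W'_def)
      have "x1 + x2 = (x + x') + (c + c') *\<^sub>C a" "v1 + v2 = (w + w') + (c + c') *\<^sub>C u"
        by (simp_all add: e scaleC_add_left)
      thus "(x1 + x2, v1 + v2) \<in> W'" unfolding W'_def using add[OF e(3) e(6)] by blast
      show "cinner v1 v2 = G x1 x2"
        unfolding e(1,2,4,5) using inner[OF e(3) e(6)] uw[OF e(6)] wu[OF e(3)] uu
        by (simp add: cinner_add_left cinner_scaleC_left cinner.add_right cinner.scaleC_right
            add_left add_right scaleC_left scaleC_right)
    next
      fix x1 v1 d assume "(x1, v1) \<in> W'"
      then obtain x w c where e: "x1 = x + c *\<^sub>C a" "v1 = w + c *\<^sub>C u" "(x, w) \<in> W" by (auto simp: W'_def)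
      have "d *\<^sub>C x1 = d *\<^sub>C x + (d * c) *\<^sub>C a" "d *\<^sub>C v1 = d *\<^sub>C w + (d * c) *\<^sub>C u"
        by (simp_all add: e scaleC_add_right)
      thus "(d *\<^sub>C x1, d *\<^sub>C v1) \<in> W'" unfolding W'_def using scale[OF e(3), of d] by blast
    next
      fix x1 v1 i assume "(x1, v1) \<in> W'" and i: "Rep_ell2 v1 i \<noteq> 0"
      then obtain x w c where e: "x1 = x + c *\<^sub>C a" "v1 = w + c *\<^sub>C u" "(x, w) \<in> W" by (auto simp: W'_def)
      have "Rep_ell2 w i \<noteq> 0 \<or> Rep_ell2 y i \<noteq> 0 \<or> i = \<iota> a"
        using i by (auto simp: e u_def Rep_ell2_linear Rep_ell2_ket split: if_splits)
      thus "i \<in> \<iota> ` Domain W'" using supp[OF e(3)] y_supp dom by blast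
    qed
    with sub have "W' = W" by (intro maximal)
    thus False using a a_in by blast
  qed
  hence "\<exists>v. (x, v) \<in> W" for x by blast
  then obtain V where V: "\<And>x. (x, V x) \<in> W" by metis
  have unique: "v = w" if vw: "(x, v) \<in> W" "(x, w) \<in> W" for x v w
  proof -
    have "(0, v - w) \<in> W" using add[OF vw(1) scale[OF vw(2), of "-1"]] by simp
    from inner[OF this this] have "cinner (v - w) (v - w) = 0"
      using scaleC_left[of 0 0 0] by simp
    thus ?thesis by (simp add: cinner_self)
  qed
  show thesis
  proof (rule that)
    show "clinear V"
      unfolding clinear_def using unique[OF V] add[OF V V] scale[OF V] by blast
  qed (rule inner[OF V V])
qed

section \<open>Calculus of bounded operators\<close>

lemma bounded_operator_linear: "bounded_operator T \<Longrightarrow> bounded_linear T"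
  unfolding bounded_operator_def clinear_def
  by (metis bounded_linear_intro scaleR_scaleC mult.commute)

lemma bounded_operator_clinear: "bounded_operator T \<Longrightarrow> clinear T"
  by (simp add: bounded_operator_def)

lemma bounded_operatorI:
  "clinear T \<Longrightarrow> bounded_linear T \<Longrightarrow> bounded_operator T"
  unfolding bounded_operator_def using bounded_linear.bounded[of T] by (auto simp: mult.commute)

lemma clinear_simps:
  assumes "clinear f"
  shows "f (x + y) = f x + f y" "f (c *\<^sub>C x) = c *\<^sub>C f x" "f 0 = 0" "f (- x) = - f x"
    "f (x - y) = f x - f y"
proof -
  show 1: "f (x + y) = f x + f y" "f (c *\<^sub>C x) = c *\<^sub>C f x" for x y c
    using assms by (auto simp: clinear_def)
  show "f 0 = 0" using 1(2)[of 0 0] by simp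
  show 2: "f (- x) = - f x" for x using 1(2)[of "-1" x] by simp
  show "f (x - y) = f x - f y" using 1(1)[of x "-y"] 2 by simp
qed

lemma bounded_operator_ops:
  assumes "bounded_operator S" "bounded_operator T"
  shows "bounded_operator (\<lambda>x. S x + T x)" "bounded_operator (S \<circ> T)"
proof -
  note b = assms[THEN bounded_operator_linear] and l = assms[THEN bounded_operator_clinear]
  show "bounded_operator (\<lambda>x. S x + T x)"
    by (intro bounded_operatorI bounded_linear_add b)
      (simp add: clinear_def clinear_simps[OF l(1)] clinear_simps[OF l(2)] scaleC_add_right)
  show "bounded_operator (S \<circ> T)"
    unfolding o_def
    by (intro bounded_operatorI bounded_linear_compose[OF b])
      (simp add: clinear_def clinear_simps[OF l(1)] clinear_simps[OF l(2)])
qed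

lemma bounded_operator_scaleC:
  assumes "bounded_operator T"
  shows "bounded_operator (\<lambda>x. c *\<^sub>C T x)"
  by (intro bounded_operatorI bounded_linear_compose[OF bounded_linear_scaleC
        bounded_operator_linear[OF assms]])
    (simp add: clinear_def clinear_simps[OF bounded_operator_clinear[OF assms]] scaleC_add_right mult.commute)

lemma bounded_linear_cinner_operator:
  assumes "bounded_operator T"
  shows "bounded_linear (\<lambda>\<xi>. cinner (T \<xi>) \<eta>)" "bounded_linear (\<lambda>\<xi>. cinner \<eta> (T \<xi>))"
  by (rule bounded_linear_compose[OF bounded_bilinear.bounded_linear_left[OF bounded_bilinear_cinner]
        bounded_operator_linear[OF assms]])
    (rule bounded_linear_compose[OF bounded_bilinear.bounded_linear_right[OF bounded_bilinear_cinner]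
        bounded_operator_linear[OF assms]])

lemma bounded_operator_id: "bounded_operator (\<lambda>x. x)"
  by (rule bounded_operatorI) (auto simp: clinear_def)

text \<open>Split \<xi> by the projection onto the closure of the range. Operators on the GNS space
  are prescribed on these two pieces, so their identities are verified there.\<close>

lemma eq_on_range_and_complement:
  fixes g :: "'v::complex_normed_vector \<Rightarrow> 'h::complex_hilbert_space"
    and F F' :: "'h \<Rightarrow> 'z::real_normed_vector"
  assumes g: "clinear g" and F: "bounded_linear F" "bounded_linear F'"
    and eq: "\<And>a. F (g a) = F' (g a)" "\<And>\<xi>. (\<And>a. cinner \<xi> (g a) = 0) \<Longrightarrow> F \<xi> = F' \<xi>"
  shows "F \<xi> = F' \<xi>"
proof -
  obtain p where p: "p \<in> closure (range g)" "\<And>k. k \<in> range g \<Longrightarrow> cinner (\<xi> - p) k = 0"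
  proof (rule hilbert_projection[of "range g" \<xi>])
    show "0 \<in> range g" using clinear_simps(3)[OF g] by (metis rangeI)
  qed (auto simp: clinear_simps(1,2)[OF g, symmetric])
  obtain f where f: "\<And>n. f n \<in> range g" "f \<longlonglongrightarrow> p" using p(1) closure_sequential by blast
  have "(\<lambda>n. F (f n)) \<longlonglongrightarrow> F p" "(\<lambda>n. F' (f n)) \<longlonglongrightarrow> F' p"
    by (rule bounded_linear.tendsto[OF F(1) f(2)] bounded_linear.tendsto[OF F(2) f(2)])+
  moreover have "F (f n) = F' (f n)" for n using f(1)[of n] eq(1) by auto
  ultimately have "F p = F' p" using LIMSEQ_unique by fastforce
  moreover have "F (\<xi> - p) = F' (\<xi> - p)" using p(2) by (intro eq(2)) auto
  ultimately show ?thesis by (simp add: linear_diff[OF bounded_linear.linear[OF F(1)]]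
        linear_diff[OF bounded_linear.linear[OF F(2)]])
qed

section \<open>The GNS construction\<close>

definition complexify :: "('a::cstar_algebra \<Rightarrow> real) \<Rightarrow> 'a \<Rightarrow> complex"
  where "complexify f x = Complex (f x) (- f (\<i> *\<^sub>C x))"

lemma complexify:
  assumes "positive_functional f"
  shows "complexify f (x + y) = complexify f x + complexify f y"
    "complexify f (c *\<^sub>C x) = c * complexify f x"
    "complexify f (star x) = cnj (complexify f x)"
    "Re (complexify f x) = f x"
proof -
  have f: "linear f" "\<And>x. f (star x) = f x" using assms by (auto simp: positive_functional_def)
  show "complexify f (x + y) = complexify f x + complexify f y"
    by (simp add: complexify_def complex_eq_iff scaleC_add_right linear_add[OF f(1)])
  have dec: "c *\<^sub>C x = Re c *\<^sub>R x + Im c *\<^sub>R (\<i> *\<^sub>C x)" for c x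
    by (simp add: scaleR_scaleC scaleC_add_left[symmetric] mult.commute flip: complex_eq)
  have "f (c *\<^sub>C x) = Re c * f x + Im c * f (\<i> *\<^sub>C x)" for c x
    by (subst dec) (simp add: linear_add[OF f(1)] linear_scale[OF f(1)])
  from this[of c x] this[of "\<i> * c" x]
  show "complexify f (c *\<^sub>C x) = c * complexify f x"
    by (simp add: complexify_def complex_eq_iff)
  have "f (\<i> *\<^sub>C star x) = f (star (\<i> *\<^sub>C star x))" by (simp only: f(2))
  also have "\<dots> = f (- (\<i> *\<^sub>C x))" by simp
  also have "\<dots> = - f (\<i> *\<^sub>C x)" by (rule linear_neg[OF f(1)])
  finally show "complexify f (star x) = cnj (complexify f x)"
    by (simp add: complexify_def complex_eq_iff f(2))
qed (simp add: complexify_def)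

lemma positive_functional_form:
  assumes f: "positive_functional f"
  shows "semi_inner_product (\<lambda>a b. complexify f (star b * a))"
proof
  show "complexify f (star y * x) = cnj (complexify f (star x * y))" for x y
    unfolding complexify(3)[OF f, symmetric] by simp
  show "0 \<le> Re (complexify f (star x * x))" for x
    using f by (simp add: complexify(4)[OF f] positive_functional_def)
qed (simp_all add: distrib_left complexify[OF f] mult_scaleC_right)

lemma norm_gns:
  assumes f: "positive_functional f" and V: "\<And>a b. cinner (V a) (V b) = complexify f (star b * a)"
  shows "(norm (V a))\<^sup>2 = f (star a * a)"
proof -
  have "Re (complex_of_real ((norm (V a))\<^sup>2)) = f (star a * a)"
    unfolding cinner_self[symmetric] V by (rule complexify(4)[OF f])
  thus ?thesis by simp
qed

text \<open>\<open>V a\<close> plays the class of \<open>a\<close> in the completion. Since the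
  closed range of \<open>V\<close> may be smaller than the test space, \<open>\<pi> 1\<close> is in
  general a projection rather than the identity, which \<open>cstar_representation\<close>
  admits.\<close>

theorem gns_construction:
  fixes f :: "'d::unital_cstar_algebra \<Rightarrow> real" and \<iota> :: "'d \<Rightarrow> 'i"
  assumes f: "positive_functional f" and \<iota>: "inj \<iota>"
  obtains V :: "'d \<Rightarrow> 'i ell2" and \<pi> where "clinear V"
    "\<And>a b. cinner (V a) (V b) = complexify f (star b * a)"
    "cstar_representation \<pi>" "\<And>x a. \<pi> x (V a) = V (x * a)"
proof -
  interpret semi_inner_product "\<lambda>a b. complexify f (star b * a)"
    by (rule positive_functional_form[OF f])
  obtain V :: "'d \<Rightarrow> 'i ell2" where V: "clinear V" "\<And>x y. cinner (V x) (V y) = complexify f (star y * x)"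
    using isometry_into_ell2[OF \<iota>] by blast
  note nV = norm_gns[OF f V(2)]
  have "\<exists>T. bounded_operator T \<and> (\<forall>a. T (V a) = V (x * a)) \<and>
    (\<forall>\<xi>. (\<forall>a. cinner \<xi> (V a) = 0) \<longrightarrow> T \<xi> = 0) \<and> (\<forall>\<xi>. T \<xi> \<in> closure (range V))" for x
  proof -
    have "norm (V (x * a)) \<le> norm x * norm (V a)" for a
    proof (rule power2_le_imp_le)
      show "(norm (V (x * a)))\<^sup>2 \<le> (norm x * norm (V a))\<^sup>2"
        using positive_functional_bound[OF f, of x a] by (simp add: nV power_mult_distrib)
    qed simp
    moreover have "clinear (\<lambda>a. V (x * a))"
      by (simp add: clinear_def distrib_left mult_scaleC_right clinear_simps[OF V(1)])
    ultimately obtain T where "bounded_operator T" "\<And>a. T (V a) = V (x * a)"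
      "\<And>\<xi>. (\<And>a. cinner \<xi> (V a) = 0) \<Longrightarrow> T \<xi> = 0" "\<And>\<xi>. T \<xi> \<in> closure (range (\<lambda>a. V (x * a)))"
      using bounded_operator_extension[OF V(1), of "\<lambda>a. V (x * a)" "norm x"] by auto
    moreover have "closure (range (\<lambda>a. V (x * a))) \<subseteq> closure (range V)"
      by (rule closure_mono) auto
    ultimately show ?thesis by blast
  qed
  then obtain \<pi> where \<pi>: "\<And>x. bounded_operator (\<pi> x)" "\<And>x a. \<pi> x (V a) = V (x * a)"
    "\<And>x \<xi>. (\<And>a. cinner \<xi> (V a) = 0) \<Longrightarrow> \<pi> x \<xi> = 0" "\<And>x \<xi>. \<pi> x \<xi> \<in> closure (range V)"
    by metis
  have op_eqI: "S = T" if "bounded_operator S" "bounded_operator T" "\<And>a. S (V a) = T (V a)"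
    "\<And>\<xi>. (\<And>a. cinner \<xi> (V a) = 0) \<Longrightarrow> S \<xi> = T \<xi>" for S T :: "'i ell2 \<Rightarrow> 'i ell2"
    using eq_on_range_and_complement[OF V(1) bounded_operator_linear[OF that(1)]
        bounded_operator_linear[OF that(2)] that(3,4)] by blast
  have \<pi>0: "\<pi> x 0 = 0" for x using clinear_simps(3)[OF bounded_operator_clinear[OF \<pi>(1)]] .
  have "cstar_representation \<pi>"
    unfolding cstar_representation_def
  proof (intro conjI allI)
    fix x y c
    show "bounded_operator (\<pi> x)" by (rule \<pi>(1))
    show "\<pi> (x + y) = (\<lambda>\<xi>. \<pi> x \<xi> + \<pi> y \<xi>)"
      by (intro op_eqI bounded_operator_ops bounded_operator_scaleC \<pi>) (simp_all add: \<pi>(2,3) distrib_right clinear_simps[OF V(1)])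
    show "\<pi> (c *\<^sub>C x) = (\<lambda>\<xi>. c *\<^sub>C \<pi> x \<xi>)"
      by (intro op_eqI bounded_operator_ops bounded_operator_scaleC \<pi>) (simp_all add: \<pi>(2,3) mult_scaleC_left clinear_simps[OF V(1)])
    show "\<pi> (x * y) = \<pi> x \<circ> \<pi> y"
      by (intro op_eqI bounded_operator_ops bounded_operator_scaleC \<pi>) (simp_all add: \<pi>(2,3) \<pi>0 mult.assoc)
    show "is_adjoint (\<pi> x) (\<pi> (star x))"
      unfolding is_adjoint_def
    proof (intro allI)
      fix \<xi> \<eta>
      \<comment> \<open>The adjoint relation is sesquilinear and gets extended one variable at a
        time: first \<eta> is arbitrary while \<xi> = V a, then \<xi> is arbitrary too.\<close>
      have step: "cinner (\<pi> x (V a)) \<eta> = cinner (V a) (\<pi> (star x) \<eta>)" for a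
      proof (rule eq_on_range_and_complement[where F = "\<lambda>\<eta>. cinner (\<pi> x (V a)) \<eta>"
            and F' = "\<lambda>\<eta>. cinner (V a) (\<pi> (star x) \<eta>)" and \<xi> = \<eta>, OF V(1)])
        show "bounded_linear (\<lambda>\<eta>. cinner (\<pi> x (V a)) \<eta>)"
          by (rule bounded_linear_cinner_operator[OF bounded_operator_id])
        show "bounded_linear (\<lambda>\<eta>. cinner (V a) (\<pi> (star x) \<eta>))"
          by (rule bounded_linear_cinner_operator[OF \<pi>(1)])
        show "cinner (\<pi> x (V a)) (V b) = cinner (V a) (\<pi> (star x) (V b))" for b
          by (simp add: \<pi>(2) V(2) mult.assoc)
        fix \<zeta> assume z: "\<And>b. cinner \<zeta> (V b) = 0"
        have "cinner (V b) \<zeta> = 0" for b using z[of b] cinner.commute[of "V b" \<zeta>] by simp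
        thus "cinner (\<pi> x (V a)) \<zeta> = cinner (V a) (\<pi> (star x) \<zeta>)"
          using \<pi>(3)[OF z] cinner.minus_right[of "V a" 0] by (simp add: \<pi>(2))
      qed
      show "cinner (\<pi> x \<xi>) \<eta> = cinner \<xi> (\<pi> (star x) \<eta>)"
      proof (rule eq_on_range_and_complement[where F = "\<lambda>\<xi>. cinner (\<pi> x \<xi>) \<eta>"
            and F' = "\<lambda>\<xi>. cinner \<xi> (\<pi> (star x) \<eta>)" and \<xi> = \<xi>, OF V(1)])
        show "bounded_linear (\<lambda>\<xi>. cinner (\<pi> x \<xi>) \<eta>)"
          by (rule bounded_linear_cinner_operator[OF \<pi>(1)])
        show "bounded_linear (\<lambda>\<xi>. cinner \<xi> (\<pi> (star x) \<eta>))"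
          by (rule bounded_linear_cinner_operator(1)[OF bounded_operator_id])
        fix \<zeta> assume z: "\<And>a. cinner \<zeta> (V a) = 0"
        have "cinner \<zeta> (\<pi> (star x) \<eta>) = 0"
          by (rule cinner_closure_zero[OF _ \<pi>(4)]) (use z in auto)
        thus "cinner (\<pi> x \<zeta>) \<eta> = cinner \<zeta> (\<pi> (star x) \<eta>)"
          using \<pi>(3)[OF z] cinner.minus_left[of 0 \<eta>] by simp
      qed (rule step)
    qed
  qed
  with V \<pi>(2) show thesis by (intro that)
qed

section \<open>Universal C*-algebras\<close>

lemma representation_simps:
  assumes "cstar_representation \<pi>"
  shows "bounded_operator (\<pi> a)" "\<pi> (a + b) \<xi> = \<pi> a \<xi> + \<pi> b \<xi>" "\<pi> (c *\<^sub>C a) \<xi> = c *\<^sub>C \<pi> a \<xi>"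
    "\<pi> (a * b) \<xi> = \<pi> a (\<pi> b \<xi>)" "cinner (\<pi> a \<xi>) \<eta> = cinner \<xi> (\<pi> (star a) \<eta>)"
    "\<pi> 0 = (\<lambda>\<xi>. 0)" "\<pi> (a - b) \<xi> = \<pi> a \<xi> - \<pi> b \<xi>" "\<pi> (- a) \<xi> = - \<pi> a \<xi>"
proof -
  have r: "\<pi> (a + b) \<xi> = \<pi> a \<xi> + \<pi> b \<xi>" "\<pi> (c *\<^sub>C a) \<xi> = c *\<^sub>C \<pi> a \<xi>" for a b c \<xi>
    using assms unfolding cstar_representation_def by (metis (no_types, lifting))+
  show "bounded_operator (\<pi> a)" "\<pi> (a * b) \<xi> = \<pi> a (\<pi> b \<xi>)"
    "cinner (\<pi> a \<xi>) \<eta> = cinner \<xi> (\<pi> (star a) \<eta>)"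
    using assms unfolding cstar_representation_def is_adjoint_def by auto
  show "\<pi> (a + b) \<xi> = \<pi> a \<xi> + \<pi> b \<xi>" "\<pi> (c *\<^sub>C a) \<xi> = c *\<^sub>C \<pi> a \<xi>" by (rule r)+
  show "\<pi> 0 = (\<lambda>\<xi>. 0)" using r(2)[of 0 0] by (simp add: fun_eq_iff)
  show n: "\<pi> (- a) \<xi> = - \<pi> a \<xi>" for a using r(2)[of "-1" a \<xi>] by simp
  show "\<pi> (a - b) \<xi> = \<pi> a \<xi> - \<pi> b \<xi>" using r(1)[of a "-b" \<xi>] by (simp add: n)
qed

lemma representation_star_hom:
  assumes \<pi>: "cstar_representation \<pi>" and f: "star_hom f"
  shows "cstar_representation (\<lambda>a. \<pi> (f a))"
  using f representation_simps[OF \<pi>]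
  unfolding cstar_representation_def star_hom_def clinear_def is_adjoint_def by (auto simp: fun_eq_iff)

lemma star_hom_embed: "star_hom embed"
  unfolding star_hom_def clinear_def by (simp add: embed_simps)

text \<open>For \<open>\<parallel>a\<parallel> \<le> 1\<close> and \<open>r\<^sup>2 = 1 - a\<^sup>* a\<close> in the unitization,
  \<open>\<parallel>\<xi>\<parallel>\<^sup>2 - \<parallel>\<pi> a \<xi>\<parallel>\<^sup>2 = \<parallel>\<pi> r \<xi>\<parallel>\<^sup>2\<close>.\<close>

lemma representation_contractive:
  assumes \<pi>: "cstar_representation \<pi>"
  shows "norm (\<pi> a \<xi>) \<le> norm a * norm \<xi>"
proof -
  note r = representation_simps[OF \<pi>]
  have unit: "norm (\<pi> a \<xi>) \<le> norm \<xi>" if a: "norm a \<le> 1" for a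
  proof -
    have "norm (embed (star a * a)) \<le> 1" using a by (simp add: cstar_identity power_le_one)
    moreover have "star (embed (star a * a)) = embed (star a * a)" by (rule unitization_eqI) auto
    ultimately obtain q where q: "q * q = 1 - embed (star a * a)" "star q = q"
      using sqrt_one_minus[of "embed (star a * a)"] by metis
    define w where "w = alg_part q"
    define \<mu> where "\<mu> = scalar_part q"
    have w: "star w = w" "cnj \<mu> = \<mu>" "\<mu> * \<mu> = 1" "w * w + \<mu> *\<^sub>C w + \<mu> *\<^sub>C w = - (star a * a)"
      using arg_cong[OF q(2), of alg_part] arg_cong[OF q(2), of scalar_part]
        arg_cong[OF q(1), of alg_part] arg_cong[OF q(1), of scalar_part]
      by (simp_all add: w_def \<mu>_def)
    have lin: "\<pi> a (\<xi> + \<eta>) = \<pi> a \<xi> + \<pi> a \<eta>" "\<pi> a (c *\<^sub>C \<xi>) = c *\<^sub>C \<pi> a \<xi>" for a c \<xi> \<eta>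
      using clinear_simps[OF bounded_operator_clinear[OF r(1)]] by blast+
    have adj: "cinner (\<pi> w \<xi> + \<mu> *\<^sub>C \<xi>) \<eta> = cinner \<xi> (\<pi> w \<eta> + \<mu> *\<^sub>C \<eta>)" for \<eta>
      by (simp add: cinner_add_left cinner_scaleC_left cinner.add_right cinner.scaleC_right r(5) w)
    have "cinner (\<pi> w \<xi> + \<mu> *\<^sub>C \<xi>) (\<pi> w \<xi> + \<mu> *\<^sub>C \<xi>) = cinner \<xi> (\<pi> w (\<pi> w \<xi> + \<mu> *\<^sub>C \<xi>) + \<mu> *\<^sub>C (\<pi> w \<xi> + \<mu> *\<^sub>C \<xi>))"
      by (rule adj)
    also have "\<pi> w (\<pi> w \<xi> + \<mu> *\<^sub>C \<xi>) + \<mu> *\<^sub>C (\<pi> w \<xi> + \<mu> *\<^sub>C \<xi>) = \<pi> (w * w + \<mu> *\<^sub>C w + \<mu> *\<^sub>C w) \<xi> + \<xi>"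
      by (simp add: r(2,3,4) lin scaleC_add_right w add_ac)
    also have "\<dots> = \<xi> - \<pi> (star a) (\<pi> a \<xi>)" unfolding w by (simp add: r(4,8))
    also have "cinner \<xi> \<dots> = cinner \<xi> \<xi> - cinner (\<pi> a \<xi>) (\<pi> a \<xi>)" by (simp add: cinner.diff_right r(5))
    finally have "complex_of_real ((norm (\<pi> w \<xi> + \<mu> *\<^sub>C \<xi>))\<^sup>2) = complex_of_real ((norm \<xi>)\<^sup>2 - (norm (\<pi> a \<xi>))\<^sup>2)"
      by (simp only: cinner_self of_real_diff)
    hence "(norm (\<pi> w \<xi> + \<mu> *\<^sub>C \<xi>))\<^sup>2 = (norm \<xi>)\<^sup>2 - (norm (\<pi> a \<xi>))\<^sup>2" by (simp only: of_real_eq_iff)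
    hence "(norm (\<pi> a \<xi>))\<^sup>2 \<le> (norm \<xi>)\<^sup>2" using zero_le_power2[of "norm (\<pi> w \<xi> + \<mu> *\<^sub>C \<xi>)"] by linarith
    thus ?thesis by (rule power2_le_imp_le) simp
  qed
  show ?thesis
  proof (cases "a = 0")
    case True
    thus ?thesis by (simp add: r(6))
  next
    case False
    define c where "c = complex_of_real (norm a)"
    have c: "c \<noteq> 0" "cmod c = norm a" using False by (simp_all add: c_def)
    have "norm (\<pi> (inverse c *\<^sub>C a) \<xi>) \<le> norm \<xi>"
      by (rule unit) (use c False in \<open>simp add: norm_scaleC norm_inverse\<close>)
    hence "inverse (norm a) * norm (\<pi> a \<xi>) \<le> norm \<xi>" using c by (simp add: r(3) norm_scaleC norm_inverse)
    thus ?thesis using False by (simp add: field_simps)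
  qed
qed

text \<open>A nonzero algebra contains a copy of the complex line, so it is infinite and in
  bijection with its square, which receives the unitization. The unitization of the zero algebra is
  the complex line, for which a small index type would not do.\<close>

lemma inj_unitization:
  fixes x :: "'c::cstar_algebra" and \<iota> :: "'c \<Rightarrow> 'i"
  assumes x: "x \<noteq> 0" and \<iota>: "inj \<iota>"
  obtains j :: "'c unitization \<Rightarrow> 'i" where "inj j"
proof -
  have inj_x: "inj (\<lambda>c. c *\<^sub>C x)"
  proof (rule injI)
    fix c d assume "c *\<^sub>C x = d *\<^sub>C x"
    hence "norm ((c - d) *\<^sub>C x) = 0" by (simp add: scaleC_diff_left)
    thus "c = d" using x by (simp add: norm_scaleC)
  qed
  have "infinite (range (\<lambda>c::complex. c *\<^sub>C x))"
    using inj_x infinite_UNIV_char_0 by (metis finite_imageD)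
  hence "infinite (UNIV :: 'c set)" by (rule infinite_super[OF subset_UNIV])
  hence "\<exists>g. bij_betw g (UNIV \<times> UNIV :: ('c \<times> 'c) set) (UNIV :: 'c set)"
    unfolding card_of_ordIso by (rule card_of_Times_same_infinite)
  then obtain g :: "'c \<times> 'c \<Rightarrow> 'c" where "bij_betw g (UNIV \<times> UNIV) UNIV" by blast
  hence g: "inj g" by (simp add: bij_betw_def)
  show thesis
  proof (rule that, rule injI)
    fix u v assume "\<iota> (g (alg_part u, scalar_part u *\<^sub>C x)) = \<iota> (g (alg_part v, scalar_part v *\<^sub>C x))"
    hence uv: "alg_part u = alg_part v" "scalar_part u *\<^sub>C x = scalar_part v *\<^sub>C x"
      using \<iota> g by (auto dest!: injD)
    show "u = v" by (rule unitization_eqI) (rule uv(1), rule injD[OF inj_x uv(2)])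
  qed
qed

lemma positive_functional_nonneg: "positive_functional f \<Longrightarrow> f (star x * x) \<ge> 0"
  by (simp add: positive_functional_def)

lemma positive_functional_one_nonneg:
  "positive_functional f \<Longrightarrow> f (1 :: 'a::unital_cstar_algebra) \<ge> 0"
  using positive_functional_nonneg[of f 1] by simp

lemma positive_functional_Cauchy_Schwarz:
  fixes w :: "'a::unital_cstar_algebra"
  assumes f: "positive_functional f"
  shows "(f w)\<^sup>2 \<le> f (star w * w) * f 1"
proof -
  interpret semi_inner_product "\<lambda>a b. complexify f (star b * a)"
    by (rule positive_functional_form[OF f])
  have Q: "Q x = f (star x * x)" for x by (simp add: Q_def complexify(4)[OF f])
  have "\<bar>f w\<bar> \<le> cmod (complexify f w)"
    using abs_Re_le_cmod[of "complexify f w"] by (simp add: complexify(4)[OF f])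
  hence "(f w)\<^sup>2 \<le> (cmod (complexify f w))\<^sup>2" using abs_le_square_iff by fastforce
  also have "\<dots> \<le> f (star w * w) * f 1" using Cauchy_Schwarz[where z = w and x = 1] by (simp add: Q)
  finally show ?thesis .
qed

text \<open>Separate h = z* z from the zero subspace: f h - g h \<ge> \<parallel>h\<parallel> and g
  h \<ge> 0 give f h \<ge> \<parallel>z\<parallel>^2. In the GNS space of f the left side is the
  squared length of the image of the vector \<open>V 1\<close>, whose norm is at most 1.\<close>

lemma norming_representation:
  fixes z :: "'c::cstar_algebra" and \<iota> :: "'c \<Rightarrow> 'i"
  assumes z: "z \<noteq> 0" and \<iota>: "inj \<iota>"
  obtains \<pi> :: "'c \<Rightarrow> 'i ell2 \<Rightarrow> 'i ell2" and \<xi> where "cstar_representation \<pi>" "norm \<xi> \<le> 1"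
    "norm z \<le> norm (\<pi> z \<xi>)"
proof -
  obtain j :: "'c unitization \<Rightarrow> 'i" where j: "inj j" using inj_unitization[OF z \<iota>] .
  let ?h = "star (embed z) * embed z"
  obtain f g where fg: "positive_functional f" "positive_functional g" "f ?h - g ?h \<ge> norm ?h" "f 1 + g 1 \<le> 1"
    by (rule separating_positive_functionals[of ?h "{0}" "norm ?h"]) auto
  obtain V :: "'c unitization \<Rightarrow> 'i ell2" and \<pi> where V: "clinear V"
    "\<And>a b. cinner (V a) (V b) = complexify f (star b * a)"
    "cstar_representation \<pi>" "\<And>x a. \<pi> x (V a) = V (x * a)"
    using gns_construction[OF fg(1) j] by blast
  note nV = norm_gns[OF fg(1) V(2)]
  show thesis
  proof (rule that)
    show "cstar_representation (\<lambda>a. \<pi> (embed a))" by (rule representation_star_hom[OF V(3) star_hom_embed])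
    have "(norm (V 1))\<^sup>2 \<le> 1\<^sup>2"
      using positive_functional_one_nonneg[OF fg(2)] fg(4) by (simp add: nV)
    thus "norm (V 1) \<le> 1" by (rule power2_le_imp_le) simp
    have "(norm z)\<^sup>2 = norm ?h" by (simp add: cstar_identity)
    also have "\<dots> \<le> f ?h" using fg(3) positive_functional_nonneg[OF fg(2), of "embed z"] by linarith
    also have "\<dots> = (norm (\<pi> (embed z) (V 1)))\<^sup>2" by (simp add: V(4) nV)
    finally show "norm z \<le> norm (\<pi> (embed z) (V 1))" by (rule power2_le_imp_le) simp
  qed
qed

definition star_multiplicative :: "'s semigroup_on \<Rightarrow> ('s \<Rightarrow> 'c::cstar_algebra) \<Rightarrow> bool"
  where "star_multiplicative S \<theta> \<longleftrightarrow> (\<forall>s\<in>carrier S. \<forall>t\<in>carrier S. \<theta> (mul S s t) = \<theta> s * \<theta> t) \<and>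
    (\<forall>s\<in>carrier S. \<theta> (inverse_in S s) = star (\<theta> s))"

lemma representation_compose:
  assumes "cstar_representation \<pi>" "star_multiplicative S \<theta>"
  shows "representation S (\<lambda>s. \<pi> (\<theta> s))"
  using assms(2) representation_simps[OF assms(1)]
  unfolding representation_def star_multiplicative_def is_adjoint_def by (auto simp: fun_eq_iff)

text \<open>The universal algebra is the case \<open>Z = {}\<close>; the contracted one is the case where \<open>Z\<close>
  contains the zero of \<open>S\<close> only.\<close>

definition relative_cstar_algebra ::
  "'h::complex_hilbert_space itself \<Rightarrow> 's set \<Rightarrow> 's semigroup_on \<Rightarrow> ('s \<Rightarrow> 'c::cstar_algebra) \<Rightarrow> bool"
  where "relative_cstar_algebra _ Z S k \<longleftrightarrow> star_multiplicative S k \<and> (\<forall>z\<in>Z. k z = 0) \<and>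
    (\<forall>\<rho> :: 's \<Rightarrow> 'h \<Rightarrow> 'h. representation S \<rho> \<and> (\<forall>z\<in>Z. \<rho> z = (\<lambda>x. 0)) \<longrightarrow>
       (\<exists>!\<pi> :: 'c \<Rightarrow> 'h \<Rightarrow> 'h. cstar_representation \<pi> \<and> (\<forall>s\<in>carrier S. \<pi> (k s) = \<rho> s)))"

lemma relative_representation_unique:
  fixes k :: "'s \<Rightarrow> 'c::cstar_algebra" and \<pi> \<sigma> :: "'c \<Rightarrow> 'h::complex_hilbert_space \<Rightarrow> 'h"
  assumes rel: "relative_cstar_algebra TYPE('h) Z S k"
    and \<pi>: "cstar_representation \<pi>" "cstar_representation \<sigma>" "\<And>s. s \<in> carrier S \<Longrightarrow> \<pi> (k s) = \<sigma> (k s)"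
  shows "\<pi> = \<sigma>"
proof -
  have "representation S (\<lambda>s. \<pi> (k s))" "\<forall>z\<in>Z. \<pi> (k z) = (\<lambda>x. 0)"
    using rel representation_compose[OF \<pi>(1)] representation_simps(6)[OF \<pi>(1)]
    by (auto simp: relative_cstar_algebra_def)
  hence "\<exists>!\<tau> :: 'c \<Rightarrow> 'h \<Rightarrow> 'h. cstar_representation \<tau> \<and> (\<forall>s\<in>carrier S. \<tau> (k s) = \<pi> (k s))"
    using rel unfolding relative_cstar_algebra_def by blast
  thus ?thesis using \<pi> by (metis (no_types, lifting))
qed

text \<open>The uniqueness clause concerns representations only. A representation that does not kill
  the difference of two values carries it over to homomorphisms into any algebra that injects into
  \<open>'i\<close>.\<close>

lemma star_hom_eqI:
  fixes k :: "'s \<Rightarrow> 'c::cstar_algebra" and f g :: "'c \<Rightarrow> 'p::cstar_algebra" and \<iota> :: "'p \<Rightarrow> 'i"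
  assumes rel: "relative_cstar_algebra TYPE('i ell2) Z S k" and \<iota>: "inj \<iota>"
    and fg: "star_hom f" "star_hom g" "\<And>s. s \<in> carrier S \<Longrightarrow> f (k s) = g (k s)"
  shows "f = g"
proof (rule ccontr)
  assume "f \<noteq> g"
  then obtain a where a: "f a - g a \<noteq> 0" by (auto simp: fun_eq_iff)
  obtain \<pi> :: "'p \<Rightarrow> 'i ell2 \<Rightarrow> 'i ell2" and \<xi> where \<pi>: "cstar_representation \<pi>"
    "norm (f a - g a) \<le> norm (\<pi> (f a - g a) \<xi>)"
    using norming_representation[OF a \<iota>] by metis
  have "(\<lambda>a. \<pi> (f a)) = (\<lambda>a. \<pi> (g a))"
    by (rule relative_representation_unique[OF rel])
      (simp_all add: representation_star_hom \<pi>(1) fg)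
  hence "\<pi> (f a - g a) \<xi> = 0" by (simp add: representation_simps(7)[OF \<pi>(1)] fun_eq_iff)
  thus False using \<pi>(2) a by simp
qed

section \<open>Density of the generated subalgebra\<close>

lemma orthogonal_projection:
  fixes K :: "'h::complex_hilbert_space set"
  assumes K: "0 \<in> K" "\<And>x y. x \<in> K \<Longrightarrow> y \<in> K \<Longrightarrow> x + y \<in> K" "\<And>c x. x \<in> K \<Longrightarrow> c *\<^sub>C x \<in> K"
  obtains P where "bounded_operator P" "\<And>\<xi>. P \<xi> \<in> closure K" "\<And>\<xi> \<eta>. cinner (P \<xi>) \<eta> = cinner \<xi> (P \<eta>)"
    "\<And>\<xi> p. p \<in> closure K \<Longrightarrow> (\<And>k. k \<in> K \<Longrightarrow> cinner (\<xi> - p) k = 0) \<Longrightarrow> P \<xi> = p"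
    "\<And>\<xi> k. k \<in> K \<Longrightarrow> cinner (\<xi> - P \<xi>) k = 0"
proof -
  have "\<exists>p. p \<in> closure K \<and> (\<forall>k\<in>K. cinner (\<xi> - p) k = 0)" for \<xi>
    using hilbert_projection[of K \<xi>] K by metis
  then obtain P where P: "\<And>\<xi>. P \<xi> \<in> closure K" "\<And>\<xi> k. k \<in> K \<Longrightarrow> cinner (\<xi> - P \<xi>) k = 0" by metis
  have cl_add: "x + y \<in> closure K" if "x \<in> closure K" "y \<in> closure K" for x y
    using closure_subspace(1)[of K] K(2) that by blast
  have cl_scale: "c *\<^sub>C x \<in> closure K" if "x \<in> closure K" for c x
    using closure_subspace(2)[of K] K(3) that by blast
  have perp: "cinner (\<xi> - P \<xi>) k = 0" if "k \<in> closure K" for \<xi> k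
    by (rule cinner_closure_zero[OF P(2) that])
  have unique: "P \<xi> = p" if p: "p \<in> closure K" "\<And>k. k \<in> K \<Longrightarrow> cinner (\<xi> - p) k = 0" for \<xi> p
  proof -
    have "P \<xi> + (-1) *\<^sub>C p \<in> closure K" by (intro cl_add cl_scale P p(1))
    hence d: "P \<xi> - p \<in> closure K" by simp
    have "cinner (P \<xi> - p) (P \<xi> - p) = cinner (\<xi> - p) (P \<xi> - p) - cinner (\<xi> - P \<xi>) (P \<xi> - p)"
      unfolding cinner.diff_left[symmetric] by simp
    also have "\<dots> = 0" using perp[OF d] cinner_closure_zero[OF p(2) d] by simp
    finally show ?thesis by (simp add: cinner_self)
  qed
  have sa: "cinner (P \<xi>) \<eta> = cinner \<xi> (P \<eta>)" for \<xi> \<eta>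
  proof -
    have "cinner (P \<xi>) (\<eta> - P \<eta>) = 0"
      using perp[OF P(1), of \<eta> \<xi>] cinner.commute[of "P \<xi>" "\<eta> - P \<eta>"] by simp
    moreover have "cinner (\<xi> - P \<xi>) (P \<eta>) = 0" by (rule perp[OF P(1)])
    ultimately show ?thesis by (simp add: cinner.diff_left cinner.diff_right)
  qed
  have "norm (P \<xi>) \<le> norm \<xi>" for \<xi>
  proof -
    have "cinner \<xi> (P \<xi>) = complex_of_real ((norm (P \<xi>))\<^sup>2)"
      using perp[OF P(1), of \<xi> \<xi>] by (simp add: cinner.diff_left cinner_self)
    hence "(norm (P \<xi>))\<^sup>2 \<le> norm \<xi> * norm (P \<xi>)" using norm_cinner_le[of \<xi> "P \<xi>"] by (simp only: norm_of_real abs_power2)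
    thus ?thesis by (cases "norm (P \<xi>) = 0") (simp_all add: power2_eq_square)
  qed
  moreover have "clinear P"
    unfolding clinear_def
  proof (intro conjI allI)
    fix x y c
    show "P (x + y) = P x + P y"
    proof (rule unique)
      fix k assume "k \<in> K"
      thus "cinner (x + y - (P x + P y)) k = 0"
        using P(2)[of k x] P(2)[of k y] by (simp add: cinner.diff_left cinner.add_left)
    qed (intro cl_add P)
    show "P (c *\<^sub>C x) = c *\<^sub>C P x"
    proof (rule unique)
      fix k assume "k \<in> K"
      thus "cinner (c *\<^sub>C x - c *\<^sub>C P x) k = 0"
        using P(2)[of k x] by (simp add: cinner.diff_left cinner.scaleC_left)
    qed (intro cl_scale P)
  qed
  ultimately have "bounded_operator P" unfolding bounded_operator_def by (auto intro!: exI[of _ 1])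
  thus thesis by (rule that[OF _ P(1) sa unique P(2)])
qed

text \<open>Uniqueness of extensions forces the image of \<open>S\<close> to generate the algebra.  Otherwise there
  are positive functionals \<open>f\<close> and \<open>g\<close> which agree on the generated subalgebra \<open>B\<close> (with a unit
  adjoined) and differ at some \<open>h\<close>.  In the GNS space of \<open>f + g\<close> let \<open>P\<close> be the projection onto the
  closure \<open>K\<close> of the subspace of \<open>B\<close>.  The symmetry \<open>u = 2 P - 1\<close> commutes with \<open>B\<close>, so
  conjugation by \<open>u\<close> fixes the representation.  Hence \<open>h\<close> maps the cyclic vector into \<open>K\<close>,
  and \<open>f h = g h\<close> follows.\<close>

theorem relative_algebra_dense:
  fixes k :: "'s \<Rightarrow> 'c::cstar_algebra" and \<iota> :: "'c \<Rightarrow> 'i"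
  assumes rel: "relative_cstar_algebra TYPE('i ell2) Z S k" and \<iota>: "inj \<iota>"
    and kB: "\<And>s. s \<in> carrier S \<Longrightarrow> k s \<in> B"
    and B: "0 \<in> B" "\<And>x y. x \<in> B \<Longrightarrow> y \<in> B \<Longrightarrow> x + y \<in> B" "\<And>c x. x \<in> B \<Longrightarrow> c *\<^sub>C x \<in> B"
      "\<And>x y. x \<in> B \<Longrightarrow> y \<in> B \<Longrightarrow> x * y \<in> B" "\<And>x. x \<in> B \<Longrightarrow> star x \<in> B"
  shows "closure B = UNIV"
proof (rule ccontr)
  assume "closure B \<noteq> UNIV"
  then obtain a where a: "a \<notin> closure B" by blast
  have cl_add: "x + y \<in> closure B" if "x \<in> closure B" "y \<in> closure B" for x y
    using closure_subspace(1)[of B] B(2) that by blast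
  have cl_scale: "c *\<^sub>C x \<in> closure B" if "x \<in> closure B" for c x
    using closure_subspace(2)[of B] B(3) that by blast
  \<comment> \<open>The element \<open>a\<close> is a linear combination of
    \<open>a + star a\<close> and \<open>\<i> *\<^sub>C (a - star a)\<close>, so one of these two
    selfadjoint elements lies outside the closure.\<close>
  obtain h where h: "star h = h" "h \<notin> closure B"
  proof (cases "a + star a \<in> closure B")
    case True
    have "\<i> *\<^sub>C (a - star a) \<notin> closure B"
    proof
      assume "\<i> *\<^sub>C (a - star a) \<in> closure B"
      hence "(1/2) *\<^sub>C (a + star a) + (- \<i> / 2) *\<^sub>C (\<i> *\<^sub>C (a - star a)) \<in> closure B"
        by (rule cl_add[OF cl_scale[OF True] cl_scale])
      also have "(1/2) *\<^sub>C (a + star a) + (- \<i> / 2) *\<^sub>C (\<i> *\<^sub>C (a - star a)) = a"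
        by (simp add: scaleC_add_right scaleC_diff_right flip: scaleC_add_left)
      finally show False using a by simp
    qed
    thus ?thesis by (intro that[of "\<i> *\<^sub>C (a - star a)"]) (simp_all add: scaleC_diff_right)
  next
    case False
    thus ?thesis by (intro that[of "a + star a"]) (simp_all add: add.commute)
  qed
  obtain \<delta> where \<delta>: "\<delta> > 0" "\<And>b. b \<in> B \<Longrightarrow> \<delta> \<le> norm (h - b)"
    using h(2) unfolding closure_approachable by (auto simp: dist_norm norm_minus_commute not_less)
  have "h \<noteq> 0" using \<delta>(2)[OF B(1)] \<delta>(1) by auto
  then obtain j :: "'c unitization \<Rightarrow> 'i" where j: "inj j" using inj_unitization \<iota> by blast
  define D where "D = {x. alg_part x \<in> B}"
  have D: "0 \<in> D" "1 \<in> D" "\<And>x y. x \<in> D \<Longrightarrow> y \<in> D \<Longrightarrow> x + y \<in> D" "\<And>c x. x \<in> D \<Longrightarrow> c *\<^sub>C x \<in> D"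
    "\<And>c x. x \<in> D \<Longrightarrow> c *\<^sub>R x \<in> D" "\<And>x y. x \<in> D \<Longrightarrow> y \<in> D \<Longrightarrow> x * y \<in> D" "\<And>x. x \<in> D \<Longrightarrow> star x \<in> D"
    unfolding D_def by (auto intro!: B simp: scaleR_scaleC)
  \<comment> \<open>The factor 1/2 is the price of recovering the algebra part from the norm of the
    unitization.\<close>
  have dist_D: "\<delta> / 2 \<le> norm (embed h - x)" if "x \<in> D" for x
    using \<delta>(2)[of "alg_part x"] that alg_part_le_norm[of "embed h - x"] by (simp add: D_def)
  have sh: "star (embed h) = embed h" using h(1) by (intro unitization_eqI) auto
  obtain f g where fg: "positive_functional f" "positive_functional g" "\<And>b. b \<in> D \<Longrightarrow> f b = g b"
    "f (embed h) - g (embed h) \<ge> \<delta> / 2" "f 1 + g 1 \<le> 1"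
    using separating_positive_functionals[OF sh D(1,3,5,7) dist_D] by blast
  define F where "F x = f x + g x" for x
  have F: "positive_functional F"
    using fg(1,2) unfolding positive_functional_def F_def[abs_def] by (auto intro: linear_compose_add)
  obtain V :: "'c unitization \<Rightarrow> 'i ell2" and \<tau> where V: "clinear V"
    "\<And>a b. cinner (V a) (V b) = complexify F (star b * a)"
    "cstar_representation \<tau>" "\<And>x a. \<tau> x (V a) = V (x * a)"
    using gns_construction[OF F j] by blast
  note nV = norm_gns[OF F V(2)]
  define \<pi> where "\<pi> x = \<tau> (embed x)" for x
  have \<pi>: "cstar_representation \<pi>"
    unfolding \<pi>_def by (rule representation_star_hom[OF V(3) star_hom_embed])
  note r = representation_simps[OF \<pi>]
  define K where "K = V ` D"
  have V0: "V 0 = 0" by (rule clinear_simps(3)[OF V(1)])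
  obtain P where P: "bounded_operator P" "\<And>\<xi>. P \<xi> \<in> closure K" "\<And>\<xi> \<eta>. cinner (P \<xi>) \<eta> = cinner \<xi> (P \<eta>)"
    "\<And>\<xi> p. p \<in> closure K \<Longrightarrow> (\<And>k. k \<in> K \<Longrightarrow> cinner (\<xi> - p) k = 0) \<Longrightarrow> P \<xi> = p"
    "\<And>\<xi> k. k \<in> K \<Longrightarrow> cinner (\<xi> - P \<xi>) k = 0"
  proof (rule orthogonal_projection[of K])
    show "0 \<in> K" unfolding K_def using D(1) V0 by (metis imageI)
  qed (use D in \<open>auto simp: K_def clinear_simps(1,2)[OF V(1), symmetric]\<close>)
  have P_K: "P \<xi> = \<xi>" if "\<xi> \<in> closure K" for \<xi>
    by (rule P(4)[OF that]) (simp add: cinner.minus_left[of 0, simplified])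
  note Pl = clinear_simps[OF bounded_operator_clinear[OF P(1)]]
  define u where "u \<xi> = 2 *\<^sub>C P \<xi> - \<xi>" for \<xi>
  have u: "bounded_operator u"
  proof -
    have "u = (\<lambda>\<xi>. 2 *\<^sub>C P \<xi> + (-1) *\<^sub>C \<xi>)" by (simp add: u_def fun_eq_iff)
    thus ?thesis by (simp only: bounded_operator_ops bounded_operator_scaleC P bounded_operator_id)
  qed
  note ul = clinear_simps[OF bounded_operator_clinear[OF u]]
  have uu: "u (u \<xi>) = \<xi>" for \<xi>
    unfolding u_def by (simp add: Pl P_K[OF P(2)] scaleC_diff_right) (simp flip: scaleC_add_left scaleC_diff_left)
  have u_sa: "cinner (u \<xi>) \<eta> = cinner \<xi> (u \<eta>)" for \<xi> \<eta>
    by (simp add: u_def cinner.diff_left cinner.diff_right cinner.scaleC_left cinner.scaleC_right P(3))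
  define \<sigma> where "\<sigma> x = u \<circ> \<pi> x \<circ> u" for x
  have "cstar_representation \<sigma>"
    unfolding cstar_representation_def is_adjoint_def \<sigma>_def
    by (auto intro!: bounded_operator_ops u r(1) simp: fun_eq_iff r(2,3,4,5) ul uu u_sa)
  moreover have "\<sigma> (k s) = \<pi> (k s)" if s: "s \<in> carrier S" for s
  proof
    fix \<xi>
    have inv: "\<pi> b x \<in> K" if b: "b \<in> B" "x \<in> K" for b x
    proof -
      obtain d where "d \<in> D" "x = V d" using b(2) by (auto simp: K_def)
      moreover have "embed b \<in> D" using b(1) by (simp add: D_def)
      ultimately show ?thesis unfolding K_def \<pi>_def using D(6) V(4) by (metis imageI)
    qed
    have "P (\<pi> (k s) \<xi>) = \<pi> (k s) (P \<xi>)"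
    proof (rule P(4))
      have "\<pi> (k s) ` closure K \<subseteq> closure (\<pi> (k s) ` K)"
        by (rule closure_bounded_linear_image_subset[OF bounded_operator_linear[OF r(1)]])
      also have "\<dots> \<subseteq> closure K" using inv[OF kB[OF s]] by (intro closure_mono) auto
      finally show "\<pi> (k s) (P \<xi>) \<in> closure K" using P(2) by blast
      fix x assume x: "x \<in> K"
      have "\<pi> (k s) \<xi> - \<pi> (k s) (P \<xi>) = \<pi> (k s) (\<xi> - P \<xi>)"
        using clinear_simps(5)[OF bounded_operator_clinear[OF r(1)]] by metis
      thus "cinner (\<pi> (k s) \<xi> - \<pi> (k s) (P \<xi>)) x = 0"
        using P(5) inv[OF B(5)[OF kB[OF s]] x] by (simp add: r(5))
    qed
    hence "u (\<pi> (k s) \<xi>) = \<pi> (k s) (u \<xi>)"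
      by (simp add: u_def clinear_simps[OF bounded_operator_clinear[OF r(1)]])
    thus "\<sigma> (k s) \<xi> = \<pi> (k s) \<xi>" by (simp add: \<sigma>_def flip: uu) (metis uu)
  qed
  ultimately have "\<sigma> = \<pi>" using relative_representation_unique[OF rel _ \<pi>] by blast
  have "V 1 \<in> K" using D(2) by (simp add: K_def)
  hence "P (V 1) = V 1" using closure_subset by (intro P_K) blast
  hence "u (V 1) = V 1" by (simp add: u_def) (simp flip: scaleC_diff_left add: scaleC_diff_left[of 2 1, simplified, symmetric])
  hence "u (\<pi> h (V 1)) = \<pi> h (V 1)"
    using fun_cong[OF fun_cong[OF \<open>\<sigma> = \<pi>\<close>, of h], of "V 1"] by (simp add: \<sigma>_def)
  hence "2 *\<^sub>C P (V (embed h)) = 2 *\<^sub>C V (embed h)"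
    using scaleC_add_left[of 1 1 "V (embed h)"] by (simp add: u_def \<pi>_def V(4) diff_eq_eq)
  hence "inverse 2 *\<^sub>C (2 *\<^sub>C P (V (embed h))) = inverse 2 *\<^sub>C (2 *\<^sub>C V (embed h))" by simp
  hence "V (embed h) \<in> closure K" using P(2)[of "V (embed h)"] by simp
  \<comment> \<open>The value of f - g at \<open>embed h - x\<close> is at least \<delta>/2, whereas
    an approximation within \<delta>/8 bounds each functional there by \<delta>/8.\<close>
  moreover have "\<delta> / 8 > 0" using \<delta>(1) by simp
  ultimately have "\<exists>y\<in>K. dist y (V (embed h)) < \<delta> / 8" unfolding closure_approachable by blast
  then obtain x where x: "x \<in> D" "norm (V x - V (embed h)) < \<delta> / 8"
    unfolding K_def dist_norm by blast
  let ?w = "embed h - x"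
  have w: "(norm (V ?w))\<^sup>2 \<le> (\<delta> / 8)\<^sup>2"
    using x(2) by (intro power_mono) (simp_all add: clinear_simps[OF V(1)] norm_minus_commute)
  have bound: "\<bar>e ?w\<bar> \<le> \<delta> / 8" if e: "positive_functional e" "e 1 \<le> 1" "e (star ?w * ?w) \<le> F (star ?w * ?w)" for e
  proof -
    have "(e ?w)\<^sup>2 \<le> e (star ?w * ?w) * e 1" by (rule positive_functional_Cauchy_Schwarz[OF e(1)])
    also have "\<dots> \<le> e (star ?w * ?w)" using e(2) positive_functional_nonneg[OF e(1)] by (intro mult_left_le)
    also have "\<dots> \<le> (\<delta> / 8)\<^sup>2" using e(3) w by (simp add: nV)
    finally show ?thesis using \<delta>(1) abs_le_square_iff[of "e ?w" "\<delta> / 8"] by simp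
  qed
  have "f 1 \<le> 1" "f (star ?w * ?w) \<le> F (star ?w * ?w)"
    using fg(5) positive_functional_one_nonneg[OF fg(2)] positive_functional_nonneg[OF fg(2), of ?w]
    unfolding F_def by linarith+
  from bound[OF fg(1) this] have bf: "\<bar>f ?w\<bar> \<le> \<delta> / 8" .
  have "g 1 \<le> 1" "g (star ?w * ?w) \<le> F (star ?w * ?w)"
    using fg(5) positive_functional_one_nonneg[OF fg(1)] positive_functional_nonneg[OF fg(1), of ?w]
    unfolding F_def by linarith+
  from bound[OF fg(2) this] have bg: "\<bar>g ?w\<bar> \<le> \<delta> / 8" .
  have "f ?w - g ?w = f (embed h) - g (embed h)"
    using fg(1,2) fg(3)[OF x(1)] by (simp add: positive_functional_def linear_diff)
  thus False using bf bg fg(4) \<delta>(1) by linarith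
qed

text \<open>The graph of the future extension on the linear span of the image. Taking a relation
  postpones well-definedness: linear dependences among the \<open>k s\<close> are handled later by
  the norm bound.\<close>

inductive_set joint_span :: "('s \<Rightarrow> 'c::cstar_algebra) \<Rightarrow> ('s \<Rightarrow> 'p::cstar_algebra) \<Rightarrow> 's set \<Rightarrow> ('c \<times> 'p) set"
  for k \<theta> A where
  zero: "(0, 0) \<in> joint_span k \<theta> A"
| base: "s \<in> A \<Longrightarrow> (k s, \<theta> s) \<in> joint_span k \<theta> A"
| add: "(a, x) \<in> joint_span k \<theta> A \<Longrightarrow> (b, y) \<in> joint_span k \<theta> A \<Longrightarrow> (a + b, x + y) \<in> joint_span k \<theta> A"
| scale: "(a, x) \<in> joint_span k \<theta> A \<Longrightarrow> (c *\<^sub>C a, c *\<^sub>C x) \<in> joint_span k \<theta> A"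

lemma joint_span_mult:
  assumes k: "star_multiplicative S k" "star_multiplicative S \<theta>"
    and closed: "\<And>s t. s \<in> carrier S \<Longrightarrow> t \<in> carrier S \<Longrightarrow> mul S s t \<in> carrier S"
    and ax: "(a, x) \<in> joint_span k \<theta> (carrier S)" "(b, y) \<in> joint_span k \<theta> (carrier S)"
  shows "(a * b, x * y) \<in> joint_span k \<theta> (carrier S)"
proof -
  have base: "(k s * b, \<theta> s * y) \<in> joint_span k \<theta> (carrier S)" if s: "s \<in> carrier S" for s
    using ax(2)
  proof induction
    case (base t)
    have "(k (mul S s t), \<theta> (mul S s t)) \<in> joint_span k \<theta> (carrier S)"
      using closed s base by (intro joint_span.base) auto
    thus ?case using k s base by (simp add: star_multiplicative_def)
  qed (auto simp: distrib_left mult_scaleC_right intro: joint_span.intros)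
  show ?thesis
    using ax(1) by induction (auto simp: distrib_right mult_scaleC_left intro: joint_span.intros base)
qed

lemma joint_span_star:
  assumes k: "star_multiplicative S k" "star_multiplicative S \<theta>"
    and closed: "\<And>s. s \<in> carrier S \<Longrightarrow> inverse_in S s \<in> carrier S"
    and ax: "(a, x) \<in> joint_span k \<theta> (carrier S)"
  shows "(star a, star x) \<in> joint_span k \<theta> (carrier S)"
  using ax
proof induction
  case (base s)
  have "(k (inverse_in S s), \<theta> (inverse_in S s)) \<in> joint_span k \<theta> (carrier S)"
    using closed base by (intro joint_span.base) auto
  thus ?case using k base by (simp add: star_multiplicative_def)
qed (auto intro: joint_span.intros)

text \<open>Both algebras have to inject into the same \<open>'i\<close>: density in the source and
  the norms in the target are detected on one test space. The closure of the joint span is then the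
  graph of the extension.\<close>

theorem relative_algebra_extension:
  fixes k :: "'s \<Rightarrow> 'c::cstar_algebra" and \<theta> :: "'s \<Rightarrow> 'p::cstar_algebra"
    and \<iota> :: "'c \<Rightarrow> 'i" and \<kappa> :: "'p \<Rightarrow> 'i"
  assumes rel: "relative_cstar_algebra TYPE('i ell2) Z S k" and \<iota>: "inj \<iota>" "inj \<kappa>"
    and \<theta>: "star_multiplicative S \<theta>" "\<And>z. z \<in> Z \<Longrightarrow> \<theta> z = 0"
    and closed: "\<And>s t. s \<in> carrier S \<Longrightarrow> t \<in> carrier S \<Longrightarrow> mul S s t \<in> carrier S"
      "\<And>s. s \<in> carrier S \<Longrightarrow> inverse_in S s \<in> carrier S"
  obtains f where "star_hom f" "\<And>s. s \<in> carrier S \<Longrightarrow> f (k s) = \<theta> s"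
proof -
  have k: "star_multiplicative S k" using rel by (simp add: relative_cstar_algebra_def)
  let ?W = "joint_span k \<theta> (carrier S)"
  have bound: "norm x \<le> 1 * norm a" if ax: "(a, x) \<in> ?W" for a x
  proof (cases "x = 0")
    case False
    obtain \<pi> :: "'p \<Rightarrow> 'i ell2 \<Rightarrow> 'i ell2" and \<xi> where \<pi>: "cstar_representation \<pi>" "norm \<xi> \<le> 1"
      "norm x \<le> norm (\<pi> x \<xi>)" using norming_representation[OF False \<iota>(2)] by metis
    have "representation S (\<lambda>s. \<pi> (\<theta> s))" "\<forall>z\<in>Z. \<pi> (\<theta> z) = (\<lambda>x. 0)"
      using representation_compose[OF \<pi>(1) \<theta>(1)] \<theta>(2) representation_simps(6)[OF \<pi>(1)] by auto
    hence "\<exists>!\<sigma> :: 'c \<Rightarrow> 'i ell2 \<Rightarrow> 'i ell2. cstar_representation \<sigma> \<and> (\<forall>s\<in>carrier S. \<sigma> (k s) = \<pi> (\<theta> s))"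
      using rel unfolding relative_cstar_algebra_def by blast
    then obtain \<sigma> :: "'c \<Rightarrow> 'i ell2 \<Rightarrow> 'i ell2" where \<sigma>: "cstar_representation \<sigma>"
      "\<And>s. s \<in> carrier S \<Longrightarrow> \<sigma> (k s) = \<pi> (\<theta> s)" by blast
    have "\<sigma> a \<xi> = \<pi> x \<xi>"
      using ax by induction
        (simp_all add: \<sigma>(2) representation_simps(2,3,6)[OF \<pi>(1)] representation_simps(2,3,6)[OF \<sigma>(1)])
    hence "norm x \<le> norm a * norm \<xi>" using \<pi>(3) representation_contractive[OF \<sigma>(1), of a \<xi>] by simp
    also have "\<dots> \<le> norm a" using \<pi>(2) by (simp add: mult_left_le)
    finally show ?thesis by simp
  qed simp
  have diff: "p - q \<in> ?W" if "p \<in> ?W" "q \<in> ?W" for p q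
  proof -
    have "(fst p + (-1) *\<^sub>C fst q, snd p + (-1) *\<^sub>C snd q) \<in> ?W"
      using that by (intro joint_span.add joint_span.scale) simp_all
    thus ?thesis by (simp add: minus_prod_def)
  qed
  have dense: "closure (fst ` ?W) = UNIV"
  proof (rule relative_algebra_dense[OF rel \<iota>(1)])
    show "k s \<in> fst ` ?W" if "s \<in> carrier S" for s
      using joint_span.base[OF that, of k \<theta>] by (metis fst_conv imageI)
    show "0 \<in> fst ` ?W" using joint_span.zero[of k \<theta> "carrier S"] by (metis fst_conv imageI)
    fix a b assume "a \<in> fst ` ?W" "b \<in> fst ` ?W"
    then obtain x y where xy: "(a, x) \<in> ?W" "(b, y) \<in> ?W" by auto
    show "a + b \<in> fst ` ?W" "a * b \<in> fst ` ?W" "star a \<in> fst ` ?W" "c *\<^sub>C a \<in> fst ` ?W" for c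
      using joint_span.add[OF xy] joint_span_mult[OF k \<theta>(1) closed(1) xy]
        joint_span_star[OF k \<theta>(1) closed(2) xy(1)] joint_span.scale[OF xy(1), of c]
      by (metis fst_conv imageI)+
  qed
  have total: "\<exists>x. (a, x) \<in> closure ?W" for a
  proof -
    have "a \<in> closure (fst ` ?W)" using dense by simp
    from closure_graph_total[OF bound diff this] show ?thesis by auto
  qed
  have cl_diff: "p - q \<in> closure ?W" if "p \<in> closure ?W" "q \<in> closure ?W" for p q
    by (rule closure_closed_under[OF that]) (auto intro: diff tendsto_diff)
  define f where "f a = (SOME x. (a, x) \<in> closure ?W)" for a
  have f: "(a, f a) \<in> closure ?W" for a unfolding f_def using total by (rule someI_ex)
  have f_eq: "f a = x" if "(a, x) \<in> closure ?W" for a x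
  proof -
    have "(0, f a - x) \<in> closure ?W" using cl_diff[OF f[of a] that] by simp
    from closure_graph_bound[OF bound this] show ?thesis by simp
  qed
  \<comment> \<open>Every operation preserves the joint span and is continuous, so it preserves the
    closure. Unary operations are treated as binary ones that ignore their second argument.\<close>
  have op: "f (F a b) = F' (f a) (f b)"
    if F: "\<And>a x b y. (a, x) \<in> ?W \<Longrightarrow> (b, y) \<in> ?W \<Longrightarrow> (F a b, F' x y) \<in> ?W"
      and cont: "\<And>u v a b. u \<longlonglongrightarrow> a \<Longrightarrow> v \<longlonglongrightarrow> b \<Longrightarrow> (\<lambda>n. F (u n) (v n)) \<longlonglongrightarrow> F a b"
        "\<And>u v a b. u \<longlonglongrightarrow> a \<Longrightarrow> v \<longlonglongrightarrow> b \<Longrightarrow> (\<lambda>n. F' (u n) (v n)) \<longlonglongrightarrow> F' a b"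
    for F :: "'c \<Rightarrow> 'c \<Rightarrow> 'c" and F' :: "'p \<Rightarrow> 'p \<Rightarrow> 'p" and a b
  proof (rule f_eq)
    have "(\<lambda>p q. (F (fst p) (fst q), F' (snd p) (snd q))) (a, f a) (b, f b) \<in> closure ?W"
    proof (rule closure_closed_under[OF f f])
      show "(F (fst p) (fst q), F' (snd p) (snd q)) \<in> ?W" if "p \<in> ?W" "q \<in> ?W" for p q
        using F[of "fst p" "snd p" "fst q" "snd q"] that by simp
      fix p q :: "nat \<Rightarrow> 'c \<times> 'p" assume "p \<longlonglongrightarrow> (a, f a)" "q \<longlonglongrightarrow> (b, f b)"
      thus "(\<lambda>n. (F (fst (p n)) (fst (q n)), F' (snd (p n)) (snd (q n)))) \<longlonglongrightarrow>
          (F (fst (a, f a)) (fst (b, f b)), F' (snd (a, f a)) (snd (b, f b)))"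
        by (intro tendsto_Pair cont tendsto_fst tendsto_snd)
    qed
    thus "(F a b, F' (f a) (f b)) \<in> closure ?W" by simp
  qed
  show thesis
  proof (rule that)
    show "star_hom f"
      unfolding star_hom_def clinear_def
    proof (intro conjI allI)
      fix a b :: 'c and c
      show "f (a + b) = f a + f b" by (rule op[where F = "(+)" and F' = "(+)"]) (auto intro: joint_span.add tendsto_add)
      show "f (c *\<^sub>C a) = c *\<^sub>C f a"
        by (rule op[where F = "\<lambda>a b. c *\<^sub>C a" and F' = "\<lambda>a b. c *\<^sub>C a"])
          (auto intro: joint_span.scale bounded_linear.tendsto[OF bounded_linear_scaleC])
      show "f (a * b) = f a * f b"
        by (rule op[where F = "(*)" and F' = "(*)"])
          (auto intro: joint_span_mult[OF k \<theta>(1) closed(1)] tendsto_mult)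
      show "f (star a) = star (f a)"
        by (rule op[where F = "\<lambda>a b. star a" and F' = "\<lambda>a b. star a"])
          (auto intro: joint_span_star[OF k \<theta>(1) closed(2)] bounded_linear.tendsto[OF bounded_linear_star])
    qed
    show "f (k s) = \<theta> s" if "s \<in> carrier S" for s
      using joint_span.base[OF that, of k \<theta>] closure_subset by (intro f_eq) blast
  qed
qed

section \<open>Inverse semigroups\<close>

locale inverse_semigroup_on =
  fixes S :: "'s semigroup_on"
  assumes inverse_semigroup: "inverse_semigroup S"
begin

abbreviation prod (infixl \<open>\<cdot>\<close> 70) where "x \<cdot> y \<equiv> mul S x y"
abbreviation inv where "inv \<equiv> inverse_in S"

lemma closed: "x \<in> carrier S \<Longrightarrow> y \<in> carrier S \<Longrightarrow> x \<cdot> y \<in> carrier S"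
  using inverse_semigroup by (simp add: inverse_semigroup_def)

lemma assoc:
  "x \<in> carrier S \<Longrightarrow> y \<in> carrier S \<Longrightarrow> z \<in> carrier S \<Longrightarrow> x \<cdot> y \<cdot> z = x \<cdot> (y \<cdot> z)"
  using inverse_semigroup by (simp add: inverse_semigroup_def)

lemma ex1_inverse: "s \<in> carrier S \<Longrightarrow> \<exists>!t. is_inverse_of S s t"
  using inverse_semigroup unfolding inverse_semigroup_def by blast

lemma is_inverse_inv: "s \<in> carrier S \<Longrightarrow> is_inverse_of S s (inv s)"
  unfolding inverse_in_def by (rule theI'[OF ex1_inverse])

lemma inv_unique: "s \<in> carrier S \<Longrightarrow> is_inverse_of S s t \<Longrightarrow> inv s = t"
  using is_inverse_inv[of s] ex1_inverse[of s] by blast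

lemma inv_closed: "s \<in> carrier S \<Longrightarrow> inv s \<in> carrier S"
  using is_inverse_inv by (simp add: is_inverse_of_def)

lemma inv_cancel: "s \<in> carrier S \<Longrightarrow> s \<cdot> inv s \<cdot> s = s" "s \<in> carrier S \<Longrightarrow> inv s \<cdot> s \<cdot> inv s = inv s"
  using is_inverse_inv by (simp_all add: is_inverse_of_def)

lemma inv_inv: "s \<in> carrier S \<Longrightarrow> inv (inv s) = s"
  by (rule inv_unique[OF inv_closed]) (simp_all add: is_inverse_of_def inv_cancel)

lemma idempotentD: "e \<in> idempotents S \<Longrightarrow> e \<in> carrier S" "e \<in> idempotents S \<Longrightarrow> e \<cdot> e = e"
  by (simp_all add: idempotents_def)

lemma inv_idempotent: "e \<in> idempotents S \<Longrightarrow> inv e = e"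
  by (rule inv_unique) (simp_all add: is_inverse_of_def idempotents_def)

lemma inv_mult_idempotent:
  "s \<in> carrier S \<Longrightarrow> inv s \<cdot> s \<in> idempotents S" "s \<in> carrier S \<Longrightarrow> s \<cdot> inv s \<in> idempotents S"
  by (simp_all add: idempotents_def closed inv_closed assoc[symmetric] inv_cancel)

text \<open>If x is the inverse of e f, then f x e is another one, so x = f x e. This makes x
  idempotent, hence its own inverse, hence equal to e f.\<close>

lemma idempotent_mult:
  assumes e: "e \<in> idempotents S" and f: "f \<in> idempotents S"
  shows "e \<cdot> f \<in> idempotents S"
proof -
  note c = idempotentD(1)[OF e] idempotentD(1)[OF f] and i = idempotentD(2)[OF e] idempotentD(2)[OF f]
  define x where "x = inv (e \<cdot> f)"
  have x: "x \<in> carrier S" "e \<cdot> f \<cdot> x \<cdot> (e \<cdot> f) = e \<cdot> f" "x \<cdot> (e \<cdot> f) \<cdot> x = x"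
    using c by (simp_all add: x_def closed inv_closed inv_cancel)
  have ii: "e \<cdot> (e \<cdot> y) = e \<cdot> y" "f \<cdot> (f \<cdot> y) = f \<cdot> y" if "y \<in> carrier S" for y
    using that c i by (simp_all add: assoc[symmetric])
  have "e \<cdot> f \<cdot> (f \<cdot> x \<cdot> e) \<cdot> (e \<cdot> f) = e \<cdot> f \<cdot> x \<cdot> (e \<cdot> f)"
    using c x(1) i ii by (simp add: closed assoc)
  moreover have "f \<cdot> x \<cdot> e \<cdot> (e \<cdot> f) \<cdot> (f \<cdot> x \<cdot> e) = f \<cdot> (x \<cdot> (e \<cdot> f) \<cdot> x) \<cdot> e"
    using c x(1) i ii by (simp add: closed assoc)
  ultimately have "is_inverse_of S (e \<cdot> f) (f \<cdot> x \<cdot> e)"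
    unfolding is_inverse_of_def x(2,3) using c x(1) by (simp add: closed)
  hence fxe: "x = f \<cdot> x \<cdot> e" unfolding x_def by (intro inv_unique) (use c in \<open>simp_all add: closed\<close>)
  hence "x \<cdot> x = f \<cdot> x \<cdot> e \<cdot> (f \<cdot> x \<cdot> e)" by simp
  also have "\<dots> = f \<cdot> (x \<cdot> (e \<cdot> f) \<cdot> x) \<cdot> e" using c x(1) by (simp add: closed assoc)
  finally have "x \<cdot> x = f \<cdot> (x \<cdot> (e \<cdot> f) \<cdot> x) \<cdot> e" .
  hence "x \<cdot> x = x" using x(3) fxe by simp
  hence "x \<in> idempotents S" using x(1) by (simp add: idempotents_def)
  moreover have "inv x = e \<cdot> f" unfolding x_def using c by (simp add: inv_inv closed)
  ultimately show ?thesis using inv_idempotent by metis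
qed

text \<open>Both products are idempotent, so f e is an inverse of e f; but e f is its own
  inverse.\<close>

lemma idempotent_commute:
  assumes e: "e \<in> idempotents S" and f: "f \<in> idempotents S"
  shows "e \<cdot> f = f \<cdot> e"
proof -
  note c = idempotentD(1)[OF e] idempotentD(1)[OF f] and i = idempotentD(2)[OF e] idempotentD(2)[OF f]
  note ef = idempotentD(2)[OF idempotent_mult[OF e f]] and fe = idempotentD(2)[OF idempotent_mult[OF f e]]
  have ii: "e \<cdot> (e \<cdot> y) = e \<cdot> y" "f \<cdot> (f \<cdot> y) = f \<cdot> y" if "y \<in> carrier S" for y
    using that c i by (simp_all add: assoc[symmetric])
  have "is_inverse_of S (e \<cdot> f) (f \<cdot> e)"
    using c ii ef fe by (simp add: is_inverse_of_def closed assoc)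
  hence "inv (e \<cdot> f) = f \<cdot> e" using c by (intro inv_unique) (simp_all add: closed)
  thus ?thesis using inv_idempotent[OF idempotent_mult[OF e f]] by simp
qed

lemma idempotent_conjugate:
  assumes s: "s \<in> carrier S" and e: "e \<in> idempotents S"
  shows "s \<cdot> e \<cdot> inv s \<in> idempotents S"
proof -
  note c = idempotentD(1)[OF e] s inv_closed[OF s]
  have "s \<cdot> e \<cdot> inv s \<cdot> (s \<cdot> e \<cdot> inv s) = s \<cdot> (e \<cdot> (inv s \<cdot> s)) \<cdot> e \<cdot> inv s"
    using c by (simp add: closed assoc)
  also have "e \<cdot> (inv s \<cdot> s) = inv s \<cdot> s \<cdot> e" by (rule idempotent_commute[OF e inv_mult_idempotent(1)[OF s]])
  also have "s \<cdot> (inv s \<cdot> s \<cdot> e) \<cdot> e \<cdot> inv s = (s \<cdot> inv s \<cdot> s) \<cdot> (e \<cdot> e) \<cdot> inv s"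
    using c by (simp add: closed assoc)
  also have "\<dots> = s \<cdot> e \<cdot> inv s" using s by (simp add: inv_cancel idempotentD(2)[OF e])
  finally show ?thesis using c by (simp add: idempotents_def closed)
qed

lemma inv_mult:
  assumes x: "x \<in> carrier S" and y: "y \<in> carrier S"
  shows "inv (x \<cdot> y) = inv y \<cdot> inv x"
proof (rule inv_unique)
  note c = x y inv_closed[OF x] inv_closed[OF y]
  have comm: "y \<cdot> inv y \<cdot> (inv x \<cdot> x) = inv x \<cdot> x \<cdot> (y \<cdot> inv y)"
    by (intro idempotent_commute inv_mult_idempotent x y)
  have "x \<cdot> y \<cdot> (inv y \<cdot> inv x) \<cdot> (x \<cdot> y) = x \<cdot> (y \<cdot> inv y \<cdot> (inv x \<cdot> x)) \<cdot> y"
    using c by (simp add: closed assoc)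
  also have "\<dots> = (x \<cdot> inv x \<cdot> x) \<cdot> (y \<cdot> inv y \<cdot> y)" unfolding comm using c by (simp add: closed assoc)
  also have "\<dots> = x \<cdot> y" using x y by (simp add: inv_cancel)
  finally have 1: "x \<cdot> y \<cdot> (inv y \<cdot> inv x) \<cdot> (x \<cdot> y) = x \<cdot> y" .
  have "inv y \<cdot> inv x \<cdot> (x \<cdot> y) \<cdot> (inv y \<cdot> inv x) = inv y \<cdot> (inv x \<cdot> x \<cdot> (y \<cdot> inv y)) \<cdot> inv x"
    using c by (simp add: closed assoc)
  also have "\<dots> = (inv y \<cdot> y \<cdot> inv y) \<cdot> (inv x \<cdot> x \<cdot> inv x)"
    unfolding comm[symmetric] using c by (simp add: closed assoc)
  also have "\<dots> = inv y \<cdot> inv x" using x y by (simp add: inv_cancel)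
  finally show "is_inverse_of S (x \<cdot> y) (inv y \<cdot> inv x)" using 1 c by (simp add: is_inverse_of_def closed)
qed (use assms in \<open>simp add: closed\<close>)

end

section \<open>Homomorphisms and generated subsemigroups\<close>

lemma semigroup_hom_inverse:
  assumes S: "inverse_semigroup S" and R: "inverse_semigroup R" and f: "semigroup_hom S R f"
    and s: "s \<in> carrier S"
  shows "f (inverse_in S s) = inverse_in R (f s)"
proof -
  interpret S: inverse_semigroup_on S by unfold_locales fact
  interpret R: inverse_semigroup_on R by unfold_locales fact
  have hom: "f (mul S x y) = mul R (f x) (f y)" "f x \<in> carrier R"
    if "x \<in> carrier S" "y \<in> carrier S" for x y
    using f that by (auto simp: semigroup_hom_def)
  note c = s S.inv_closed[OF s] S.closed
  have "is_inverse_of R (f s) (f (inverse_in S s))"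
    unfolding is_inverse_of_def using c S.inv_cancel[OF s] by (simp add: hom flip: hom(1))
  thus ?thesis using hom(2)[OF s s] by (intro R.inv_unique[symmetric])
qed

lemma star_multiplicative_hom:
  assumes "inverse_semigroup S" "inverse_semigroup T" "semigroup_hom S T \<psi>" "star_multiplicative T k"
  shows "star_multiplicative S (\<lambda>s. k (\<psi> s))"
  using assms semigroup_hom_inverse[OF assms(1-3)]
  by (auto simp: star_multiplicative_def semigroup_hom_def image_subset_iff)

lemma star_multiplicative_star_hom:
  "star_hom f \<Longrightarrow> star_multiplicative S k \<Longrightarrow> star_multiplicative S (\<lambda>s. f (k s))"
  by (simp add: star_hom_def star_multiplicative_def)

text \<open>The generated subsemigroup as right-nested words, so that induction strips off one
  generator. The multiplication is a parameter because words are formed both in \<open>T\<close> and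
  in a C*-algebra.\<close>

inductive_set mult_closure :: "('t \<Rightarrow> 't \<Rightarrow> 't) \<Rightarrow> 't set \<Rightarrow> 't set" for m G where
  base: "g \<in> G \<Longrightarrow> g \<in> mult_closure m G"
| step: "g \<in> G \<Longrightarrow> w \<in> mult_closure m G \<Longrightarrow> m g w \<in> mult_closure m G"

lemma mult_closure_mult:
  assumes assoc: "\<And>x y z. x \<in> C \<Longrightarrow> y \<in> C \<Longrightarrow> z \<in> C \<Longrightarrow> m (m x y) z = m x (m y z)"
    and C: "\<And>x y. x \<in> C \<Longrightarrow> y \<in> C \<Longrightarrow> m x y \<in> C" "G \<subseteq> C"
    and v: "v \<in> mult_closure m G" "w \<in> mult_closure m G"
  shows "m v w \<in> mult_closure m G"
proof -
  have sub: "x \<in> C" if "x \<in> mult_closure m G" for x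
    using that by induction (use C in auto)
  show ?thesis using v(1)
  proof induction
    case (step g x)
    have "m (m g x) w = m g (m x w)" using step sub v(2) C(2) by (intro assoc) auto
    thus ?case using step by (auto intro: mult_closure.step)
  qed (use v(2) in \<open>auto intro: mult_closure.step\<close>)
qed

text \<open>Stability of \<open>E\<close> under conjugation puts \<open>w * star w\<close> into
  \<open>E\<close> for every word w, so these projections commute and words are partial isometries.
  Inverses are unique because every idempotent word x lies in \<open>E\<close>: its adjoint is the
  product of \<open>star x * x\<close> and \<open>x * star x\<close>.\<close>

lemma inverse_semigroup_of_partial_isometries:
  fixes G E :: "'p::cstar_algebra set"
  assumes ne: "G \<noteq> {}" and star: "\<And>g. g \<in> G \<Longrightarrow> star g \<in> G" and G: "\<And>g. g \<in> G \<Longrightarrow> g * star g * g = g"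
    "\<And>g. g \<in> G \<Longrightarrow> star g * g \<in> E" "\<And>g e. g \<in> G \<Longrightarrow> e \<in> E \<Longrightarrow> g * e * star g \<in> E"
    and E: "\<And>e. e \<in> E \<Longrightarrow> star e = e" "\<And>e f. e \<in> E \<Longrightarrow> f \<in> E \<Longrightarrow> e * f = f * e"
    "\<And>e f. e \<in> E \<Longrightarrow> f \<in> E \<Longrightarrow> e * f \<in> E"
  defines "R \<equiv> \<lparr>carrier = mult_closure (*) G, mul = (*)\<rparr>"
  shows "inverse_semigroup R" "\<And>w. w \<in> carrier R \<Longrightarrow> inverse_in R w = star w"
proof -
  let ?R = "mult_closure (*) G"
  have mult: "v * w \<in> ?R" if "v \<in> ?R" "w \<in> ?R" for v w
    by (rule mult_closure_mult[OF _ _ _ that, where C = UNIV]) (simp_all add: mult.assoc)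
  have star_R: "star w \<in> ?R" if "w \<in> ?R" for w
    using that by induction (auto intro: mult_closure.base star mult)
  have GE: "g * star g \<in> E" if "g \<in> G" for g using G(2)[OF star[OF that]] by simp
  have ww: "w * star w \<in> E" if "w \<in> ?R" for w
    using that
  proof induction
    case (step g w)
    thus ?case using G(3)[of g "w * star w"] by (simp add: mult.assoc)
  qed (rule GE)
  have ww': "star w * w \<in> E" if "w \<in> ?R" for w using ww[OF star_R[OF that]] by simp
  have www: "w * star w * w = w" if "w \<in> ?R" for w
    using that
  proof induction
    case (step g w)
    have "g * w * star (g * w) * (g * w) = g * ((w * star w) * (star g * g)) * w" by (simp add: mult.assoc)
    also have "\<dots> = g * ((star g * g) * (w * star w)) * w"
      using E(2)[OF ww[OF step(2)] G(2)[OF step(1)]] by simp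
    also have "\<dots> = (g * star g * g) * (w * star w * w)" by (simp add: mult.assoc)
    also have "\<dots> = g * w" using step G(1) by simp
    finally show ?case .
  qed (rule G(1))
  have idem: "x \<in> E" if x: "x \<in> ?R" "x * x = x" for x
  proof -
    have "star x = star x * x * star x" using www[OF star_R[OF x(1)]] by simp
    also have "\<dots> = (star x * x) * (x * star x)" using x(2) by (metis mult.assoc)
    finally have "star x \<in> E" using E(3)[OF ww'[OF x(1)] ww[OF x(1)]] by simp
    thus ?thesis using E(1) by fastforce
  qed
  have unique: "t = star w" if w: "w \<in> ?R" and t: "t \<in> ?R" "w * t * w = w" "t * w * t = t" for w t
  proof -
    have wt: "w * t \<in> E" "t * w \<in> E"
      by (rule idem, rule mult[OF w t(1)], metis t(2) mult.assoc,
        rule idem, rule mult[OF t(1) w], metis t(3) mult.assoc)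
    have "t = t * (w * star w * w) * t" using t(3) www[OF w] by simp
    also have "\<dots> = (t * w) * (star w * w) * t" by (simp add: mult.assoc)
    also have "\<dots> = (star w * w) * (t * w) * t" using E(2)[OF wt(2) ww'[OF w]] by simp
    also have "\<dots> = star w * w * (t * w * t)" by (simp add: mult.assoc)
    also have "\<dots> = star w * (w * star w * w) * t" using www[OF w] t(3) by simp
    also have "\<dots> = star w * ((w * star w) * (w * t))" by (simp add: mult.assoc)
    also have "\<dots> = star w * ((w * t) * (w * star w))" using E(2)[OF wt(1) ww[OF w]] by simp
    also have "\<dots> = star w * (w * t * w) * star w" by (simp add: mult.assoc)
    also have "\<dots> = star w" using t(2) www[OF star_R[OF w]] by simp
    finally show ?thesis .
  qed
  have inv: "is_inverse_of R w (star w)" if "w \<in> ?R" for w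
    using that star_R www[OF that] www[OF star_R[OF that]] by (simp add: R_def is_inverse_of_def)
  have uni: "t = star w" if "w \<in> ?R" "is_inverse_of R w t" for w t
    using unique[OF that(1)] that(2) by (simp add: R_def is_inverse_of_def)
  show R: "inverse_semigroup R"
    unfolding inverse_semigroup_def
  proof (intro conjI ballI)
    show "carrier R \<noteq> {}" using ne mult_closure.base by (fastforce simp: R_def)
    show "\<exists>!t. is_inverse_of R w t" if "w \<in> carrier R" for w
      using that inv uni by (metis R_def semigroup_on.select_convs(1))
  qed (simp_all add: R_def mult mult.assoc)
  show "inverse_in R w = star w" if "w \<in> carrier R" for w
    using inverse_semigroup_on.inv_unique[of R w] R that inv[of w]
    by (simp add: inverse_semigroup_on_def R_def)
qed

lemma star_multiplicative_idempotents:
  assumes S: "inverse_semigroup S" and \<theta>: "star_multiplicative S \<theta>"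
  defines "E \<equiv> \<theta> ` idempotents S"
  shows "\<And>s. s \<in> carrier S \<Longrightarrow> \<theta> s * star (\<theta> s) * \<theta> s = \<theta> s"
    "\<And>s. s \<in> carrier S \<Longrightarrow> star (\<theta> s) * \<theta> s \<in> E"
    "\<And>s e. s \<in> carrier S \<Longrightarrow> e \<in> E \<Longrightarrow> \<theta> s * e * star (\<theta> s) \<in> E"
    "\<And>e. e \<in> E \<Longrightarrow> star e = e" "\<And>e f. e \<in> E \<Longrightarrow> f \<in> E \<Longrightarrow> e * f = f * e"
    "\<And>e f. e \<in> E \<Longrightarrow> f \<in> E \<Longrightarrow> e * f \<in> E"
proof -
  interpret inverse_semigroup_on S by unfold_locales fact
  have m: "\<And>x y. x \<in> carrier S \<Longrightarrow> y \<in> carrier S \<Longrightarrow> \<theta> x * \<theta> y = \<theta> (x \<cdot> y)"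
    "\<And>x. x \<in> carrier S \<Longrightarrow> star (\<theta> x) = \<theta> (inv x)"
    using \<theta> by (auto simp: star_multiplicative_def)
  show "\<theta> s * star (\<theta> s) * \<theta> s = \<theta> s" "star (\<theta> s) * \<theta> s \<in> E" if s: "s \<in> carrier S" for s
    using s by (simp_all add: m inv_closed closed inv_cancel inv_mult_idempotent E_def)
  show "\<theta> s * e * star (\<theta> s) \<in> E" if s: "s \<in> carrier S" "e \<in> E" for s e
    using s idempotent_conjugate[OF s(1)] by (auto simp: E_def m inv_closed closed idempotentD)
  show "star e = e" if "e \<in> E" for e
    using that by (auto simp: E_def m(2) idempotentD inv_idempotent)
  show "e * f = f * e" "e * f \<in> E" if ef: "e \<in> E" "f \<in> E" for e f
  proof -
    obtain x y where xy: "x \<in> idempotents S" "e = \<theta> x" "y \<in> idempotents S" "f = \<theta> y"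
      using ef by (auto simp: E_def)
    show "e * f = f * e" using xy idempotent_commute[of x y] by (simp add: m idempotentD)
    show "e * f \<in> E" using xy idempotent_mult[of x y] by (auto simp: m idempotentD E_def)
  qed
qed

section \<open>The amalgamated free product of semigroups\<close>

lemma free_product_lift:
  fixes R :: "'r semigroup_on"
  assumes "semigroup_free_product TYPE('r) S1 S2 U i1 i2 T \<psi>1 \<psi>2" "inverse_semigroup R"
    "semigroup_hom S1 R \<phi>1" "semigroup_hom S2 R \<phi>2" "\<And>u. u \<in> carrier U \<Longrightarrow> \<phi>1 (i1 u) = \<phi>2 (i2 u)"
  shows "\<exists>!l. l \<in> extensional (carrier T) \<and> semigroup_hom T R l \<and>
    (\<forall>s\<in>carrier S1. l (\<psi>1 s) = \<phi>1 s) \<and> (\<forall>s\<in>carrier S2. l (\<psi>2 s) = \<phi>2 s)"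
  using assms unfolding semigroup_free_product_def by blast

text \<open>The generated part is an inverse semigroup on the same type, hence a legitimate test
  object. The map from \<open>T\<close> into it and the identity of \<open>T\<close> extend the same
  data, so they coincide and every element is a word.\<close>

lemma free_product_generated:
  fixes T :: "'t semigroup_on"
  assumes S: "inverse_semigroup S1" "inverse_semigroup S2"
    and free: "semigroup_free_product TYPE('t) S1 S2 U i1 i2 T \<psi>1 \<psi>2"
  shows "carrier T = mult_closure (mul T) (\<psi>1 ` carrier S1 \<union> \<psi>2 ` carrier S2)"
proof -
  define G where "G = \<psi>1 ` carrier S1 \<union> \<psi>2 ` carrier S2"
  let ?C = "mult_closure (mul T) G"
  let ?T' = "\<lparr>carrier = ?C, mul = mul T\<rparr>"
  have T: "inverse_semigroup T" and \<psi>: "semigroup_hom S1 T \<psi>1" "semigroup_hom S2 T \<psi>2"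
    and amalgam: "\<And>u. u \<in> carrier U \<Longrightarrow> \<psi>1 (i1 u) = \<psi>2 (i2 u)"
    using free unfolding semigroup_free_product_def by blast+
  interpret T: inverse_semigroup_on T by unfold_locales fact
  interpret S1: inverse_semigroup_on S1 by unfold_locales fact
  interpret S2: inverse_semigroup_on S2 by unfold_locales fact
  have G: "G \<subseteq> carrier T" using \<psi> by (auto simp: G_def semigroup_hom_def)
  have sub: "x \<in> carrier T" if "x \<in> ?C" for x
    using that by induction (use G T.closed in auto)
  have mult: "mul T x y \<in> ?C" if "x \<in> ?C" "y \<in> ?C" for x y
    by (rule mult_closure_mult[OF T.assoc T.closed G that])
  have inv_G: "inverse_in T g \<in> G" if g: "g \<in> G" for g
  proof -
    from g consider s where "s \<in> carrier S1" "g = \<psi>1 s" | s where "s \<in> carrier S2" "g = \<psi>2 s"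
      unfolding G_def by blast
    thus ?thesis
    proof cases
      case 1
      thus ?thesis
        using S1.inv_closed[OF 1(1)]
        unfolding 1(2) G_def semigroup_hom_inverse[OF S(1) T \<psi>(1) 1(1), symmetric] by blast
    next
      case 2
      thus ?thesis
        using S2.inv_closed[OF 2(1)]
        unfolding 2(2) G_def semigroup_hom_inverse[OF S(2) T \<psi>(2) 2(1), symmetric] by blast
    qed
  qed
  have inv: "inverse_in T x \<in> ?C" if "x \<in> ?C" for x
    using that
  proof induction
    case (base g)
    thus ?case by (intro mult_closure.base inv_G)
  next
    case (step g w)
    have "inverse_in T g \<in> G" by (rule inv_G[OF step(1)])
    hence "mul T (inverse_in T w) (inverse_in T g) \<in> ?C"
      by (intro mult step mult_closure.base)
    moreover have "inverse_in T (mul T g w) = mul T (inverse_in T w) (inverse_in T g)"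
      using step G sub by (intro T.inv_mult) auto
    ultimately show ?case by simp
  qed
  have T': "inverse_semigroup ?T'"
    unfolding inverse_semigroup_def
  proof (intro conjI ballI)
    obtain s where "s \<in> carrier S1" using S(1) by (auto simp: inverse_semigroup_def)
    hence "\<psi>1 s \<in> ?C" by (intro mult_closure.base) (simp add: G_def)
    thus "carrier ?T' \<noteq> {}" by auto
    fix x assume "x \<in> carrier ?T'"
    hence x: "x \<in> ?C" by simp
    show "\<exists>!t. is_inverse_of ?T' x t"
    proof
      show "is_inverse_of ?T' x (inverse_in T x)"
        using inv[OF x] T.inv_cancel[OF sub[OF x]] by (simp add: is_inverse_of_def)
      show "t = inverse_in T x" if "is_inverse_of ?T' x t" for t
        using that sub x by (intro T.inv_unique[symmetric]) (auto simp: is_inverse_of_def)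
    qed
  qed (simp_all add: mult T.assoc sub)
  have hom': "semigroup_hom S1 ?T' \<psi>1" "semigroup_hom S2 ?T' \<psi>2"
    using \<psi> by (auto simp: semigroup_hom_def G_def intro: mult_closure.base)
  obtain l where l: "semigroup_hom T ?T' l" "l \<in> extensional (carrier T)"
    "\<forall>s\<in>carrier S1. l (\<psi>1 s) = \<psi>1 s" "\<forall>s\<in>carrier S2. l (\<psi>2 s) = \<psi>2 s"
    using free_product_lift[OF free T' hom' amalgam] by blast
  \<comment> \<open>Uniqueness holds among functions extensional on the carrier, hence the
    restriction.\<close>
  let ?id = "restrict (\<lambda>x. x) (carrier T)"
  have "semigroup_hom T T ?id" by (auto simp: semigroup_hom_def T.closed)
  moreover have "semigroup_hom T T l" using l(1) sub by (auto simp: semigroup_hom_def)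
  moreover have "\<forall>s\<in>carrier S1. ?id (\<psi>1 s) = \<psi>1 s" "\<forall>s\<in>carrier S2. ?id (\<psi>2 s) = \<psi>2 s"
    using \<psi> by (auto simp: semigroup_hom_def)
  ultimately have "?id = l" using free_product_lift[OF free T \<psi> amalgam] l by (metis restrict_extensional)
  hence "x \<in> ?C" if "x \<in> carrier T" for x
    using l(1) that by (metis (no_types, lifting) image_subset_iff restrict_apply' semigroup_hom_def semigroup_on.select_convs(1))
  thus ?thesis using sub by (auto simp: G_def)
qed

section \<open>The isomorphism\<close>

lemma cstar_isomorphismI:
  "star_hom f \<Longrightarrow> g \<circ> f = id \<Longrightarrow> f \<circ> g = id \<Longrightarrow> cstar_isomorphism f"
  unfolding cstar_isomorphism_def by (blast intro: o_bij)

lemma star_hom_id: "star_hom (id :: 'a::cstar_algebra \<Rightarrow> 'a)"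
  by (simp add: star_hom_def clinear_def)

lemma star_hom_compose: "star_hom f \<Longrightarrow> star_hom g \<Longrightarrow> star_hom (f \<circ> g)"
  by (simp add: star_hom_def clinear_def)

text \<open>Each test type has its task: \<open>'t\<close> shows that \<open>T\<close> is generated
  by the factors, \<open>'p\<close> receives \<open>T\<close> and settles the composite on the free
  product, \<open>'ct\<close> provides the map back. The inclusions for the sets \<open>Z\<close>
  let zeros be respected in both directions, and hold trivially when all of them are empty.\<close>

theorem relative_amalgamated_isomorphism:
  fixes kU :: "'u \<Rightarrow> 'cu::cstar_algebra" and k1 :: "'a \<Rightarrow> 'c1::cstar_algebra"
    and k2 :: "'b \<Rightarrow> 'c2::cstar_algebra" and kT :: "'t \<Rightarrow> 'ct::cstar_algebra"
    and \<eta>1 :: "'c1 \<Rightarrow> 'p::cstar_algebra"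
    and \<iota>1 :: "'c1 \<Rightarrow> 'i" and \<iota>2 :: "'c2 \<Rightarrow> 'i" and \<iota>T :: "'ct \<Rightarrow> 'i" and \<iota>P :: "'p \<Rightarrow> 'i"
  assumes full: "full_amalgam S1 S2 U i1 i2"
    and free_t: "semigroup_free_product TYPE('t) S1 S2 U i1 i2 T \<psi>1 \<psi>2"
    and free_p: "semigroup_free_product TYPE('p) S1 S2 U i1 i2 T \<psi>1 \<psi>2"
    and inj: "inj \<iota>1" "inj \<iota>2" "inj \<iota>T" "inj \<iota>P"
    and U: "relative_cstar_algebra TYPE('i ell2) ZU U kU"
    and rel: "relative_cstar_algebra TYPE('i ell2) Z1 S1 k1" "relative_cstar_algebra TYPE('i ell2) Z2 S2 k2"
    and T: "relative_cstar_algebra TYPE('i ell2) ZT T kT"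
    and j: "induced_hom U i1 kU k1 j1" "induced_hom U i2 kU k2 j2"
    and prod_t: "cstar_free_product TYPE('ct) j1 j2 \<eta>1 \<eta>2"
    and prod_p: "cstar_free_product TYPE('p) j1 j2 \<eta>1 \<eta>2"
    and Z: "\<psi>1 ` Z1 \<subseteq> ZT" "\<psi>2 ` Z2 \<subseteq> ZT" "ZT \<subseteq> \<psi>1 ` (Z1 \<inter> carrier S1)"
  shows "\<exists>f :: 'ct \<Rightarrow> 'p. cstar_isomorphism f"
proof -
  have S: "inverse_semigroup S1" "inverse_semigroup S2"
    and i: "\<And>u. u \<in> carrier U \<Longrightarrow> i1 u \<in> carrier S1" "\<And>u. u \<in> carrier U \<Longrightarrow> i2 u \<in> carrier S2"
    and E_eq: "i1 ` idempotents U = idempotents S1" "i2 ` idempotents U = idempotents S2"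
    using full by (auto simp: full_amalgam_def amalgam_def semigroup_hom_def)
  have iT: "inverse_semigroup T" and \<psi>: "semigroup_hom S1 T \<psi>1" "semigroup_hom S2 T \<psi>2"
    and \<psi>_i: "\<And>u. u \<in> carrier U \<Longrightarrow> \<psi>1 (i1 u) = \<psi>2 (i2 u)"
    using free_p unfolding semigroup_free_product_def by blast+
  interpret S1: inverse_semigroup_on S1 by unfold_locales fact
  interpret S2: inverse_semigroup_on S2 by unfold_locales fact
  interpret T: inverse_semigroup_on T by unfold_locales fact
  have k: "star_multiplicative S1 k1" "star_multiplicative S2 k2" "star_multiplicative T kT"
    and k_zero: "\<And>z. z \<in> Z1 \<Longrightarrow> k1 z = 0" "\<And>z. z \<in> ZT \<Longrightarrow> kT z = 0"
    using rel T by (auto simp: relative_cstar_algebra_def)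
  have jh: "star_hom j1" "star_hom j2" and jk: "\<And>u. u \<in> carrier U \<Longrightarrow> j1 (kU u) = k1 (i1 u)"
    "\<And>u. u \<in> carrier U \<Longrightarrow> j2 (kU u) = k2 (i2 u)"
    using j by (auto simp: induced_hom_def)
  have \<eta>: "star_hom \<eta>1" "star_hom \<eta>2" "\<eta>1 \<circ> j1 = \<eta>2 \<circ> j2" using prod_p by (auto simp: cstar_free_product_def)

  define \<theta>1 where "\<theta>1 s = \<eta>1 (k1 s)" for s
  define \<theta>2 where "\<theta>2 s = \<eta>2 (k2 s)" for s
  have \<theta>: "star_multiplicative S1 \<theta>1" "star_multiplicative S2 \<theta>2"
    unfolding \<theta>1_def[abs_def] \<theta>2_def[abs_def]
    by (rule star_multiplicative_star_hom[OF \<eta>(1) k(1)], rule star_multiplicative_star_hom[OF \<eta>(2) k(2)])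
  have \<theta>_i: "\<theta>1 (i1 u) = \<theta>2 (i2 u)" if "u \<in> carrier U" for u
    using fun_cong[OF \<eta>(3), of "kU u"] by (simp add: \<theta>1_def \<theta>2_def jk that)
  define E where "E = \<theta>1 ` idempotents S1"
  \<comment> \<open>The only appeal to fullness: all idempotents of the factors come from
    \<open>U\<close>, where the two maps agree.\<close>
  have E2: "E = \<theta>2 ` idempotents S2"
    unfolding E_def E_eq[symmetric] image_image using \<theta>_i by (intro image_cong) (auto simp: idempotents_def)
  define G where "G = \<theta>1 ` carrier S1 \<union> \<theta>2 ` carrier S2"
  define R where "R = \<lparr>carrier = mult_closure (*) G, mul = (*)\<rparr>"
  note p1 = star_multiplicative_idempotents[OF S(1) \<theta>(1), folded E_def]
    and p2 = star_multiplicative_idempotents[OF S(2) \<theta>(2), folded E2]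
  have "carrier S1 \<noteq> {}" using S(1) by (simp add: inverse_semigroup_def)
  hence ne: "G \<noteq> {}" by (simp add: G_def)
  have star_G: "star g \<in> G" if "g \<in> G" for g
  proof -
    have "star (\<theta>1 s) = \<theta>1 (inverse_in S1 s)" if "s \<in> carrier S1" for s
      using \<theta>(1) that by (simp add: star_multiplicative_def)
    moreover have "star (\<theta>2 s) = \<theta>2 (inverse_in S2 s)" if "s \<in> carrier S2" for s
      using \<theta>(2) that by (simp add: star_multiplicative_def)
    ultimately show ?thesis using that S1.inv_closed S2.inv_closed by (auto simp: G_def)
  qed
  have G: "\<And>g. g \<in> G \<Longrightarrow> g * star g * g = g" "\<And>g. g \<in> G \<Longrightarrow> star g * g \<in> E"
    "\<And>g e. g \<in> G \<Longrightarrow> e \<in> E \<Longrightarrow> g * e * star g \<in> E"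
    using p1(1,2,3) p2(1,2,3) unfolding G_def by blast+
  note R = inverse_semigroup_of_partial_isometries[OF ne star_G G p1(4,5,6), folded R_def]
  have \<theta>_R: "semigroup_hom S1 R \<theta>1" "semigroup_hom S2 R \<theta>2"
    using \<theta> by (auto simp: semigroup_hom_def R_def star_multiplicative_def G_def intro: mult_closure.base)
  obtain l where l: "semigroup_hom T R l" "\<And>s. s \<in> carrier S1 \<Longrightarrow> l (\<psi>1 s) = \<theta>1 s"
    "\<And>s. s \<in> carrier S2 \<Longrightarrow> l (\<psi>2 s) = \<theta>2 s"
    using free_product_lift[OF free_p R(1) \<theta>_R \<theta>_i] by blast
  have l_star: "star_multiplicative T l"
    unfolding star_multiplicative_def
    using l(1) semigroup_hom_inverse[OF iT R(1) l(1)] R(2)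
    by (auto simp: semigroup_hom_def R_def image_subset_iff)
  have l_zero: "l z = 0" if z: "z \<in> ZT" for z
  proof -
    obtain y where "y \<in> Z1" "y \<in> carrier S1" "z = \<psi>1 y" using Z(3) z by auto
    moreover have "\<eta>1 0 = 0" using \<eta>(1) clinear_simps(3) by (auto simp: star_hom_def)
    ultimately show ?thesis using l(2) k_zero(1) by (simp add: \<theta>1_def)
  qed
  obtain f where f: "star_hom f" "\<And>t. t \<in> carrier T \<Longrightarrow> f (kT t) = l t"
    using relative_algebra_extension[OF T inj(3,4) l_star l_zero T.closed T.inv_closed] by blast

  have kZ: "kT (\<psi>1 z) = 0" if "z \<in> Z1" for z using that Z k_zero by auto
  have kZ2: "kT (\<psi>2 z) = 0" if "z \<in> Z2" for z using that Z k_zero by auto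
  obtain g1 where g1: "star_hom g1" "\<And>s. s \<in> carrier S1 \<Longrightarrow> g1 (k1 s) = kT (\<psi>1 s)"
    using relative_algebra_extension[OF rel(1) inj(1,3) star_multiplicative_hom[OF S(1) iT \<psi>(1) k(3)]
        kZ S1.closed S1.inv_closed] by blast
  obtain g2 where g2: "star_hom g2" "\<And>s. s \<in> carrier S2 \<Longrightarrow> g2 (k2 s) = kT (\<psi>2 s)"
    using relative_algebra_extension[OF rel(2) inj(2,3) star_multiplicative_hom[OF S(2) iT \<psi>(2) k(3)]
        kZ2 S2.closed S2.inv_closed] by blast
  have "g1 \<circ> j1 = g2 \<circ> j2"
    by (rule star_hom_eqI[OF U inj(3)]) (auto simp: star_hom_compose g1 g2 jh jk i \<psi>_i)
  then obtain g where g: "star_hom g" "g \<circ> \<eta>1 = g1" "g \<circ> \<eta>2 = g2"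
    using prod_t g1(1) g2(1) unfolding cstar_free_product_def by blast

  \<comment> \<open>Both sides are multiplicative in \<open>t\<close>, so it suffices that
    \<open>T\<close> consists of words in the images of the factors.\<close>
  have gl: "g (l t) = kT t" if "t \<in> carrier T" for t
  proof -
    have gen: "g (l x) = kT x" if "x \<in> \<psi>1 ` carrier S1 \<union> \<psi>2 ` carrier S2" for x
      using that l(2,3) fun_cong[OF g(2)] fun_cong[OF g(3)] g1(2) g2(2) by (auto simp: \<theta>1_def \<theta>2_def)
    have T_eq: "carrier T = mult_closure (mul T) (\<psi>1 ` carrier S1 \<union> \<psi>2 ` carrier S2)"
      by (rule free_product_generated[OF S free_t])
    have sub: "x \<in> carrier T" if "x \<in> \<psi>1 ` carrier S1 \<union> \<psi>2 ` carrier S2" for x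
      using that \<psi> by (auto simp: semigroup_hom_def)
    have mg: "star_multiplicative T (\<lambda>t. g (l t))" by (rule star_multiplicative_star_hom[OF g(1) l_star])
    have "t \<in> mult_closure (mul T) (\<psi>1 ` carrier S1 \<union> \<psi>2 ` carrier S2)" using that T_eq by simp
    thus ?thesis
    proof induction
      case (step x w)
      hence "x \<in> carrier T" "w \<in> carrier T" using sub T_eq by blast+
      thus ?case using step.IH gen[OF step.hyps(1)] mg k(3) by (simp add: star_multiplicative_def)
    qed (rule gen)
  qed
  have gf: "g \<circ> f = id"
    by (rule star_hom_eqI[OF T inj(3)]) (auto simp: star_hom_compose star_hom_id f g gl)
  have "f \<circ> g1 = \<eta>1" "f \<circ> g2 = \<eta>2"
    using \<psi> by (auto intro!: star_hom_eqI[OF rel(1) inj(4)] star_hom_eqI[OF rel(2) inj(4)] star_hom_compose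
        f(1) g1(1) g2(1) \<eta> simp: g1(2) g2(2) f(2) l semigroup_hom_def image_subset_iff \<theta>1_def \<theta>2_def)
  hence "(f \<circ> g) \<circ> \<eta>1 = \<eta>1" "(f \<circ> g) \<circ> \<eta>2 = \<eta>2" using g by (simp_all add: o_assoc[symmetric])
  moreover have "\<exists>!h. star_hom h \<and> h \<circ> \<eta>1 = \<eta>1 \<and> h \<circ> \<eta>2 = \<eta>2"
    using prod_p \<eta> unfolding cstar_free_product_def by blast
  ultimately have "f \<circ> g = id" using star_hom_compose[OF f(1) g(1)] star_hom_id by (metis id_o)
  thus ?thesis using cstar_isomorphismI[OF f(1) gf] by blast
qed

section \<open>The universal and the contracted case\<close>

lemma relative_if_universal:
  "universal_cstar_algebra (H :: 'h::complex_hilbert_space itself) S k \<Longrightarrow>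
    relative_cstar_algebra TYPE('h) {} S k"
  by (simp add: universal_cstar_algebra_def relative_cstar_algebra_def star_monomorphism_def
      star_multiplicative_def)

lemma relative_if_contracted:
  "contracted_cstar_algebra (H :: 'h::complex_hilbert_space itself) S k \<Longrightarrow>
    relative_cstar_algebra TYPE('h) {z. is_zero_of S z} S k"
  by (simp add: contracted_cstar_algebra_def relative_cstar_algebra_def star_monomorphism_def
      star_multiplicative_def)

lemma Collect_is_zero_of: "is_zero_of S z \<Longrightarrow> {x. is_zero_of S x} = {z}"
  unfolding is_zero_of_def by auto

text \<open>An element that absorbs all generators from both sides absorbs all words. This
  identifies the zero that the contracted algebra of \<open>T\<close> has to annihilate.\<close>

lemma free_product_zero:
  fixes T :: "'t semigroup_on"
  assumes S: "inverse_semigroup S1" "inverse_semigroup S2"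
    and free: "semigroup_free_product TYPE('t) S1 S2 U i1 i2 T \<psi>1 \<psi>2"
    and z: "is_zero_of U z" "is_zero_of S1 (i1 z)" "is_zero_of S2 (i2 z)"
  shows "is_zero_of T (\<psi>1 (i1 z))" "\<psi>1 (i1 z) = \<psi>2 (i2 z)"
proof -
  have T: "inverse_semigroup T" and \<psi>: "semigroup_hom S1 T \<psi>1" "semigroup_hom S2 T \<psi>2"
    and \<psi>_i: "\<forall>u\<in>carrier U. \<psi>1 (i1 u) = \<psi>2 (i2 u)"
    using free unfolding semigroup_free_product_def by blast+
  interpret T: inverse_semigroup_on T by unfold_locales fact
  show eq: "\<psi>1 (i1 z) = \<psi>2 (i2 z)" using z(1) \<psi>_i by (simp add: is_zero_of_def)
  define zT where "zT = \<psi>1 (i1 z)"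
  have c: "zT \<in> carrier T" using z(2) \<psi>(1) by (auto simp: zT_def is_zero_of_def semigroup_hom_def)
  have gen: "mul T zT x = zT \<and> mul T x zT = zT \<and> x \<in> carrier T" if "x \<in> \<psi>1 ` carrier S1 \<union> \<psi>2 ` carrier S2" for x
    using that
  proof
    assume "x \<in> \<psi>1 ` carrier S1"
    then obtain s where "s \<in> carrier S1" "x = \<psi>1 s" by blast
    thus ?thesis using z(2) \<psi>(1) unfolding zT_def is_zero_of_def semigroup_hom_def
      by (metis image_subset_iff)
  next
    assume "x \<in> \<psi>2 ` carrier S2"
    then obtain s where "s \<in> carrier S2" "x = \<psi>2 s" by blast
    thus ?thesis using z(3) \<psi>(2) unfolding zT_def eq is_zero_of_def semigroup_hom_def
      by (metis image_subset_iff)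
  qed
  have T_eq: "carrier T = mult_closure (mul T) (\<psi>1 ` carrier S1 \<union> \<psi>2 ` carrier S2)"
    by (rule free_product_generated[OF S free])
  have "mul T zT t = zT \<and> mul T t zT = zT" if "t \<in> mult_closure (mul T) (\<psi>1 ` carrier S1 \<union> \<psi>2 ` carrier S2)" for t
    using that
  proof induction
    case (base g)
    thus ?case using gen by blast
  next
    case (step g w)
    have g: "mul T zT g = zT" "mul T g zT = zT" "g \<in> carrier T" using gen[OF step(1)] by blast+
    have w: "w \<in> carrier T" using step(2) T_eq by blast
    show ?case using g w step(3) c T.assoc[of zT g w] T.assoc[of g w zT] by simp
  qed
  hence "\<forall>t\<in>carrier T. mul T zT t = zT \<and> mul T t zT = zT" using T_eq by blast
  thus "is_zero_of T (\<psi>1 (i1 z))" using c by (simp add: is_zero_of_def zT_def)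
qed

theorem theorem4:
  fixes S1 :: "'a semigroup_on" and S2 :: "'b semigroup_on" and U :: "'u semigroup_on"
    and i1 :: "'u \<Rightarrow> 'a" and i2 :: "'u \<Rightarrow> 'b"
    and T :: "'t semigroup_on" and \<psi>1 :: "'a \<Rightarrow> 't" and \<psi>2 :: "'b \<Rightarrow> 't"
    \<comment> \<open>C*-algebras of \<open>U\<close>, \<open>S1\<close>, \<open>S2\<close>, \<open>T\<close> and the free product \<open>'p\<close>\<close>
    and kU :: "'u \<Rightarrow> 'cu::cstar_algebra" and k1 :: "'a \<Rightarrow> 'c1::cstar_algebra"
    and k2 :: "'b \<Rightarrow> 'c2::cstar_algebra" and kT :: "'t \<Rightarrow> 'ct::cstar_algebra"
    and j1 :: "'cu \<Rightarrow> 'c1" and j2 :: "'cu \<Rightarrow> 'c2"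
    and \<eta>1 :: "'c1 \<Rightarrow> 'p::cstar_algebra" and \<eta>2 :: "'c2 \<Rightarrow> 'p"
    and H :: "('cu \<times> 'c1 \<times> 'c2 \<times> 'ct \<times> 'p) ell2 itself"
    \<comment> \<open>contracted C*-algebras of \<open>U\<close>, \<open>S1\<close>, \<open>S2\<close>, \<open>T\<close> and the free product \<open>'q\<close>\<close>
    and lU :: "'u \<Rightarrow> 'du::cstar_algebra" and l1 :: "'a \<Rightarrow> 'd1::cstar_algebra"
    and l2 :: "'b \<Rightarrow> 'd2::cstar_algebra" and lT :: "'t \<Rightarrow> 'dt::cstar_algebra"
    and m1 :: "'du \<Rightarrow> 'd1" and m2 :: "'du \<Rightarrow> 'd2"
    and \<theta>1 :: "'d1 \<Rightarrow> 'q::cstar_algebra" and \<theta>2 :: "'d2 \<Rightarrow> 'q"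
    and H0 :: "('du \<times> 'd1 \<times> 'd2 \<times> 'dt \<times> 'q) ell2 itself"
  assumes "full_amalgam S1 S2 U i1 i2"
    and "semigroup_free_product TYPE('t) S1 S2 U i1 i2 T \<psi>1 \<psi>2"
    and "semigroup_free_product TYPE('p) S1 S2 U i1 i2 T \<psi>1 \<psi>2"
    and "semigroup_free_product TYPE('q) S1 S2 U i1 i2 T \<psi>1 \<psi>2"
  shows
    "(universal_cstar_algebra H U kU \<and> universal_cstar_algebra H S1 k1 \<and>
      universal_cstar_algebra H S2 k2 \<and> universal_cstar_algebra H T kT \<and>
      induced_hom U i1 kU k1 j1 \<and> induced_hom U i2 kU k2 j2 \<and>
      cstar_free_product TYPE('ct) j1 j2 \<eta>1 \<eta>2 \<and> cstar_free_product TYPE('p) j1 j2 \<eta>1 \<eta>2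
      \<longrightarrow> (\<exists>f :: 'ct \<Rightarrow> 'p. cstar_isomorphism f))
     \<and>
     ((\<exists>z. is_zero_of U z \<and> is_zero_of S1 (i1 z) \<and> is_zero_of S2 (i2 z)) \<and>
      contracted_cstar_algebra H0 U lU \<and> contracted_cstar_algebra H0 S1 l1 \<and>
      contracted_cstar_algebra H0 S2 l2 \<and> contracted_cstar_algebra H0 T lT \<and>
      induced_hom U i1 lU l1 m1 \<and> induced_hom U i2 lU l2 m2 \<and>
      cstar_free_product TYPE('dt) m1 m2 \<theta>1 \<theta>2 \<and> cstar_free_product TYPE('q) m1 m2 \<theta>1 \<theta>2
      \<longrightarrow> (\<exists>f :: 'dt \<Rightarrow> 'q. cstar_isomorphism f))"
proof (intro conjI impI, goal_cases)
  case 1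
  let ?I = "TYPE(('cu \<times> 'c1 \<times> 'c2 \<times> 'ct \<times> 'p) ell2)"
  have rel: "relative_cstar_algebra ?I {} U kU" "relative_cstar_algebra ?I {} S1 k1"
    "relative_cstar_algebra ?I {} S2 k2" "relative_cstar_algebra ?I {} T kT"
    using 1 by (auto intro: relative_if_universal)
  \<comment> \<open>Each algebra enters the index type of the test space through its own coordinate,
    with arbitrary fixed values elsewhere.\<close>
  have inj: "inj (\<lambda>x. (undefined::'cu, x::'c1, undefined::'c2, undefined::'ct, undefined::'p))"
    "inj (\<lambda>x. (undefined::'cu, undefined::'c1, x::'c2, undefined::'ct, undefined::'p))"
    "inj (\<lambda>x. (undefined::'cu, undefined::'c1, undefined::'c2, x::'ct, undefined::'p))"
    "inj (\<lambda>x. (undefined::'cu, undefined::'c1, undefined::'c2, undefined::'ct, x::'p))"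
    by (auto intro: injI)
  have j: "induced_hom U i1 kU k1 j1" "induced_hom U i2 kU k2 j2"
    "cstar_free_product TYPE('ct) j1 j2 \<eta>1 \<eta>2" "cstar_free_product TYPE('p) j1 j2 \<eta>1 \<eta>2"
    using 1 by blast+
  show ?case by (rule relative_amalgamated_isomorphism[OF assms(1-3) inj rel j]) auto
next
  case 2
  let ?I = "TYPE(('du \<times> 'd1 \<times> 'd2 \<times> 'dt \<times> 'q) ell2)"
  have S: "inverse_semigroup S1" "inverse_semigroup S2"
    using assms(1) by (simp_all add: full_amalgam_def amalgam_def)
  obtain z where z: "is_zero_of U z" "is_zero_of S1 (i1 z)" "is_zero_of S2 (i2 z)" using 2 by blast
  note zT = free_product_zero[OF S assms(2) z]
  have rel: "relative_cstar_algebra ?I {z. is_zero_of U z} U lU" "relative_cstar_algebra ?I {z. is_zero_of S1 z} S1 l1"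
    "relative_cstar_algebra ?I {z. is_zero_of S2 z} S2 l2" "relative_cstar_algebra ?I {z. is_zero_of T z} T lT"
    using 2 by (auto intro: relative_if_contracted)
  have inj: "inj (\<lambda>x. (undefined::'du, x::'d1, undefined::'d2, undefined::'dt, undefined::'q))"
    "inj (\<lambda>x. (undefined::'du, undefined::'d1, x::'d2, undefined::'dt, undefined::'q))"
    "inj (\<lambda>x. (undefined::'du, undefined::'d1, undefined::'d2, x::'dt, undefined::'q))"
    "inj (\<lambda>x. (undefined::'du, undefined::'d1, undefined::'d2, undefined::'dt, x::'q))"
    by (auto intro: injI)
  \<comment> \<open>Zeros are unique, so the three inclusions between the sets \<open>Z\<close>
    reduce to the equality of the two images of \<open>z\<close> in \<open>T\<close> and to
    membership of \<open>i1 z\<close> in the carrier.\<close>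
  note Z = z(2,3)[THEN Collect_is_zero_of] zT(1)[THEN Collect_is_zero_of]
  have iz: "i1 z \<in> carrier S1" using z(2) by (simp add: is_zero_of_def)
  have m: "induced_hom U i1 lU l1 m1" "induced_hom U i2 lU l2 m2"
    "cstar_free_product TYPE('dt) m1 m2 \<theta>1 \<theta>2" "cstar_free_product TYPE('q) m1 m2 \<theta>1 \<theta>2"
    using 2 by blast+
  show ?case
    by (rule relative_amalgamated_isomorphism[OF assms(1,2,4) inj rel m]) (use zT(2) iz in \<open>simp_all add: Z\<close>)
qed

end
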